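(* Let $n\ge 1$. Then: (i) the Frobenius character of the $\mathfrak{S}_n$-module $\mathbb{C}[\mathrm{OShPf}(n)]$ (with the action described in the context) is $SH_n$; (ii) $SH_n=\sum_{(p,\overline{\sigma},\tau)} V_{\lambda(p)}$, where the sum runs over all sorted odd shifted parking functions $(p,\overline{\sigma},\tau)$ of size $n$.
   Context: Parking functions. A parking function of size $n$ is an $n$-tuple $p=(p_1,\dots,p_n)$ of positive integers such that for each $i\in[n]=\{1,\dots,n\}$ the $i$-th smallest entry of $p$ (counted with multiplicity) is at most $i$; $\mathrm{Pf}(n)$ is the set of these. $\mathtt{sort}(p)$ denotes the weakly increasing rearrangement of $p$; $p$ is sorted if $p=\mathtt{sort}(p)$. The content of $p$ is $(\alpha_1(p),\dots,\alpha_n(p))$ with $\alpha_k(p)=\#\{j:p_j=k\}$, and the shape $\lambda(p)$ is the partition whose parts are the nonzero $\alpha_k(p)$ in weakly decreasing order. A partition is odd if all its parts are odd. Symmetric functions. $\mathrm{Sym}$ is the ring of symmetric functions with power sums $p_k$, complete homogeneous $h_k$ and elementary $e_k$ ($h_0=e_0=1$). Put $P_0=1$, $P_k=\frac12\sum_{i=0}^k h_ie_{k-i}$ for $k\ge1$, and $V_\lambda=\prod_i P_{\lambda_i}$ for a partition $\lambda$. Shiftification $\mathtt{sh}:\mathrm{Sym}\to\mathrm{Sym}$ is the algebra homomorphism with $\mathtt{sh}(p_{2k-1})=2p_{2k-1}$ and $\mathtt{sh}(p_{2k})=0$ for $k\ge1$. $PF_n=\sum_{p} h_{\lambda(p)}$,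 summed over sorted $p\in\mathrm{Pf}(n)$ (equivalently, the Frobenius character of the permutation module $\mathbb{C}[\mathrm{Pf}(n)]$), and $SH_n=\mathtt{sh}(PF_n)$. The Frobenius character of a finite-dimensional $\mathfrak{S}_n$-module with character $\chi$ is $\sum_{\lambda\vdash n} z_\lambda^{-1}\chi(\pi_\lambda)p_\lambda$, with $\pi_\lambda$ of cycle type $\lambda$ and $z_\lambda$ the order of its centralizer. Odd shifted parking functions. For $p\in\mathrm{Pf}(n)$ and $\sigma\in\{-1,1\}^n$ define $\overline{\sigma}\in\{-1,0,1\}^n$ by $\overline{\sigma}_k=\prod_{i:\,p_i=k}\sigma_i$ if $\alpha_k(p)>0$ and $\overline{\sigma}_k=0$ if $\alpha_k(p)=0$. An odd shifted parking function of size $n$ is a triple $(p,\sigma,\tau)$ where $p\in\mathrm{Pf}(n)$ has odd shape, $\sigma\in\{-1,1\}^n$, and $\tau$ is a non-crossing partial matching of the set of integers appearing in $p$ (a set of pairs $(a,b)$ with $a<b$, both values of $p$, each value in at most one pair, and no two pairs $(a,c),(b,d)\in\tau$ with $a<b<c<d$), such that: (1) if $(a,b)\in\tau$ then $\overline{\sigma}_a=-\overline{\sigma}_b$; (2) if $(a,c)\in\tau$ and $a<b<c$ then $b$ appears in $p$; (3) if $(a,d),(b,c)\in\tau$ with $a<b<c<d$ then $\overline{\sigma}_a=\overline{\sigma}_b$. $\mathrm{OShPf}(n)$ is the set of these. Its sort is $\mathtt{sort}(p,\sigma,\tau)=(\mathtt{sort}(p),\overline{\sigma},\tau)$, and a sorted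 odd shifted parking function of size $n$ is any triple of the form $\mathtt{sort}(p,\sigma,\tau)$ with $(p,\sigma,\tau)\in\mathrm{OShPf}(n)$. Action. $\mathbb{C}[\mathrm{OShPf}(n)]$ is the vector space with basis $\mathrm{OShPf}(n)$. For $w\in\mathfrak{S}_n$ and an $n$-tuple $a$, let $w\cdot a$ be the tuple whose entry in position $w(i)$ is $a_i$. For $(p,\sigma,\tau)\in\mathrm{OShPf}(n)$ let $i_1<\dots<i_k$ be the positions with $\sigma_i=-1$, and define $w\cdot(p,\sigma,\tau)=\varepsilon\,(w\cdot p,w\cdot\sigma,\tau)$, where $\varepsilon\in\{\pm1\}$ is the sign of the permutation sorting $(w(i_1),\dots,w(i_k))$ into increasing order; equivalently this is the action transported from $\mathbb{C}[\mathrm{Pf}(n)]\otimes\bigwedge(\mathbb{C}^n)$ (with $\mathfrak{S}_n$ permuting the basis $\beta_1,\dots,\beta_n$ of $\mathbb{C}^n$) via $(p,\sigma,\tau)\mapsto p\otimes\beta_{i_1}\wedge\cdots\wedge\beta_{i_k}$ for each fixed $\tau$. *)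

theory Defs
  imports Complex_Main "HOL-Library.Multiset" "HOL-Library.Poly_Mapping"
    "HOL-Combinatorics.Permutations" "HOL-Combinatorics.Orbits"
begin

section \<open>The ring of symmetric functions\<close>

text \<open>
  Formal power series with complex coefficients in countably many variables
  \<open>x\<^sub>0, x\<^sub>1, \<dots>\<close>. A monomial is the multiset of its variable indices:
  the exponent of \<open>x\<^sub>i\<close> in \<open>m\<close> is \<open>count m i\<close> and the total degree is \<open>size m\<close>.
\<close>

typedef mseries = "UNIV :: (nat multiset \<Rightarrow> complex) set"
  morphisms mcoeff Abs_mseries ..

setup_lifting type_definition_mseries

lemma mseries_eqI: "(\<And>m. mcoeff f m = mcoeff g m) \<Longrightarrow> f = g"
  by transfer auto

definition msplits :: "nat multiset \<Rightarrow> (nat multiset \<times> nat multiset) set" where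
  "msplits m = {(a, b). a + b = m}"

lemma finite_submultisets: "finite {a. a \<subseteq># (m :: 'a multiset)}"
proof (rule finite_subset)
  show "{a. a \<subseteq># m} \<subseteq> {a. set_mset a \<subseteq> set_mset m \<and> size a \<le> size m}"
    by (auto dest: set_mset_mono size_mset_mono mset_subset_eqD)
  have "{a. set_mset a \<subseteq> set_mset m \<and> size a \<le> size m}
      \<subseteq> mset ` {xs. set xs \<subseteq> set_mset m \<and> length xs \<le> size m}"
  proof
    fix a assume "a \<in> {a. set_mset a \<subseteq> set_mset m \<and> size a \<le> size m}"
    moreover obtain xs where "mset xs = a" using ex_mset by blast
    ultimately show "a \<in> mset ` {xs. set xs \<subseteq> set_mset m \<and> length xs \<le> size m}"
      by (auto intro!: image_eqI[of _ _ xs])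
  qed
  then show "finite {a. set_mset a \<subseteq> set_mset m \<and> size a \<le> size m}"
    by (rule finite_subset) (intro finite_imageI finite_lists_length_le finite_set_mset)
qed

lemma finite_msplits [simp, intro]: "finite (msplits m)"
proof (rule finite_subset)
  show "msplits m \<subseteq> {a. a \<subseteq># m} \<times> {a. a \<subseteq># m}"
    by (auto simp: msplits_def)
  show "finite ({a. a \<subseteq># m} \<times> {a. a \<subseteq># m})"
    by (intro finite_cartesian_product finite_submultisets)
qed

lemma in_msplits [simp]: "(a, b) \<in> msplits m \<longleftrightarrow> a + b = m"
  by (simp add: msplits_def)

instantiation mseries :: comm_ring_1
begin

lift_definition zero_mseries :: mseries is "\<lambda>_. 0" .
lift_definition one_mseries :: mseries is "\<lambda>m. if m = {#} then 1 else 0" .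
lift_definition plus_mseries :: "mseries \<Rightarrow> mseries \<Rightarrow> mseries" is "\<lambda>f g m. f m + g m" .
lift_definition minus_mseries :: "mseries \<Rightarrow> mseries \<Rightarrow> mseries" is "\<lambda>f g m. f m - g m" .
lift_definition uminus_mseries :: "mseries \<Rightarrow> mseries" is "\<lambda>f m. - f m" .
lift_definition times_mseries :: "mseries \<Rightarrow> mseries \<Rightarrow> mseries"
  is "\<lambda>f g m. \<Sum>(a, b)\<in>msplits m. f a * g b" .

instance
proof
  fix f g h :: mseries
  show "f * g * h = f * (g * h)"
  proof (transfer, rule ext)
    fix f g h :: "nat multiset \<Rightarrow> complex" and m
    have "(\<Sum>(u, c)\<in>msplits m. (\<Sum>(a, b)\<in>msplits u. f a * g b) * h c)
        = (\<Sum>((u, c), (a, b))\<in>(SIGMA (u, c):msplits m. msplits u). f a * g b * h c)"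
      by (subst sum.Sigma[symmetric]) (auto simp: sum_distrib_right split_def)
    also have "\<dots> = (\<Sum>((a, v), (b, c))\<in>(SIGMA (a, v):msplits m. msplits v). f a * (g b * h c))"
      by (rule sum.reindex_bij_witness[of _ "\<lambda>((a, v), (b, c)). ((a + b, c), (a, b))"
            "\<lambda>((u, c), (a, b)). ((a, b + c), (b, c))"])
        (auto simp: add.assoc mult.assoc)
    also have "\<dots> = (\<Sum>(a, v)\<in>msplits m. f a * (\<Sum>(b, c)\<in>msplits v. g b * h c))"
      by (subst sum.Sigma[symmetric]) (auto simp: sum_distrib_left split_def)
    finally show "(\<Sum>(u, c)\<in>msplits m. (\<Sum>(a, b)\<in>msplits u. f a * g b) * h c)
        = (\<Sum>(a, v)\<in>msplits m. f a * (\<Sum>(b, c)\<in>msplits v. g b * h c))" .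
  qed
  show "f * g = g * f"
  proof (transfer, rule ext)
    fix f g :: "nat multiset \<Rightarrow> complex" and m
    show "(\<Sum>(a, b)\<in>msplits m. f a * g b) = (\<Sum>(a, b)\<in>msplits m. g a * f b)"
      by (rule sum.reindex_bij_witness[of _ prod.swap prod.swap])
        (auto simp: add.commute)
  qed
  show "1 * f = f"
  proof (transfer, rule ext)
    fix f :: "nat multiset \<Rightarrow> complex" and m
    have "(\<Sum>(a, b)\<in>msplits m. (if a = {#} then 1 else 0) * f b)
        = (\<Sum>(a, b)\<in>{({#} :: nat multiset, m)}. (if a = {#} then 1 else 0) * f b)"
      by (rule sum.mono_neutral_right) (auto split: if_splits)
    then show "(\<Sum>(a, b)\<in>msplits m. (if a = {#} then 1 else 0) * f b) = f m" by simp
  qed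
  show "(f + g) * h = f * h + g * h"
    by transfer (auto simp: fun_eq_iff split_def algebra_simps sum.distrib)
  show "(0 :: mseries) \<noteq> 1" by transfer (auto simp: fun_eq_iff)
qed (transfer; auto simp: fun_eq_iff)+

end

lift_definition mconst :: "complex \<Rightarrow> mseries" is "\<lambda>c m. if m = {#} then c else 0" .

definition Sym :: "mseries set" where
  "Sym = {f. (\<forall>\<pi>. bij \<pi> \<longrightarrow> (\<forall>m. mcoeff f (image_mset \<pi> m) = mcoeff f m))
           \<and> (\<exists>d. \<forall>m. mcoeff f m \<noteq> 0 \<longrightarrow> size m \<le> d)}"

lift_definition sym_p :: "nat \<Rightarrow> mseries"
  is "\<lambda>k m. if \<exists>i. m = replicate_mset k i then 1 else 0" .

lift_definition sym_h :: "nat \<Rightarrow> mseries"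
  is "\<lambda>k m. if size m = k then 1 else 0" .

lift_definition sym_e :: "nat \<Rightarrow> mseries"
  is "\<lambda>k m. if size m = k \<and> (\<forall>i. count m i \<le> 1) then 1 else 0" .

text \<open>Partitions are represented by the multiset of their (positive) parts.\<close>

definition partitions :: "nat \<Rightarrow> nat multiset set" where
  "partitions n = {l. 0 \<notin># l \<and> sum_mset l = n}"

definition sym_p_part :: "nat multiset \<Rightarrow> mseries" where
  "sym_p_part l = (\<Prod>k\<in>#l. sym_p k)"

definition sym_h_part :: "nat multiset \<Rightarrow> mseries" where
  "sym_h_part l = (\<Prod>k\<in>#l. sym_h k)"

definition sym_P :: "nat \<Rightarrow> mseries" where
  "sym_P k = (if k = 0 then 1 else mconst (1/2) * (\<Sum>i\<le>k. sym_h i * sym_e (k - i)))"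

definition sym_V :: "nat multiset \<Rightarrow> mseries" where
  "sym_V l = (\<Prod>k\<in>#l. sym_P k)"

definition sym_alg_hom :: "(mseries \<Rightarrow> mseries) \<Rightarrow> bool" where
  "sym_alg_hom \<phi> \<longleftrightarrow> \<phi> ` Sym \<subseteq> Sym \<and> (\<forall>c. \<phi> (mconst c) = mconst c) \<and>
     (\<forall>f\<in>Sym. \<forall>g\<in>Sym. \<phi> (f + g) = \<phi> f + \<phi> g \<and> \<phi> (f * g) = \<phi> f * \<phi> g)"

definition is_shiftification :: "(mseries \<Rightarrow> mseries) \<Rightarrow> bool" where
  "is_shiftification \<phi> \<longleftrightarrow> sym_alg_hom \<phi> \<and>
     (\<forall>k\<ge>1. \<phi> (sym_p (2 * k - 1)) = 2 * sym_p (2 * k - 1) \<and> \<phi> (sym_p (2 * k)) = 0)"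

subsection \<open>Existence and uniqueness of shiftification\<close>

lemma SymI:
  assumes "\<And>\<pi> m. bij \<pi> \<Longrightarrow> mcoeff f (image_mset \<pi> m) = mcoeff f m"
    and "\<And>m. mcoeff f m \<noteq> 0 \<Longrightarrow> size m \<le> d"
  shows "f \<in> Sym"
  using assms unfolding Sym_def by blast

lemma Sym_const [simp]: "mconst c \<in> Sym"
  by (rule SymI[of _ 0]; transfer) (auto split: if_splits)

lemma Sym_add:
  assumes "f \<in> Sym" "g \<in> Sym" shows "f + g \<in> Sym"
proof -
  obtain d e where "\<forall>m. mcoeff f m \<noteq> 0 \<longrightarrow> size m \<le> d" "\<forall>m. mcoeff g m \<noteq> 0 \<longrightarrow> size m \<le> e"
    using assms unfolding Sym_def by blast
  then show ?thesis
    by (intro SymI[of _ "max d e"])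
      (use assms in \<open>auto simp: plus_mseries.rep_eq Sym_def le_max_iff_disj\<close>, metis add_0)
qed

lemma Sym_mult:
  assumes "f \<in> Sym" "g \<in> Sym" shows "f * g \<in> Sym"
proof -
  obtain d e where de: "\<And>m. mcoeff f m \<noteq> 0 \<Longrightarrow> size m \<le> d" "\<And>m. mcoeff g m \<noteq> 0 \<Longrightarrow> size m \<le> e"
    using assms unfolding Sym_def by blast
  show ?thesis
  proof (rule SymI[of _ "d + e"])
    fix \<pi> :: "nat \<Rightarrow> nat" and m assume bij: "bij \<pi>"
    have inv: "image_mset \<pi> (image_mset (inv \<pi>) a) = a" "image_mset (inv \<pi>) (image_mset \<pi> a) = a" for a
      using bij by (simp_all add: image_mset.compositionality o_def bij_is_surj bij_is_inj surj_f_inv_f)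
    have s: "mcoeff f (image_mset \<pi> a) = mcoeff f a" "mcoeff g (image_mset \<pi> a) = mcoeff g a" for a
      using assms bij unfolding Sym_def by auto
    have s': "mcoeff f (image_mset (inv \<pi>) a) = mcoeff f a" "mcoeff g (image_mset (inv \<pi>) a) = mcoeff g a" for a
      by (metis s inv(1))+
    have u: "image_mset (inv \<pi>) a + image_mset (inv \<pi>) b = m" if "a + b = image_mset \<pi> m" for a b
      by (metis that image_mset_union inv(2))
    show "mcoeff (f * g) (image_mset \<pi> m) = mcoeff (f * g) m"
      unfolding times_mseries.rep_eq
      by (rule sum.reindex_bij_witness[of _ "\<lambda>(a, b). (image_mset \<pi> a, image_mset \<pi> b)"
            "\<lambda>(a, b). (image_mset (inv \<pi>) a, image_mset (inv \<pi>) b)"])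
        (auto simp: inv s' u)
  next
    fix m assume "mcoeff (f * g) m \<noteq> 0"
    then obtain x where "x \<in> msplits m" "mcoeff f (fst x) * mcoeff g (snd x) \<noteq> 0"
      unfolding times_mseries.rep_eq split_def by (rule sum.not_neutral_contains_not_neutral)
    with de(1)[of "fst x"] de(2)[of "snd x"] show "size m \<le> d + e"
      by (auto simp: msplits_def)
  qed
qed

lemma mconst_0: "mconst 0 = 0" and mconst_1: "mconst 1 = 1"
  by (transfer; auto)+

lemma mconst_add: "mconst (a + b) = mconst a + mconst b"
  by transfer auto

lemma mcoeff_const_mult [simp]: "mcoeff (mconst c * f) m = c * mcoeff f m"
proof -
  have "mcoeff (mconst c * f) m = (\<Sum>(a, b)\<in>msplits m. (if a = {#} then c else 0) * mcoeff f b)"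
    by (simp add: times_mseries.rep_eq mconst.rep_eq)
  also have "\<dots> = (\<Sum>(a, b)\<in>{({#} :: nat multiset, m)}. (if a = {#} then c else 0) * mcoeff f b)"
    by (rule sum.mono_neutral_right) (auto split: if_splits)
  finally show ?thesis by simp
qed

lemma mconst_mult: "mconst (a * b) = mconst a * mconst b"
  by (rule mseries_eqI) (simp add: mconst.rep_eq)

lemma Sym_0 [simp]: "0 \<in> Sym" and Sym_1 [simp]: "1 \<in> Sym"
  using Sym_const[of 0] Sym_const[of 1] by (simp_all add: mconst_0 mconst_1)

lemma Sym_diff: "f \<in> Sym \<Longrightarrow> g \<in> Sym \<Longrightarrow> f - g \<in> Sym"
proof -
  assume "f \<in> Sym" "g \<in> Sym"
  then have "f + mconst (-1) * g \<in> Sym" by (intro Sym_add Sym_mult Sym_const)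
  also have "f + mconst (-1) * g = f - g"
    by (rule mseries_eqI) (simp add: plus_mseries.rep_eq minus_mseries.rep_eq)
  finally show ?thesis .
qed

lemma Sym_sum: "(\<And>x. x \<in> A \<Longrightarrow> F x \<in> Sym) \<Longrightarrow> sum F A \<in> Sym"
  by (induction A rule: infinite_finite_induct) (auto intro: Sym_add)

lemma Sym_prod_mset: "(\<And>k. k \<in># l \<Longrightarrow> F k \<in> Sym) \<Longrightarrow> (\<Prod>k\<in>#l. F k) \<in> Sym"
  by (induction l) (auto intro: Sym_mult)

lemma Sym_p [simp]: "sym_p k \<in> Sym"
proof (rule SymI[of _ k])
  fix \<pi> :: "nat \<Rightarrow> nat" and m assume "bij \<pi>"
  then have "(\<exists>i. image_mset \<pi> m = replicate_mset k i) \<longleftrightarrow> (\<exists>i. m = replicate_mset k i)"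
    by (metis bij_is_inj bij_is_surj image_replicate_mset surjD multiset.inj_map injD)
  then show "mcoeff (sym_p k) (image_mset \<pi> m) = mcoeff (sym_p k) m"
    by (simp add: sym_p.rep_eq)
qed (auto simp: sym_p.rep_eq split: if_splits)

lemma mcoeff_sum: "mcoeff (sum F A) m = (\<Sum>x\<in>A. mcoeff (F x) m)"
  by (induction A rule: infinite_finite_induct) (auto simp: zero_mseries.rep_eq plus_mseries.rep_eq)

text \<open>Polynomials in generators \<open>q\<^sub>0, q\<^sub>1, \<dots>\<close>, represented by finitely supported functions on multisets.\<close>

definition mpow :: "(nat \<Rightarrow> mseries) \<Rightarrow> nat multiset \<Rightarrow> mseries" where
  "mpow q l = (\<Prod>k\<in>#l. q k)"

definition meval :: "(nat \<Rightarrow> mseries) \<Rightarrow> (nat multiset \<Rightarrow>\<^sub>0 complex) \<Rightarrow> mseries" where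
  "meval q c = (\<Sum>l\<in>Poly_Mapping.keys c. mconst (Poly_Mapping.lookup c l) * mpow q l)"

lemma meval_superset:
  "finite A \<Longrightarrow> Poly_Mapping.keys c \<subseteq> A \<Longrightarrow> meval q c = (\<Sum>l\<in>A. mconst (Poly_Mapping.lookup c l) * mpow q l)"
  unfolding meval_def by (rule sum.mono_neutral_left) (auto simp: in_keys_iff mconst_0)

lemma meval_add: "meval q (c + d) = meval q c + meval q d"
proof -
  let ?A = "Poly_Mapping.keys c \<union> Poly_Mapping.keys d"
  have k: "Poly_Mapping.keys (c + d) \<subseteq> ?A" by (rule keys_add)
  show ?thesis
    by (subst (1 2 3) meval_superset[of ?A])
      (use k in \<open>auto simp: lookup_add mconst_add sum.distrib algebra_simps\<close>)
qed

lemma meval_0 [simp]: "meval q 0 = 0"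
  by (simp add: meval_def)

lemma meval_sum: "meval q (sum F A) = (\<Sum>x\<in>A. meval q (F x))"
  by (induction A rule: infinite_finite_induct) (auto simp: meval_add)

lemma meval_single: "meval q (Poly_Mapping.single l x) = mconst x * mpow q l"
  by (simp add: meval_def mconst_0)

lemma poly_mapping_expand:
  "c = (\<Sum>l\<in>Poly_Mapping.keys c. Poly_Mapping.single l (Poly_Mapping.lookup c l))"
proof (rule poly_mapping_eqI)
  fix k
  have "(\<Sum>l\<in>Poly_Mapping.keys c. if l = k then Poly_Mapping.lookup c l else 0) = Poly_Mapping.lookup c k"
    by (auto simp: in_keys_iff)
  then show "Poly_Mapping.lookup c k
      = Poly_Mapping.lookup (\<Sum>l\<in>Poly_Mapping.keys c. Poly_Mapping.single l (Poly_Mapping.lookup c l)) k"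
    by (simp add: lookup_sum lookup_single when_def)
qed

lemma meval_mult: "meval q (c * d) = meval q c * meval q d"
proof -
  let ?s = "\<lambda>c l. Poly_Mapping.single l (Poly_Mapping.lookup c l)"
  have "c * d = (\<Sum>l\<in>Poly_Mapping.keys c. \<Sum>l'\<in>Poly_Mapping.keys d. ?s c l * ?s d l')"
    by (subst (1) poly_mapping_expand[of c], subst (1) poly_mapping_expand[of d])
      (simp only: sum_product)
  also have "meval q \<dots> = (\<Sum>l\<in>Poly_Mapping.keys c. \<Sum>l'\<in>Poly_Mapping.keys d.
      (mconst (Poly_Mapping.lookup c l) * mpow q l) * (mconst (Poly_Mapping.lookup d l') * mpow q l'))"
    by (simp add: meval_sum mult_single meval_single mconst_mult mpow_def mult_ac)
  also have "\<dots> = meval q c * meval q d"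
    by (simp only: meval_def sum_product)
  finally show ?thesis .
qed

lemma meval_Sym: "(\<And>k. q k \<in> Sym) \<Longrightarrow> meval q c \<in> Sym"
  unfolding meval_def mpow_def by (intro Sym_sum Sym_mult Sym_const Sym_prod_mset)

text \<open>\<open>mtype m\<close> is the multiset of nonzero exponents of \<open>m\<close>.\<close>

definition mtype :: "nat multiset \<Rightarrow> nat multiset" where
  "mtype m = image_mset (count m) (mset_set (set_mset m))"

abbreviation ppow :: "nat multiset \<Rightarrow> mseries" where
  "ppow \<equiv> mpow (\<lambda>k. sym_p (Suc k))"

lemma size_mtype: "size (mtype m) = card (set_mset m)"
  by (simp add: mtype_def)

lemma mtype_fresh:
  assumes "i \<notin># b" shows "mtype (replicate_mset (Suc k) i + b) = add_mset (Suc k) (mtype b)"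
proof -
  have "image_mset (count (replicate_mset (Suc k) i + b)) (mset_set (set_mset b)) = image_mset (count b) (mset_set (set_mset b))"
    by (rule image_mset_cong) (use assms in auto)
  moreover have "count b i = 0" using assms by (simp add: not_in_iff)
  ultimately show ?thesis using assms by (simp add: mtype_def) (auto split: if_splits)
qed

lemma sum_Nats: "(\<And>x. x \<in> A \<Longrightarrow> F x \<in> \<nat>) \<Longrightarrow> sum F A \<in> \<nat>"
  by (induction A rule: infinite_finite_induct) auto

lemma mcoeff_ppow_Nats: "mcoeff (ppow l) m \<in> \<nat>"
proof (induction l arbitrary: m)
  case (add k l)
  have "mcoeff (sym_p (Suc k)) a \<in> \<nat>" for a by (auto simp: sym_p.rep_eq)
  with add show ?case
    by (auto simp: mpow_def times_mseries.rep_eq intro!: sum_Nats Nats_mult)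
qed (auto simp: mpow_def one_mseries.rep_eq)

lemma mcoeff_ppow_nonzero:
  assumes "mcoeff (ppow l) m \<noteq> 0"
  shows "card (set_mset m) \<le> size l \<and> size m = sum_mset (image_mset Suc l) \<and>
    (card (set_mset m) = size l \<longrightarrow> mtype m = image_mset Suc l)"
  using assms
proof (induction l arbitrary: m)
  case (add k l)
  then obtain a b where ab: "a + b = m" "mcoeff (sym_p (Suc k)) a \<noteq> 0" "mcoeff (ppow l) b \<noteq> 0"
    by (auto simp: mpow_def times_mseries.rep_eq elim!: sum.not_neutral_contains_not_neutral)
  then obtain i where a: "a = replicate_mset (Suc k) i"
    by (auto simp: sym_p.rep_eq split: if_splits)
  note IH = add.IH[OF ab(3)]
  have m: "m = replicate_mset (Suc k) i + b" using a ab by simp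
  show ?case
  proof (cases "i \<in># b")
    case True
    then have "card (set_mset m) = card (set_mset b)" by (simp add: m insert_absorb)
    with IH m show ?thesis by auto
  next
    case False
    then have "card (set_mset m) = Suc (card (set_mset b))" by (simp add: m)
    with IH False show ?thesis by (simp add: m mtype_fresh del: replicate_mset_Suc)
  qed
qed (auto simp: mpow_def one_mseries.rep_eq mtype_def split: if_splits)

lemma sum_Nats_nonzero:
  fixes F :: "'a \<Rightarrow> complex"
  assumes "finite A" "\<And>x. x \<in> A \<Longrightarrow> F x \<in> \<nat>" "y \<in> A" "F y \<noteq> 0"
  shows "sum F A \<noteq> 0"
proof -
  have "\<forall>x\<in>A. \<exists>n. F x = of_nat n" using assms(2) by (auto elim: Nats_cases)
  then obtain g where g: "\<And>x. x \<in> A \<Longrightarrow> F x = of_nat (g x)" by metis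
  then have "sum F A = of_nat (sum g A)" by simp
  moreover have "sum g A \<noteq> 0" using assms g by auto
  ultimately show ?thesis by (metis of_nat_eq_0_iff)
qed

lemma mcoeff_ppow_diag: "mtype m = image_mset Suc l \<Longrightarrow> mcoeff (ppow l) m \<noteq> 0"
proof (induction l arbitrary: m)
  case empty
  then have "m = {#}" by (auto simp: mtype_def mset_set_empty_iff)
  then show ?case by (simp add: mpow_def one_mseries.rep_eq)
next
  case (add k l)
  then have "Suc k \<in># mtype m" by simp
  then obtain i where i: "i \<in># m" "count m i = Suc k" by (auto simp: mtype_def)
  define b where "b = filter_mset (\<lambda>j. j \<noteq> i) m"
  have m: "m = replicate_mset (Suc k) i + b"
    by (rule multiset_eqI) (use i in \<open>auto simp: b_def\<close>)
  have "i \<notin># b" by (simp add: b_def)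
  with add.prems have "mtype b = image_mset Suc l" by (simp add: m mtype_fresh del: replicate_mset_Suc)
  then have nz: "mcoeff (ppow l) b \<noteq> 0" by (rule add.IH)
  have N: "mcoeff (sym_p (Suc k)) a \<in> \<nat>" for a by (auto simp: sym_p.rep_eq)
  have "(\<Sum>x\<in>msplits m. mcoeff (sym_p (Suc k)) (fst x) * mcoeff (ppow l) (snd x)) \<noteq> 0"
    by (rule sum_Nats_nonzero[where y = "(replicate_mset (Suc k) i, b)"])
      (use N mcoeff_ppow_Nats nz in \<open>auto simp: m sym_p.rep_eq simp del: replicate_mset_Suc\<close>)
  then show ?case by (simp add: mpow_def times_mseries.rep_eq split_def)
qed

lemma ex_mtype: "\<exists>m. mtype m = image_mset Suc l"
proof (induction l)
  case (add k l)
  then obtain b where b: "mtype b = image_mset Suc l" by blast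
  obtain i where "i \<notin># b" using ex_new_if_finite[of "set_mset b"] by auto
  with b show ?case by (metis mtype_fresh image_mset_add_mset)
qed (auto simp: mtype_def intro!: exI[of _ "{#}"])

lemma mtype_eq_imp_perm:
  assumes "mtype m = mtype m'"
  shows "\<exists>\<pi>. bij \<pi> \<and> image_mset \<pi> m = m'"
proof -
  define S where "S = set_mset m \<union> set_mset m'"
  have pad: "image_mset (count u) (mset_set S) = mtype u + replicate_mset (card S - card (set_mset u)) 0"
    if "set_mset u \<subseteq> S" for u
  proof -
    have fin: "finite S" by (simp add: S_def)
    have "mset_set S = mset_set (set_mset u) + mset_set (S - set_mset u)"
      using that fin by (subst mset_set_Union[symmetric]) (auto simp: Un_absorb1 finite_subset intro!: arg_cong[where f=mset_set])
    moreover have "image_mset (count u) (mset_set (S - set_mset u)) = image_mset (\<lambda>_. 0) (mset_set (S - set_mset u))"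
      by (rule image_mset_cong) (use fin in \<open>auto simp: not_in_iff\<close>)
    ultimately show ?thesis
      using that fin by (simp add: mtype_def image_mset_const_eq card_Diff_subset)
  qed
  have "card (set_mset m) = card (set_mset m')" using assms by (metis size_mtype)
  then have "image_mset (count m) (mset_set S) = image_mset (count m') (mset_set S)"
    using assms by (subst (1 2) pad) (auto simp: S_def)
  then obtain p where p: "p permutes S" "\<forall>x\<in>S. count m x = count m' (p x)"
    using image_mset_eq_implies_permutes[of S "count m" "count m'"] by (auto simp: S_def)
  have eq: "count m x = count m' (p x)" for x
  proof (cases "x \<in> S")
    case False
    then have "p x = x" using p(1) by (simp add: permutes_not_in)
    with False show ?thesis by (simp add: S_def not_in_iff)
  qed (use p in auto)
  have bij: "bij p" using p(1) by (rule permutes_bij)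
  have "image_mset p m = m'"
  proof (rule multiset_eqI)
    fix y
    obtain x where y: "y = p x" using bij by (meson bij_pointE)
    have "count (image_mset p m) (p x) = count m x"
      using bij by (induction m) (auto simp: bij_is_inj inj_eq)
    then show "count (image_mset p m) y = count m' y"
      using eq by (simp add: y)
  qed
  with bij show ?thesis by blast
qed

lemma Sym_mcoeff_cong:
  assumes "f \<in> Sym" "mtype m = mtype m'" shows "mcoeff f m = mcoeff f m'"
  using mtype_eq_imp_perm[OF assms(2)] assms(1) unfolding Sym_def by auto

lemma ppow_Sym [simp]: "ppow l \<in> Sym"
  by (simp add: mpow_def Sym_prod_mset)

abbreviation peval :: "(nat multiset \<Rightarrow>\<^sub>0 complex) \<Rightarrow> mseries" where
  "peval \<equiv> meval (\<lambda>k. sym_p (Suc k))"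

lemma image_mset_Suc_inject: "image_mset Suc l = image_mset Suc l' \<longleftrightarrow> l = l'"
  by (metis inj_Suc multiset.inj_map injD)

lemma peval_eq_0:
  assumes "peval c = 0" shows "c = 0"
proof (rule ccontr)
  assume "c \<noteq> 0"
  then have ne: "size ` Poly_Mapping.keys c \<noteq> {}" by simp
  define L where "L = Max (size ` Poly_Mapping.keys c)"
  have "L \<in> size ` Poly_Mapping.keys c" unfolding L_def using ne by (intro Max_in) auto
  then obtain l where l: "l \<in> Poly_Mapping.keys c" "size l = L" by auto
  have le: "size l' \<le> size l" if "l' \<in> Poly_Mapping.keys c" for l'
    using that by (simp add: l(2) L_def)
  obtain m where m: "mtype m = image_mset Suc l" using ex_mtype by blast
  then have cm: "card (set_mset m) = size l" by (metis size_image_mset size_mtype)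
  have "mcoeff (ppow l') m = 0" if "l' \<in> Poly_Mapping.keys c" "l' \<noteq> l" for l'
    using mcoeff_ppow_nonzero[of l' m] le[OF that(1)] cm m that(2) image_mset_Suc_inject by fastforce
  then have "(\<Sum>l'\<in>Poly_Mapping.keys c. Poly_Mapping.lookup c l' * mcoeff (ppow l') m)
      = (\<Sum>l'\<in>{l}. Poly_Mapping.lookup c l' * mcoeff (ppow l') m)"
    by (intro sum.mono_neutral_right) (use l in auto)
  moreover have "mcoeff (peval c) m = (\<Sum>l'\<in>Poly_Mapping.keys c. Poly_Mapping.lookup c l' * mcoeff (ppow l') m)"
    by (simp add: meval_def mcoeff_sum)
  ultimately have "Poly_Mapping.lookup c l * mcoeff (ppow l) m = 0"
    using assms by (simp add: zero_mseries.rep_eq)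
  with mcoeff_ppow_diag[OF m] l show False by (simp add: in_keys_iff)
qed

lemma inj_peval: "inj peval"
proof (rule injI)
  fix c d assume "peval c = peval d"
  moreover have "peval c = peval (c - d) + peval d" by (simp flip: meval_add)
  ultimately have "peval (c - d) = 0" by simp
  then have "c - d = 0" by (rule peval_eq_0)
  then show "c = d" by simp
qed

lemma finite_bounded_multisets: "finite {l. sum_mset (image_mset Suc l) \<le> d}"
proof -
  have "size l \<le> sum_mset (image_mset Suc l) \<and> (\<forall>k\<in>#l. k \<le> sum_mset (image_mset Suc l))" for l
    by (induction l) auto
  then have "{l. sum_mset (image_mset Suc l) \<le> d} \<subseteq> {l. set_mset l \<subseteq> {..d} \<and> size l \<le> d}"
    by (fastforce dest: order_trans)
  also have "\<dots> \<subseteq> mset ` {xs. set xs \<subseteq> {..d} \<and> length xs \<le> d}"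
  proof
    fix l assume "l \<in> {l. set_mset l \<subseteq> {..d} \<and> size l \<le> d}"
    moreover obtain xs where "mset xs = l" using ex_mset by blast
    ultimately show "l \<in> mset ` {xs. set xs \<subseteq> {..d} \<and> length xs \<le> d}"
      by (auto intro!: image_eqI[of _ _ xs])
  qed
  finally show ?thesis
    by (rule finite_subset) (intro finite_imageI finite_lists_length_le, simp)
qed

lemma Sym_in_range_peval_aux:
  assumes "f \<in> Sym" "\<And>m. mcoeff f m \<noteq> 0 \<Longrightarrow> card (set_mset m) \<le> L"
  shows "f \<in> range peval"
  using assms
proof (induction L arbitrary: f)
  case 0
  have "f = mconst (mcoeff f {#})"
    by (rule mseries_eqI) (use 0 in \<open>auto simp: mconst.rep_eq\<close>)
  also have "\<dots> = peval (Poly_Mapping.single {#} (mcoeff f {#}))"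
    by (simp add: meval_single mpow_def)
  finally show ?case by blast
next
  case (Suc L)
  obtain d where d: "\<And>m. mcoeff f m \<noteq> 0 \<Longrightarrow> size m \<le> d"
    using Suc.prems unfolding Sym_def by blast
  obtain M where M: "\<And>l. mtype (M l) = image_mset Suc l" using ex_mtype by metis
  define T where "T = {l. size l = Suc L \<and> mcoeff f (M l) \<noteq> 0}"
  define r where "r l = mcoeff f (M l) / mcoeff (ppow l) (M l)" for l
  define g where "g = (\<Sum>l\<in>T. mconst (r l) * ppow l)"
  have szM: "size (M l) = sum_mset (image_mset Suc l)" for l
    using mcoeff_ppow_nonzero[OF mcoeff_ppow_diag[OF M]] by blast
  have finT: "finite T"
    by (rule finite_subset[OF _ finite_bounded_multisets[of d]])
      (use d szM in \<open>fastforce simp: T_def\<close>)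
  have gm: "mcoeff g m = (\<Sum>l\<in>T. r l * mcoeff (ppow l) m)" for m
    by (simp add: g_def mcoeff_sum)
  have gS: "g \<in> Sym" unfolding g_def by (intro Sym_sum Sym_mult) auto
  have "f - g \<in> range peval"
  proof (rule Suc.IH)
    show "f - g \<in> Sym" using Suc.prems gS by (intro Sym_diff)
    fix m assume nz: "mcoeff (f - g) m \<noteq> 0"
    show "card (set_mset m) \<le> L"
    proof (rule ccontr)
      assume nle: "\<not> card (set_mset m) \<le> L"
      show False
      proof (cases "card (set_mset m) = Suc L")
        case False
        then have "mcoeff f m = 0" using Suc.prems(2)[of m] nle by force
        moreover have "mcoeff (ppow l) m = 0" if "l \<in> T" for l
          using mcoeff_ppow_nonzero[of l m] that False nle by (force simp: T_def)
        ultimately show False using nz by (simp add: minus_mseries.rep_eq gm)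
      next
        case True
        define l where "l = image_mset (\<lambda>x. x - 1) (mtype m)"
        have "image_mset Suc l = image_mset (\<lambda>x. x) (mtype m)"
          unfolding l_def image_mset.compositionality
          by (rule image_mset_cong) (auto simp: mtype_def)
        then have ml: "mtype m = image_mset Suc l" by simp
        have szl: "size l = Suc L" using True by (simp add: l_def size_mtype)
        have fm: "mcoeff f m = mcoeff f (M l)"
          using Suc.prems(1) by (rule Sym_mcoeff_cong) (simp add: M ml)
        have pm: "mcoeff (ppow l) m = mcoeff (ppow l) (M l)"
          by (rule Sym_mcoeff_cong) (simp_all add: M ml)
        have oth: "mcoeff (ppow l') m = 0" if "l' \<in> T" "l' \<noteq> l" for l'
          using mcoeff_ppow_nonzero[of l' m] that True ml image_mset_Suc_inject by (force simp: T_def)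
        have "mcoeff g m = mcoeff f m"
        proof (cases "l \<in> T")
          case True
          have "mcoeff g m = (\<Sum>l\<in>{l}. r l * mcoeff (ppow l) m)"
            unfolding gm by (rule sum.mono_neutral_right) (use finT True oth in auto)
          then show ?thesis using mcoeff_ppow_diag[OF M[of l]] by (simp add: r_def pm fm)
        next
          case False
          then have "mcoeff f m = 0" using szl fm by (simp add: T_def)
          moreover have "mcoeff g m = 0" unfolding gm
            by (rule sum.neutral) (use oth False in auto)
          ultimately show ?thesis by simp
        qed
        with nz show False by (simp add: minus_mseries.rep_eq)
      qed
    qed
  qed
  then obtain c where c: "f - g = peval c" by blast
  have "f = peval (c + (\<Sum>l\<in>T. Poly_Mapping.single l (r l)))"
    by (simp add: meval_add meval_sum meval_single g_def flip: c)
  then show ?case by blast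
qed

lemma range_peval: "range peval = Sym"
proof
  show "range peval \<subseteq> Sym" using meval_Sym[OF Sym_p] by blast
  show "Sym \<subseteq> range peval"
  proof
    fix f assume f: "f \<in> Sym"
    then obtain d where d: "\<And>m. mcoeff f m \<noteq> 0 \<Longrightarrow> size m \<le> d" unfolding Sym_def by blast
    have "card (set_mset m) \<le> size m" for m :: "nat multiset"
      by (metis mset_set_set_mset_msubset size_mset_mono size_mset_set)
    with d have "card (set_mset m) \<le> d" if "mcoeff f m \<noteq> 0" for m
      using that le_trans by blast
    with f show "f \<in> range peval" by (rule Sym_in_range_peval_aux)
  qed
qed

lemma ex_shiftification: "\<exists>\<phi>. is_shiftification \<phi>"
proof -
  define q where "q k = (if odd (Suc k) then 2 * sym_p (Suc k) else 0)" for k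
  define \<phi> where "\<phi> f = meval q (inv peval f)" for f
  have \<phi>: "\<phi> (peval c) = meval q c" for c
    by (simp add: \<phi>_def inv_f_f[OF inj_peval])
  have two: "(2 :: mseries) \<in> Sym" using Sym_add[OF Sym_1 Sym_1] by simp
  have qS: "q k \<in> Sym" for k by (auto simp: q_def two intro: Sym_mult)
  have const: "mconst c = peval (Poly_Mapping.single {#} c)" "mconst c = meval q (Poly_Mapping.single {#} c)" for c
    by (simp_all add: meval_single mpow_def)
  have "\<phi> (mconst c) = mconst c" for c by (subst const(1), subst \<phi>, subst const(2)) (rule refl)
  moreover have "\<phi> ` Sym \<subseteq> Sym" unfolding \<phi>_def using meval_Sym[of q, OF qS] by blast
  moreover have "\<phi> (f + g) = \<phi> f + \<phi> g \<and> \<phi> (f * g) = \<phi> f * \<phi> g" if "f \<in> Sym" "g \<in> Sym" for f g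
  proof -
    obtain c d where "f = peval c" "g = peval d" using \<open>f \<in> Sym\<close> \<open>g \<in> Sym\<close> range_peval by blast
    then show ?thesis
      by (simp only: \<phi> meval_add[symmetric] meval_mult[symmetric])
  qed
  moreover have p: "\<phi> (sym_p (Suc k)) = q k" for k
  proof -
    have "sym_p (Suc k) = peval (Poly_Mapping.single {#k#} 1)" by (simp add: meval_single mpow_def mconst_1)
    then have "\<phi> (sym_p (Suc k)) = meval q (Poly_Mapping.single {#k#} 1)" by (simp only: \<phi>)
    then show ?thesis by (simp add: meval_single mpow_def mconst_1)
  qed
  have "\<phi> (sym_p (2 * k - 1)) = 2 * sym_p (2 * k - 1) \<and> \<phi> (sym_p (2 * k)) = 0" if "k \<ge> 1" for k
  proof -
    from that obtain j where "k = Suc j" by (cases k) auto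
    then show ?thesis using p[of "2 * j"] p[of "Suc (2 * j)"] by (simp add: q_def)
  qed
  ultimately have "is_shiftification \<phi>" by (simp add: is_shiftification_def sym_alg_hom_def)
  then show ?thesis by blast
qed

lemma shiftification_unique:
  assumes "is_shiftification \<phi>" "is_shiftification \<psi>" "f \<in> Sym"
  shows "\<phi> f = \<psi> f"
proof -
  obtain c where c: "f = peval c" using assms(3) range_peval by blast
  have p: "\<chi> (sym_p (Suc k)) = (if odd (Suc k) then 2 * sym_p (Suc k) else 0)"
    if "is_shiftification \<chi>" for \<chi> k
  proof (cases "odd (Suc k)")
    case True
    then have "Suc k = 2 * Suc (k div 2) - 1" by simp
    with that True show ?thesis unfolding is_shiftification_def by (metis le_add1 plus_1_eq_Suc)
  next
    case False
    then have "Suc k = 2 * (Suc k div 2)" "Suc k div 2 \<ge> 1" by auto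
    with that False show ?thesis unfolding is_shiftification_def by metis
  qed
  have pp: "\<chi> (ppow l) = mpow (\<lambda>k. \<chi> (sym_p (Suc k))) l" if "is_shiftification \<chi>" for \<chi> l
  proof (induction l)
    case empty
    then show ?case using that mconst_1 unfolding is_shiftification_def sym_alg_hom_def mpow_def
      by (metis image_mset_empty prod_mset_empty)
  next
    case (add k l)
    have "\<chi> (sym_p (Suc k) * ppow l) = \<chi> (sym_p (Suc k)) * \<chi> (ppow l)"
      using that by (simp add: is_shiftification_def sym_alg_hom_def)
    with add show ?case by (simp add: mpow_def)
  qed
  have e: "\<chi> (peval c) = meval (\<lambda>k. \<chi> (sym_p (Suc k))) c" if "is_shiftification \<chi>" for \<chi>
  proof -
    have "\<chi> (\<Sum>l\<in>A. mconst (F l) * ppow l) = (\<Sum>l\<in>A. mconst (F l) * \<chi> (ppow l))" if "finite A" for F A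
      using that
    proof (induction A)
      case empty
      then show ?case using \<open>is_shiftification \<chi>\<close> mconst_0
        unfolding is_shiftification_def sym_alg_hom_def by (metis sum.empty)
    next
      case (insert x A)
      have "mconst (F x) * ppow x \<in> Sym" "(\<Sum>l\<in>A. mconst (F l) * ppow l) \<in> Sym"
        by (auto intro!: Sym_mult Sym_sum)
      with insert \<open>is_shiftification \<chi>\<close> show ?case
        by (simp add: is_shiftification_def sym_alg_hom_def)
    qed
    then show ?thesis by (simp add: meval_def pp[OF that])
  qed
  have "(\<lambda>k. \<phi> (sym_p (Suc k))) = (\<lambda>k. \<psi> (sym_p (Suc k)))"
    by (simp only: p[OF assms(1)] p[OF assms(2)])
  then show ?thesis by (simp only: c e[OF assms(1)] e[OF assms(2)])
qed

definition shiftification :: "mseries \<Rightarrow> mseries" where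
  "shiftification = (SOME \<phi>. is_shiftification \<phi>)"

lemma is_shiftification_shiftification: "is_shiftification shiftification"
  unfolding shiftification_def using ex_shiftification by (rule someI_ex)

section \<open>Parking functions\<close>

text \<open>Tuples are lists, so positions run over \<open>{..<n}\<close>; the entries of a parking function lie in \<open>{1..n}\<close>.\<close>

definition Pf :: "nat \<Rightarrow> nat list set" where
  "Pf n = {p. length p = n \<and> (\<forall>x\<in>set p. x \<ge> 1) \<and> (\<forall>i\<in>{1..n}. sort p ! (i - 1) \<le> i)}"

definition content :: "nat list \<Rightarrow> nat list" where
  "content p = map (\<lambda>k. count_list p k) [1..<length p + 1]"

definition shape :: "nat list \<Rightarrow> nat multiset" where
  "shape p = filter_mset (\<lambda>a. a \<noteq> 0) (mset (content p))"

definition odd_partition :: "nat multiset \<Rightarrow> bool" where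
  "odd_partition l \<longleftrightarrow> (\<forall>k\<in>#l. odd k)"

definition PF :: "nat \<Rightarrow> mseries" where
  "PF n = (\<Sum>p\<in>{p \<in> Pf n. sorted p}. sym_h_part (shape p))"

definition SH :: "nat \<Rightarrow> mseries" where
  "SH n = shiftification (PF n)"

section \<open>Odd shifted parking functions\<close>

definition bar :: "nat list \<Rightarrow> int list \<Rightarrow> nat \<Rightarrow> int" where
  "bar p \<sigma> k = (if count_list p k > 0 then \<Prod>i\<in>{i. i < length p \<and> p ! i = k}. \<sigma> ! i else 0)"

definition bar_tuple :: "nat list \<Rightarrow> int list \<Rightarrow> int list" where
  "bar_tuple p \<sigma> = map (bar p \<sigma>) [1..<length p + 1]"

definition noncrossing_matching :: "nat set \<Rightarrow> (nat \<times> nat) set \<Rightarrow> bool" where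
  "noncrossing_matching A \<tau> \<longleftrightarrow>
     (\<forall>(a, b)\<in>\<tau>. a \<in> A \<and> b \<in> A \<and> a < b) \<and>
     (\<forall>(a, b)\<in>\<tau>. \<forall>(c, d)\<in>\<tau>. (a, b) \<noteq> (c, d) \<longrightarrow> {a, b} \<inter> {c, d} = {}) \<and>
     \<not> (\<exists>a b c d. a < b \<and> b < c \<and> c < d \<and> (a, c) \<in> \<tau> \<and> (b, d) \<in> \<tau>)"

type_synonym shpf = "nat list \<times> int list \<times> (nat \<times> nat) set"

definition OShPf :: "nat \<Rightarrow> shpf set" where
  "OShPf n = {(p, \<sigma>, \<tau>).
     p \<in> Pf n \<and> odd_partition (shape p) \<and>
     length \<sigma> = n \<and> set \<sigma> \<subseteq> {-1, 1} \<and>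
     noncrossing_matching (set p) \<tau> \<and>
     (\<forall>(a, b)\<in>\<tau>. bar p \<sigma> a = - bar p \<sigma> b) \<and>
     (\<forall>a b c. (a, c) \<in> \<tau> \<and> a < b \<and> b < c \<longrightarrow> b \<in> set p) \<and>
     (\<forall>a b c d. (a, d) \<in> \<tau> \<and> (b, c) \<in> \<tau> \<and> a < b \<and> b < c \<and> c < d \<longrightarrow> bar p \<sigma> a = bar p \<sigma> b)}"

fun sort_shpf :: "shpf \<Rightarrow> shpf" where
  "sort_shpf (p, \<sigma>, \<tau>) = (sort p, bar_tuple p \<sigma>, \<tau>)"

definition sorted_OShPf :: "nat \<Rightarrow> shpf set" where
  "sorted_OShPf n = sort_shpf ` OShPf n"

section \<open>Modules of the symmetric group and Frobenius characters\<close>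

text \<open>The symmetric group on \<open>n\<close> letters consists of the \<open>w\<close> with \<open>w permutes {..<n}\<close>.\<close>

definition cycle_type :: "nat \<Rightarrow> (nat \<Rightarrow> nat) \<Rightarrow> nat multiset" where
  "cycle_type n w = image_mset card (mset_set (orbit w ` {..<n}))"

definition perm_of_type :: "nat \<Rightarrow> nat multiset \<Rightarrow> nat \<Rightarrow> nat" where
  "perm_of_type n l = (SOME w. w permutes {..<n} \<and> cycle_type n w = l)"

definition centralizer_order :: "nat \<Rightarrow> nat multiset \<Rightarrow> nat" where
  "centralizer_order n l =
     card {w. w permutes {..<n} \<and> w \<circ> perm_of_type n l = perm_of_type n l \<circ> w}"

definition frobenius_character :: "nat \<Rightarrow> ((nat \<Rightarrow> nat) \<Rightarrow> complex) \<Rightarrow> mseries" where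
  "frobenius_character n \<chi> =
     (\<Sum>l\<in>partitions n. mconst (\<chi> (perm_of_type n l) / of_nat (centralizer_order n l)) * sym_p_part l)"

text \<open>
  The trace of the linear operator \<open>T\<close> on the vector space with basis \<open>B\<close>, whose
  vectors are the finitely supported functions vanishing outside \<open>B\<close>.
\<close>

definition trace_on :: "'a set \<Rightarrow> (('a \<Rightarrow>\<^sub>0 complex) \<Rightarrow> ('a \<Rightarrow>\<^sub>0 complex)) \<Rightarrow> complex" where
  "trace_on B T = (\<Sum>b\<in>B. Poly_Mapping.lookup (T (Poly_Mapping.single b 1)) b)"

text \<open>The entry of \<open>tuple_act w a\<close> in position \<open>w i\<close> is \<open>a ! i\<close>.\<close>

definition tuple_act :: "(nat \<Rightarrow> nat) \<Rightarrow> 'a list \<Rightarrow> 'a list" where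
  "tuple_act w a = permute_list (inv w) a"

lemma tuple_act_nth:
  assumes "w permutes {..<length a}" "i < length a"
  shows "tuple_act w a ! w i = a ! i"
  using assms permutes_in_image[OF assms(1), of i] permutes_inv[OF assms(1)]
  by (simp add: tuple_act_def permute_list_nth permutes_inverses)

definition sorting_sign :: "nat list \<Rightarrow> int" where
  "sorting_sign xs = sign (THE \<pi>. \<pi> permutes {..<length xs} \<and> sorted (permute_list \<pi> xs))"

definition act_sign :: "(nat \<Rightarrow> nat) \<Rightarrow> int list \<Rightarrow> int" where
  "act_sign w \<sigma> = sorting_sign (map w (filter (\<lambda>i. \<sigma> ! i = -1) [0..<length \<sigma>]))"

fun basis_act :: "(nat \<Rightarrow> nat) \<Rightarrow> shpf \<Rightarrow> (shpf \<Rightarrow>\<^sub>0 complex)" where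
  "basis_act w (p, \<sigma>, \<tau>) =
     Poly_Mapping.single (tuple_act w p, tuple_act w \<sigma>, \<tau>) (of_int (act_sign w \<sigma>))"

definition shpf_act :: "(nat \<Rightarrow> nat) \<Rightarrow> (shpf \<Rightarrow>\<^sub>0 complex) \<Rightarrow> (shpf \<Rightarrow>\<^sub>0 complex)" where
  "shpf_act w v =
     (\<Sum>b\<in>Poly_Mapping.keys v. Poly_Mapping.map ((*) (Poly_Mapping.lookup v b)) (basis_act w b))"

definition OShPf_character :: "nat \<Rightarrow> (nat \<Rightarrow> nat) \<Rightarrow> complex" where
  "OShPf_character n w = trace_on (OShPf n) (shpf_act w)"

end

theory Submission
  imports Defs "HOL-Computational_Algebra.Formal_Power_Series"
begin

text \<open>
  Write \<open>q\<^sub>k = sh(h\<^sub>k) = 2 P\<^sub>k\<close> and \<open>Q(t) = \<Sum> q\<^sub>k t\<^sup>k\<close>, so \<open>Q(t) Q(-t) = 1\<close>. Contents of parking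
  functions are Lukasiewicz words, hence \<open>f = \<Sum> SH\<^sub>n z\<^bsup>n+1\<^esup>\<close> solves \<open>f = z Q(f)\<close>. Splitting
  \<open>Q\<close> into its even part and its odd part \<open>O\<close> turns this into \<open>f\<^sup>2 - 2 z f O(f) = z\<^sup>2\<close>, that is
  \<open>f = z C(z O(f) / 2f)\<close> with \<open>C(x)\<^sup>2 (1 - 4 x) = 1\<close>. The coefficients of \<open>C\<close> count the pairs of signs
  and matchings on a run of consecutive values, by decomposing at the arc starting at the first value;
  so \<open>f\<close> also enumerates the words with odd nonzero letters weighted by these counts, which is the
  expansion over sorted odd shifted parking functions.

  For the Frobenius character, the coefficient of a monomial \<open>m\<close> in \<open>p\<^sub>\<lambda>\<close> is the number of words
  of content \<open>m\<close> fixed by a permutation of cycle type \<open>\<lambda>\<close>. Averaging over the symmetric group, one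
  obtains a signed sum over stabilizers of words of labels (value, sign, variable): it vanishes if a
  negative label is repeated, and otherwise every multiset of labels contributes once. Grouping the
  labels by their value gives \<open>V\<^sub>\<lambda>\<close>, since half of the terms of \<open>\<Sum> h\<^sub>i e\<^bsub>k-i\<^esub>\<close>, those with a fixed
  parity of \<open>i\<close>, already sum to \<open>P\<^sub>k\<close>.
\<close>

section \<open>Symmetric functions\<close>

text \<open>The two expansions of SH_n are not matched word by word: one has letters of every size
  weighted by q_k, the other only odd letters weighted by P_k. Both are read off as coefficients of
  the same series f, and the even letters disappear because Q(t) Q(-t) = 1 expresses the square of
  the even part of Q through its odd part. The series C has the central binomial coefficients. They
  arise because condition (2) confines each arc to a maximal run of consecutive values, so the
  number of sign vectors and matchings is a product over runs. Within a run an outermost arc may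
  start with either sign, while by condition (3) everything nested below it repeats that sign; the
  inside is therefore counted by Catalan numbers instead. On the module side, \<tau> is never moved,
  and \<open>bar\<close> is unchanged when p and \<sigma> are permuted together. Hence the fibres of
  \<open>sort_shpf\<close> are stable under the action, and each of them contributes its own
  V_\<lambda>.\<close>

definition sym_q :: "nat \<Rightarrow> mseries" where
  "sym_q k = (\<Sum>i\<le>k. sym_h i * sym_e (k - i))"

definition fps_flip :: "'a::comm_ring_1 fps \<Rightarrow> 'a fps" where
  "fps_flip f = Abs_fps (\<lambda>n. (-1) ^ n * fps_nth f n)"

lemma fps_flip_mult: "fps_flip (f * g) = fps_flip f * fps_flip g"
proof (rule fps_ext)
  fix n
  have "(-1) ^ n * (\<Sum>i\<le>n. fps_nth f i * fps_nth g (n - i)) =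
      (\<Sum>i\<le>n. ((-1) ^ i * fps_nth f i) * ((-1) ^ (n - i) * fps_nth g (n - i)))"
    unfolding sum_distrib_left
  proof (rule sum.cong)
    fix i assume "i \<in> {..n}"
    then have "(-1 :: 'a) ^ n = (-1) ^ i * (-1) ^ (n - i)" by (simp flip: power_add)
    then show "(-1) ^ n * (fps_nth f i * fps_nth g (n - i)) =
      ((-1) ^ i * fps_nth f i) * ((-1) ^ (n - i) * fps_nth g (n - i))" by (simp add: mult_ac)
  qed simp
  then show "fps_nth (fps_flip (f * g)) n = fps_nth (fps_flip f * fps_flip g) n"
    by (simp add: fps_flip_def fps_mult_nth atLeast0AtMost)
qed

lemma fps_flip_flip [simp]: "fps_flip (fps_flip f) = f"
  by (rule fps_ext) (simp add: fps_flip_def flip: mult.assoc power_add)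

lemma fps_flip_1 [simp]: "fps_flip 1 = 1"
  by (rule fps_ext) (simp add: fps_flip_def)

lemma mcoeff_0 [simp]: "mcoeff 0 m = 0"
  and mcoeff_add [simp]: "mcoeff (f + g) m = mcoeff f m + mcoeff g m"
  and mcoeff_uminus [simp]: "mcoeff (- f) m = - mcoeff f m"
  and mcoeff_1: "mcoeff 1 m = (if m = {#} then 1 else 0)"
  and mcoeff_mult: "mcoeff (f * g) m = (\<Sum>(a, b)\<in>msplits m. mcoeff f a * mcoeff g b)"
  by (simp_all add: zero_mseries.rep_eq plus_mseries.rep_eq
      uminus_mseries.rep_eq one_mseries.rep_eq times_mseries.rep_eq)

lemma mconst_of_nat: "mconst (of_nat k) = of_nat k"
  by (induction k) (simp_all add: mconst_0 mconst_1 mconst_add)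

lemma mcoeff_of_nat_mult [simp]: "mcoeff (of_nat k * f) m = of_nat k * mcoeff f m"
  by (simp flip: mconst_of_nat)

text \<open>Torsion-freeness is inherited from the complex coefficients. It takes the place of
  division when the factor k of a Newton recursion or a factor 2 has to be removed.\<close>

lemma mseries_of_nat_mult_cancel:
  fixes f g :: mseries
  assumes "of_nat k * f = of_nat k * g" "k > 0" shows "f = g"
proof (rule mseries_eqI)
  fix m
  have "of_nat k * mcoeff f m = of_nat k * mcoeff g m"
    using assms(1) by (metis mcoeff_of_nat_mult)
  with assms(2) show "mcoeff f m = mcoeff g m" by simp
qed

lemma mcoeff_power_minus_one_mult: "mcoeff ((-1) ^ i * f) m = (-1) ^ i * mcoeff f m"
  by (induction i) auto

lemma sum_msplits: "(\<Sum>(a, b)\<in>msplits m. F a b) = (\<Sum>a | a \<subseteq># m. F a (m - a))"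
  by (rule sum.reindex_bij_witness[of _ "\<lambda>a. (a, m - a)" fst]) auto

text \<open>At a monomial m of degree k, the left side is the signed count of squarefree divisors of
  m, that is, of subsets of its support. Toggling one fixed variable cancels them in pairs unless m
  is trivial.\<close>

lemma sum_sym_e_h:
  "(\<Sum>i\<le>k. (-1) ^ i * sym_e i * sym_h (k - i)) = (if k = 0 then 1 else 0)"
proof (rule mseries_eqI)
  fix m :: "nat multiset"
  let ?T = "{a. a \<subseteq># m \<and> (\<forall>j. count a j \<le> 1)}"
  have fin: "finite ?T" by (rule finite_subset[OF _ finite_submultisets[of m]]) auto
  have c: "mcoeff ((-1) ^ i * sym_e i * sym_h (k - i)) m
      = (\<Sum>a\<in>?T. if size a = i \<and> size m - size a = k - i then (-1) ^ i else 0)" for i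
  proof -
    have "mcoeff ((-1) ^ i * sym_e i * sym_h (k - i)) m = (-1) ^ i * mcoeff (sym_e i * sym_h (k - i)) m"
      by (simp add: mcoeff_power_minus_one_mult mult.assoc)
    also have "mcoeff (sym_e i * sym_h (k - i)) m
        = (\<Sum>a | a \<subseteq># m. mcoeff (sym_e i) a * mcoeff (sym_h (k - i)) (m - a))"
      by (simp only: mcoeff_mult sum_msplits)
    also have "\<dots> = (\<Sum>a\<in>?T. mcoeff (sym_e i) a * mcoeff (sym_h (k - i)) (m - a))"
      by (rule sum.mono_neutral_right) (auto simp: finite_submultisets sym_e.rep_eq)
    also have "\<dots> = (\<Sum>a\<in>?T. if size a = i \<and> size m - size a = k - i then 1 else 0)"
      by (rule sum.cong) (auto simp: sym_e.rep_eq sym_h.rep_eq size_Diff_submset)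
    finally show ?thesis by (simp add: sum_distrib_left if_distrib cong: if_cong)
  qed
  have "mcoeff (\<Sum>i\<le>k. (-1) ^ i * sym_e i * sym_h (k - i)) m
      = (\<Sum>i\<le>k. \<Sum>a\<in>?T. if size a = i \<and> size m - size a = k - i then (-1) ^ i else 0)"
    by (simp only: mcoeff_sum c)
  also have "\<dots> = (\<Sum>a\<in>?T. \<Sum>i\<le>k. if size a = i \<and> size m - size a = k - i then (-1) ^ i else 0)"
    by (rule sum.swap)
  also have "\<dots> = (\<Sum>a\<in>?T. if size m = k then (-1) ^ size a else 0)"
  proof (rule sum.cong)
    fix a assume "a \<in> ?T"
    then have le: "size a \<le> size m" by (auto dest: size_mset_mono)
    have "(\<Sum>i\<le>k. if size a = i \<and> size m - size a = k - i then (-1) ^ i else 0)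
        = (\<Sum>i\<le>k. if i = size a then (if size m = k then (-1) ^ size a else (0::complex)) else 0)"
      by (rule sum.cong) (use le in auto)
    then show "(\<Sum>i\<le>k. if size a = i \<and> size m - size a = k - i then (-1) ^ i else 0)
        = (if size m = k then (-1) ^ size a else (0::complex))"
      using le by auto
  qed simp
  also have "\<dots> = (if size m = k then \<Sum>a\<in>?T. (-1) ^ size a else 0)" by simp
  \<comment> \<open>Submultisets of m without repetition are exactly the subsets of its
    support.\<close>
  also have "(\<Sum>a\<in>?T. (-1) ^ size a :: complex) = (\<Sum>A\<in>Pow (set_mset m). (-1) ^ card A)"
  proof (rule sum.reindex_bij_witness[of _ mset_set set_mset])
    fix a assume a: "a \<in> ?T"
    show "mset_set (set_mset a) = a"
    proof (rule multiset_eqI)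
      fix x
      have "count a x \<le> 1" using a by simp
      then have "count a x = (if x \<in># a then 1 else 0)"
        by (metis One_nat_def count_eq_zero_iff le_Suc_eq le_zero_eq)
      then show "count (mset_set (set_mset a)) x = count a x"
        by (simp add: count_mset_set')
    qed
    then show "(-1 :: complex) ^ card (set_mset a) = (-1) ^ size a" by (metis size_mset_set)
    show "set_mset a \<in> Pow (set_mset m)" using a by (auto dest: mset_subset_eqD)
  next
    fix A assume A: "A \<in> Pow (set_mset m)"
    then have finA: "finite A" by (auto intro: finite_subset)
    then show "set_mset (mset_set A) = A" by simp
    have "mset_set A \<subseteq># m"
      using A by (auto simp: subseteq_mset_def count_mset_set' Suc_le_eq)
    then show "mset_set A \<in> ?T" by (simp add: count_mset_set')
  qed
  also have "\<dots> = (if m = {#} then 1 else 0)"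
  proof (cases "m = {#}")
    case False
    then obtain x where x: "x \<in># m" by blast
    \<comment> \<open>Toggling x flips every sign, so the sum equals its own negative.\<close>
    have "(\<Sum>A\<in>Pow (set_mset m). (-1) ^ card A :: complex) = (\<Sum>A\<in>Pow (set_mset m). - ((-1) ^ card A))"
    proof (rule sum.reindex_bij_witness[of _ "\<lambda>A. if x \<in> A then A - {x} else insert x A"
          "\<lambda>A. if x \<in> A then A - {x} else insert x A"])
      fix A assume A: "A \<in> Pow (set_mset m)"
      then have fin: "finite A" by (auto intro: finite_subset)
      show "- ((-1 :: complex) ^ card (if x \<in> A then A - {x} else insert x A)) = (-1) ^ card A"
      proof (cases "x \<in> A")
        case True
        then have "card A = Suc (card (A - {x}))" using fin by (metis card_Suc_Diff1)
        with True show ?thesis by (simp only: if_True power_Suc) simp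
      qed (use fin in auto)
    qed (use x in auto)
    with False show ?thesis by (simp add: sum_negf)
  qed simp
  finally show "mcoeff (\<Sum>i\<le>k. (-1) ^ i * sym_e i * sym_h (k - i)) m
      = mcoeff (if k = 0 then 1 else 0) m"
    by (auto simp: mcoeff_1)
qed

lemma sym_h_0 [simp]: "sym_h 0 = 1" and sym_e_0 [simp]: "sym_e 0 = 1"
  by (auto intro!: mseries_eqI simp: sym_h.rep_eq sym_e.rep_eq mcoeff_1)

lemma sym_q_0 [simp]: "sym_q 0 = 1"
  by (simp add: sym_q_def)

text \<open>Stripping i+1 copies of one variable j from m is possible when i+1 is at most the
  exponent of j. The pairs (j, i) thus number the sum of all exponents of m, which is its degree
  k+1.\<close>

lemma newton_sym_h:
  "of_nat (Suc k) * sym_h (Suc k) = (\<Sum>i\<le>k. sym_p (Suc i) * sym_h (k - i))"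
proof (rule mseries_eqI)
  fix m :: "nat multiset"
  have c: "mcoeff (sym_p (Suc i) * sym_h (k - i)) m
      = (\<Sum>j\<in>set_mset m. if Suc i \<le> count m j \<and> size m = Suc k then 1 else 0)"
    if i: "i \<le> k" for i
  proof -
    let ?T = "{j \<in> set_mset m. Suc i \<le> count m j}"
    have inj: "inj_on (replicate_mset (Suc i)) ?T"
      by (rule inj_onI) (metis Zero_not_Suc in_replicate_mset bot_nat_0.not_eq_extremum)
    have sub: "replicate_mset (Suc i) j \<subseteq># m \<longleftrightarrow> j \<in> ?T" for j
      using count_le_replicate_mset_subset_eq[of "Suc i" m j]
      by (metis (mono_tags, lifting) Suc_le_lessD count_greater_zero_iff gr_zeroI mem_Collect_eq not_less_zero)
    have "mcoeff (sym_p (Suc i) * sym_h (k - i)) m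
        = (\<Sum>a | a \<subseteq># m. mcoeff (sym_p (Suc i)) a * mcoeff (sym_h (k - i)) (m - a))"
      by (simp only: mcoeff_mult sum_msplits)
    also have "\<dots> = (\<Sum>a\<in>replicate_mset (Suc i) ` ?T. mcoeff (sym_p (Suc i)) a * mcoeff (sym_h (k - i)) (m - a))"
    proof (rule sum.mono_neutral_right[OF finite_submultisets])
      show "replicate_mset (Suc i) ` ?T \<subseteq> {a. a \<subseteq># m}" using sub by blast
      show "\<forall>a\<in>{a. a \<subseteq># m} - replicate_mset (Suc i) ` ?T.
          mcoeff (sym_p (Suc i)) a * mcoeff (sym_h (k - i)) (m - a) = 0"
        unfolding sym_p.rep_eq using sub by auto
    qed
    also have "\<dots> = (\<Sum>j\<in>?T. mcoeff (sym_p (Suc i)) (replicate_mset (Suc i) j)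
        * mcoeff (sym_h (k - i)) (m - replicate_mset (Suc i) j))"
      using inj by (simp add: sum.reindex del: replicate_mset_Suc)
    also have "\<dots> = (\<Sum>j\<in>?T. if size m = Suc k then 1 else 0)"
    proof (rule sum.cong)
      fix j assume "j \<in> ?T"
      then have s: "replicate_mset (Suc i) j \<subseteq># m" by (simp only: sub)
      then have "size (m - replicate_mset (Suc i) j) = size m - Suc i" "Suc i \<le> size m"
        using size_Diff_submset[OF s] size_mset_mono[OF s] by simp_all
      then show "mcoeff (sym_p (Suc i)) (replicate_mset (Suc i) j)
        * mcoeff (sym_h (k - i)) (m - replicate_mset (Suc i) j) = (if size m = Suc k then 1 else 0)"
        using i by (auto simp: sym_p.rep_eq sym_h.rep_eq simp del: replicate_mset_Suc)
    qed simp
    also have "\<dots> = (\<Sum>j\<in>set_mset m. if Suc i \<le> count m j \<and> size m = Suc k then 1 else 0)"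
      by (rule sum.mono_neutral_cong_left) auto
    finally show ?thesis .
  qed
  have "mcoeff (\<Sum>i\<le>k. sym_p (Suc i) * sym_h (k - i)) m
      = (\<Sum>i\<le>k. \<Sum>j\<in>set_mset m. if Suc i \<le> count m j \<and> size m = Suc k then 1 else 0)"
    by (simp add: mcoeff_sum c)
  also have "\<dots> = (\<Sum>j\<in>set_mset m. \<Sum>i\<le>k. if Suc i \<le> count m j \<and> size m = Suc k then 1 else 0)"
    by (rule sum.swap)
  also have "\<dots> = (\<Sum>j\<in>set_mset m. if size m = Suc k then of_nat (count m j) else 0)"
  proof (rule sum.cong)
    fix j assume "j \<in># m"
    have "count m j \<le> Suc k" if "size m = Suc k" using that by (metis count_le_size)
    then have "{i. i \<le> k \<and> Suc i \<le> count m j} = {..<count m j}" if "size m = Suc k"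
      using that by auto
    then show "(\<Sum>i\<le>k. if Suc i \<le> count m j \<and> size m = Suc k then 1 else 0)
        = (if size m = Suc k then of_nat (count m j) else (0::complex))"
      by (auto simp: atMost_def simp flip: sum.inter_filter)
  qed simp
  also have "\<dots> = (if size m = Suc k then of_nat (size m) else 0)"
    by (simp only: size_multiset_overloaded_eq of_nat_sum) simp
  finally show "mcoeff (of_nat (Suc k) * sym_h (Suc k)) m
      = mcoeff (\<Sum>i\<le>k. sym_p (Suc i) * sym_h (k - i)) m"
    by (simp add: sym_h.rep_eq del: of_nat_Suc)
qed

section \<open>Generating series of h, e and q\<close>

definition H_series :: "mseries fps" where "H_series = Abs_fps sym_h"
definition E_series :: "mseries fps" where "E_series = Abs_fps sym_e"
definition Q_series :: "mseries fps" where "Q_series = Abs_fps sym_q"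

lemma Q_series_eq: "Q_series = H_series * E_series"
  by (rule fps_ext) (simp add: Q_series_def H_series_def E_series_def fps_mult_nth sym_q_def atLeast0AtMost)

lemma flip_E_H: "fps_flip E_series * H_series = 1"
  by (rule fps_ext) (simp add: H_series_def E_series_def fps_flip_def fps_mult_nth atLeast0AtMost
      sum_sym_e_h flip: fps_one_nth)

lemma Q_series_flip: "Q_series * fps_flip Q_series = 1"
proof -
  have "fps_flip (fps_flip E_series * H_series) = 1" by (simp add: flip_E_H)
  then have "E_series * fps_flip H_series = 1" by (simp add: fps_flip_mult)
  moreover have "Q_series * fps_flip Q_series
      = (fps_flip E_series * H_series) * (E_series * fps_flip H_series)"
    by (simp add: Q_series_eq fps_flip_mult mult_ac)
  ultimately show ?thesis by (simp add: flip_E_H)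
qed

text \<open>Logarithmic derivatives: H' = P H, and E(-t) is the inverse of H, so E' = P(-t) E and Q'
  = (P + P(-t)) Q. The factor P(t) + P(-t) doubles the odd power sums and kills the even ones, which
  is the effect of shiftification on power sums.\<close>

lemma newton_sym_q:
  "of_nat (Suc k) * sym_q (Suc k) = (\<Sum>i\<le>k. (if even i then 2 * sym_p (Suc i) else 0) * sym_q (k - i))"
proof -
  define P :: "mseries fps" where "P = Abs_fps (\<lambda>i. sym_p (Suc i))"
  have H': "fps_deriv H_series = P * H_series"
    by (rule fps_ext) (simp add: P_def H_series_def fps_mult_nth atLeast0AtMost newton_sym_h del: of_nat_Suc)
  have "fps_deriv (fps_flip E_series * H_series) = 0" by (simp add: flip_E_H)
  then have "fps_deriv (fps_flip E_series) * H_series = - (P * (fps_flip E_series * H_series))"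
    by (simp add: H' algebra_simps eq_neg_iff_add_eq_0)
  then have eq: "fps_deriv (fps_flip E_series) * H_series = - P" by (simp add: flip_E_H)
  have "fps_deriv (fps_flip E_series) = (fps_deriv (fps_flip E_series) * H_series) * fps_flip E_series"
    using flip_E_H by (simp only: mult.assoc mult.commute[of H_series]) simp
  then have Em': "fps_deriv (fps_flip E_series) = - (P * fps_flip E_series)"
    unfolding eq by simp
  have E': "fps_deriv E_series = fps_flip P * E_series"
  proof -
    \<comment> \<open>The chain rule for t -> -t, applied to the flipped series.\<close>
    have fd: "fps_deriv f = - fps_flip (fps_deriv (fps_flip f))" for f :: "mseries fps"
    proof (rule fps_ext)
      fix n show "fps_nth (fps_deriv f) n = fps_nth (- fps_flip (fps_deriv (fps_flip f))) n"
        by (cases "even n") (simp_all add: fps_flip_def)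
    qed
    have "fps_deriv E_series = fps_flip (P * fps_flip E_series)"
      by (subst fd, subst Em') (rule fps_ext, simp add: fps_flip_def)
    then show ?thesis by (simp add: fps_flip_mult)
  qed
  have "fps_deriv Q_series = (P + fps_flip P) * Q_series"
    by (simp add: Q_series_eq H' E' algebra_simps)
  then have "fps_nth (fps_deriv Q_series) k = fps_nth ((P + fps_flip P) * Q_series) k" by simp
  also have "fps_nth ((P + fps_flip P) * Q_series) k
      = (\<Sum>i\<le>k. (sym_p (Suc i) + (-1) ^ i * sym_p (Suc i)) * sym_q (k - i))"
    by (simp add: P_def Q_series_def fps_flip_def fps_mult_nth atLeast0AtMost)
  also have "\<dots> = (\<Sum>i\<le>k. (if even i then 2 * sym_p (Suc i) else 0) * sym_q (k - i))"
    by (rule sum.cong) (auto simp flip: mult_2)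
  finally show ?thesis by (simp add: Q_series_def del: of_nat_Suc)
qed

section \<open>Shiftification of complete homogeneous functions\<close>

lemma Sym_h [simp]: "sym_h k \<in> Sym"
  by (rule SymI[of _ k]) (auto simp: sym_h.rep_eq split: if_splits)

lemma shiftification_add: "f \<in> Sym \<Longrightarrow> g \<in> Sym \<Longrightarrow> shiftification (f + g) = shiftification f + shiftification g"
  and shiftification_mult: "f \<in> Sym \<Longrightarrow> g \<in> Sym \<Longrightarrow> shiftification (f * g) = shiftification f * shiftification g"
  and shiftification_mconst: "shiftification (mconst c) = mconst c"
  using is_shiftification_shiftification by (auto simp: is_shiftification_def sym_alg_hom_def)

lemma shiftification_sum:
  "(\<And>x. x \<in> A \<Longrightarrow> F x \<in> Sym) \<Longrightarrow> shiftification (sum F A) = (\<Sum>x\<in>A. shiftification (F x))"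
  using shiftification_mconst[of 0]
  by (induction A rule: infinite_finite_induct)
    (auto simp: shiftification_add Sym_sum mconst_0)

lemma shiftification_prod_mset:
  "(\<And>k. F k \<in> Sym) \<Longrightarrow> shiftification (\<Prod>k\<in>#l. F k) = (\<Prod>k\<in>#l. shiftification (F k))"
  using shiftification_mconst[of 1]
  by (induction l) (auto simp: shiftification_mult Sym_prod_mset mconst_1)

lemma shiftification_p:
  "shiftification (sym_p (Suc i)) = (if even i then 2 * sym_p (Suc i) else 0)"
proof -
  have p: "\<forall>k\<ge>1. shiftification (sym_p (2 * k - 1)) = 2 * sym_p (2 * k - 1) \<and> shiftification (sym_p (2 * k)) = 0"
    using is_shiftification_shiftification by (simp add: is_shiftification_def)
  show ?thesis
  proof (cases "even i")
    case True
    then have "Suc i = 2 * Suc (i div 2) - 1" by simp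
    with p True show ?thesis by (metis le_add1 plus_1_eq_Suc)
  next
    case False
    then have "Suc i = 2 * (Suc i div 2)" "Suc i div 2 \<ge> 1" by auto
    with p False show ?thesis by metis
  qed
qed

text \<open>Applying the homomorphism to Newton's recursion for h produces the recursion
  \<open>newton_sym_q\<close>; the two sequences start alike and the leading factor can be
  cancelled.\<close>

lemma shiftification_h: "shiftification (sym_h k) = sym_q k"
proof (induction k rule: less_induct)
  case (less k)
  show ?case
  proof (cases k)
    case 0
    then show ?thesis using shiftification_mconst[of 1] by (simp add: mconst_1)
  next
    case (Suc j)
    have "of_nat (Suc j) * shiftification (sym_h (Suc j)) = shiftification (mconst (of_nat (Suc j)) * sym_h (Suc j))"
      unfolding shiftification_mult[OF Sym_const Sym_h] shiftification_mconst by (simp only: mconst_of_nat)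
    also have "\<dots> = (\<Sum>i\<le>j. shiftification (sym_p (Suc i)) * shiftification (sym_h (j - i)))"
      by (simp add: mconst_of_nat newton_sym_h shiftification_sum shiftification_mult Sym_mult del: of_nat_Suc)
    also have "\<dots> = of_nat (Suc j) * sym_q (Suc j)"
      unfolding newton_sym_q by (rule sum.cong) (simp_all add: shiftification_p less.IH Suc)
    finally show ?thesis using Suc mseries_of_nat_mult_cancel zero_less_Suc by blast
  qed
qed

lemma mconst_half_add: "mconst (1/2) * f + mconst (1/2) * f = f"
  by (rule mseries_eqI) (simp only: mcoeff_add mcoeff_const_mult, simp)

lemma sym_P_double: "k > 0 \<Longrightarrow> 2 * sym_P k = sym_q k"
  unfolding mult_2 by (simp add: sym_P_def mconst_half_add flip: sym_q_def)

text \<open>The alternating sum of e_i h_{k-i} vanishes for k > 0, so the terms with even i and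
  those with odd i have equal sums, each half of q_k. A fixed product of signs fixes the parity of
  the number i of negative labels, which is how this form is used later.\<close>

lemma sym_P_parity:
  assumes "k > 0"
  shows "(\<Sum>i | i \<le> k \<and> even i = b. sym_h (k - i) * sym_e i) = sym_P k"
proof -
  define S where "S b = (\<Sum>i | i \<le> k \<and> even i = b. sym_h (k - i) * sym_e i)" for b
  have part: "{..k} = {i. i \<le> k \<and> even i = True} \<union> {i. i \<le> k \<and> even i = False}" by auto
  have "(\<Sum>i\<le>k. sym_h (k - i) * sym_e i) = S True + S False"
    unfolding S_def by (subst part, subst sum.union_disjoint) auto
  moreover have "(\<Sum>i\<le>k. sym_h (k - i) * sym_e i) = sym_q k"
    unfolding sym_q_def by (rule sum.reindex_bij_witness[of _ "\<lambda>i. k - i" "\<lambda>i. k - i"]) auto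
  moreover have "(\<Sum>i\<le>k. (-1) ^ i * sym_e i * sym_h (k - i)) = S True - S False"
    unfolding S_def by (subst part, subst sum.union_disjoint) (auto simp: sum_negf mult.commute)
  ultimately have "S True = S False" "sym_q k = S True + S False"
    using assms by (auto simp: sum_sym_e_h)
  then have "2 * S b = 2 * sym_P k" for b
    using assms by (cases b) (simp_all add: sym_P_double)
  then have "S b = sym_P k" using mseries_of_nat_mult_cancel[of 2 "S b" "sym_P k"] by simp
  then show ?thesis by (simp add: S_def)
qed

section \<open>Formal power series over a commutative ring\<close>

lemma fps_power_nth_below:
  fixes c :: "'a::comm_ring_1 fps"
  assumes "fps_nth c 0 = 0" "n < i" shows "fps_nth (c ^ i) n = 0"
  using assms(2)
proof (induction i arbitrary: n)
  case (Suc i)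
  have "fps_nth c k * fps_nth (c ^ i) (n - k) = 0" if "k \<le> n" for k
    using assms(1) Suc.IH[of "n - k"] Suc.prems that by (cases "k = 0") auto
  then show ?case by (auto simp: fps_mult_nth intro!: sum.neutral)
qed simp

text \<open>Since c^i starts in degree i, all inner sums may be extended to the common bound n and
  interchanged. The coefficient becomes linear in a, the shape needed to split off one letter a_i of
  a word.\<close>

lemma fps_mult_compose_nth:
  fixes c :: "'a::comm_ring_1 fps"
  assumes "fps_nth c 0 = 0"
  shows "fps_nth (g * (a oo c)) n = (\<Sum>i\<le>n. fps_nth a i * fps_nth (g * c ^ i) n)"
proof -
  have "fps_nth (g * (a oo c)) n
      = (\<Sum>k\<le>n. fps_nth g k * (\<Sum>i\<le>n - k. fps_nth a i * fps_nth (c ^ i) (n - k)))"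
    by (simp add: fps_mult_nth fps_compose_nth atLeast0AtMost)
  also have "\<dots> = (\<Sum>k\<le>n. fps_nth g k * (\<Sum>i\<le>n. fps_nth a i * fps_nth (c ^ i) (n - k)))"
    by (intro sum.cong arg_cong2[where f = "(*)"] sum.mono_neutral_left)
      (auto simp: fps_power_nth_below[OF assms])
  also have "\<dots> = (\<Sum>i\<le>n. \<Sum>k\<le>n. fps_nth g k * (fps_nth a i * fps_nth (c ^ i) (n - k)))"
    by (subst sum.swap) (simp add: sum_distrib_left)
  also have "\<dots> = (\<Sum>i\<le>n. fps_nth a i * fps_nth (g * c ^ i) n)"
    by (simp add: fps_mult_nth atLeast0AtMost sum_distrib_left mult_ac)
  finally show ?thesis .
qed

text \<open>Products of terms with i + j > n start above degree n and drop out; the remaining ones,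
  grouped by s = i + j, form the Cauchy product. Only commutativity of the coefficient ring
  enters.\<close>

lemma fps_compose_mult_distrib_ring:
  fixes c :: "'a::comm_ring_1 fps"
  assumes "fps_nth c 0 = 0"
  shows "(a * b) oo c = (a oo c) * (b oo c)"
proof (rule fps_ext)
  fix n
  have "fps_nth ((a oo c) * (b oo c)) n
      = (\<Sum>i\<le>n. fps_nth b i * (\<Sum>j\<le>n. fps_nth a j * fps_nth (c ^ i * c ^ j) n))"
    by (simp only: fps_mult_compose_nth[OF assms] mult.commute[of "a oo c" "c ^ _"])
  also have "\<dots> = (\<Sum>(i, j)\<in>{..n} \<times> {..n}. fps_nth b i * fps_nth a j * fps_nth (c ^ (i + j)) n)"
    by (simp add: sum.cartesian_product[symmetric] sum_distrib_left mult.assoc power_add)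
  also have "\<dots> = (\<Sum>(i, j)\<in>{(i, j). i + j \<le> n}. fps_nth b i * fps_nth a j * fps_nth (c ^ (i + j)) n)"
  proof (rule sum.mono_neutral_right)
    show "{(i, j). i + j \<le> n} \<subseteq> {..n} \<times> {..n}" by auto
    show "\<forall>x\<in>{..n} \<times> {..n} - {(i, j). i + j \<le> n}.
        (case x of (i, j) \<Rightarrow> fps_nth b i * fps_nth a j * fps_nth (c ^ (i + j)) n) = 0"
      by auto (metis fps_power_nth_below[OF assms] mult_zero_right not_le)
  qed simp
  also have "\<dots> = (\<Sum>s\<le>n. \<Sum>i\<le>s. fps_nth b i * fps_nth a (s - i) * fps_nth (c ^ s) n)"
    by (subst sum.triangle_reindex_eq) simp
  also have "\<dots> = fps_nth ((b * a) oo c) n"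
    by (simp add: fps_compose_nth fps_mult_nth atLeast0AtMost sum_distrib_right)
  finally show "fps_nth ((a * b) oo c) n = fps_nth ((a oo c) * (b oo c)) n"
    by (simp add: mult.commute)
qed

text \<open>Each application of \<Phi> makes one more coefficient final: the iterates of 0 with
  index above i agree in degree i. The diagonal of these stable coefficients is the fixed
  point.\<close>

lemma fps_fixpoint_exists:
  fixes \<Phi> :: "'a::zero fps \<Rightarrow> 'a fps"
  assumes \<Phi>: "\<And>f g n. (\<And>i. i < n \<Longrightarrow> fps_nth f i = fps_nth g i) \<Longrightarrow> fps_nth (\<Phi> f) n = fps_nth (\<Phi> g) n"
  shows "\<exists>f. \<Phi> f = f"
proof -
  define F where "F k = (\<Phi> ^^ k) 0" for k
  have F_Suc: "F (Suc k) = \<Phi> (F k)" for k by (simp add: F_def)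
  have step: "fps_nth (F k) i = fps_nth (F (Suc k)) i" if "i < k" for i k
    using that
  proof (induction k arbitrary: i)
    case (Suc k)
    then show ?case by (simp only: F_Suc) (rule \<Phi>, simp add: F_Suc)
  qed simp
  have stable: "fps_nth (F (Suc i + k)) i = fps_nth (F (Suc i)) i" for i k
    by (induction k) (simp_all flip: step)
  define f where "f = Abs_fps (\<lambda>i. fps_nth (F (Suc i)) i)"
  have "fps_nth (\<Phi> f) n = fps_nth f n" for n
  proof -
    have "fps_nth (\<Phi> f) n = fps_nth (\<Phi> (F n)) n"
    proof (rule \<Phi>)
      fix i assume "i < n"
      then obtain k where "n = Suc i + k" by (auto simp: less_iff_Suc_add)
      then show "fps_nth f i = fps_nth (F n) i" using stable[of i k] by (simp add: f_def)
    qed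
    then show ?thesis by (simp add: f_def F_Suc)
  qed
  then have "\<Phi> f = f" by (rule fps_ext)
  then show ?thesis by blast
qed

lemma fps_mult_nth_cong:
  assumes "\<And>i. i \<le> n \<Longrightarrow> fps_nth f i = fps_nth f' i" "\<And>i. i \<le> n \<Longrightarrow> fps_nth g i = fps_nth g' i"
  shows "fps_nth (f * g) n = fps_nth (f' * g') n"
  unfolding fps_mult_nth by (rule sum.cong) (auto simp: assms)

lemma fps_power_nth_cong:
  fixes f g :: "'a::comm_ring_1 fps"
  assumes "\<And>i. i \<le> n \<Longrightarrow> fps_nth f i = fps_nth g i"
  shows "fps_nth (f ^ k) n = fps_nth (g ^ k) n"
  using assms
proof (induction k arbitrary: n)
  case (Suc k)
  then show ?case by (simp only: power_Suc) (rule fps_mult_nth_cong, auto)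
qed simp

text \<open>The factor \<open>fps_X\<close> shifts degrees, so coefficient n of the right side
  depends only on coefficients of f below n.\<close>

lemma fps_lagrange_exists:
  fixes q :: "'a::comm_ring_1 fps"
  shows "\<exists>f. f = fps_X * (q oo f)"
proof -
  have "\<exists>f. fps_X * (q oo f) = f"
  proof (rule fps_fixpoint_exists)
    fix f g :: "'a fps" and n
    assume eq: "\<And>i. i < n \<Longrightarrow> fps_nth f i = fps_nth g i"
    show "fps_nth (fps_X * (q oo f)) n = fps_nth (fps_X * (q oo g)) n"
    proof (cases n)
      case (Suc k)
      have "fps_nth (f ^ i) k = fps_nth (g ^ i) k" for i
        using eq Suc by (intro fps_power_nth_cong) auto
      then show ?thesis using Suc by (simp add: fps_compose_nth)
    qed simp
  qed
  then show ?thesis by metis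
qed

lemma fps_mult_eq_0_cancel:
  fixes u x :: "'a::comm_ring_1 fps"
  assumes "u * x = 0" "\<And>y. fps_nth u 0 * y = 0 \<Longrightarrow> y = 0"
  shows "x = 0"
proof (rule fps_ext)
  fix n show "fps_nth x n = fps_nth 0 n"
  proof (induction n rule: less_induct)
    case (less n)
    have "0 = fps_nth (u * x) n" using assms(1) by simp
    also have "\<dots> = (\<Sum>i\<in>{0}. fps_nth u i * fps_nth x (n - i))"
      unfolding fps_mult_nth by (rule sum.mono_neutral_right) (use less in auto)
    finally show ?case using assms(2) by simp
  qed
qed

text \<open>Both squares are inverse to v, hence equal, and (u + y)(u - y) = 0. The constant term of
  u + y is 2, which is no zero divisor, so u - y vanishes coefficient by coefficient.\<close>

lemma fps_square_unique:
  fixes u y v :: "'a::comm_ring_1 fps"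
  assumes "u\<^sup>2 * v = 1" "y\<^sup>2 * v = 1" "fps_nth u 0 = 1" "fps_nth y 0 = 1"
    and two: "\<And>x :: 'a. 2 * x = 0 \<Longrightarrow> x = 0"
  shows "u = y"
proof -
  have "u\<^sup>2 = u\<^sup>2 * (y\<^sup>2 * v)" using assms by simp
  also have "\<dots> = y\<^sup>2 * (u\<^sup>2 * v)" by (simp add: mult_ac)
  finally have "u\<^sup>2 = y\<^sup>2" using assms by simp
  then have "(u + y) * (u - y) = 0" by (simp add: power2_eq_square algebra_simps)
  then have "u - y = 0"
    by (rule fps_mult_eq_0_cancel) (use assms in \<open>simp add: two\<close>)
  then show ?thesis by simp
qed

text \<open>The Catalan numbers 1, 2, 5, 14, ... with index shifted by one. On a run whose arcs must
  all start with one prescribed sign, the first value is unmatched with either sign (factor 2), or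
  is matched across i values, leaving n - 1 - i after the arc.\<close>

fun nested_count :: "nat \<Rightarrow> nat" where
  "nested_count 0 = 1"
| "nested_count (Suc n) = 2 * nested_count n + (\<Sum>i<n. nested_count i * nested_count (n - 1 - i))"

text \<open>The central binomial coefficients 1, 2, 6, 20, ... Here the arc leaving the first value
  may start with either sign, whence the second factor 2; the i values below it are under the sign
  restriction of \<open>nested_count\<close>, the values after it are free.\<close>

fun run_count :: "nat \<Rightarrow> nat" where
  "run_count 0 = 1"
| "run_count (Suc n) = 2 * run_count n + 2 * (\<Sum>i<n. nested_count i * run_count (n - 1 - i))"

text \<open>The shift r is the length of the run already read when a word is processed letter by
  letter; \<open>run_series_rec\<close> decides whether the run stops at r or continues.\<close>

definition run_series :: "nat \<Rightarrow> 'a::comm_ring_1 fps" where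
  "run_series r = Abs_fps (\<lambda>m. of_nat (run_count (r + m)))"

lemma run_series_rec: "run_series r = fps_const (of_nat (run_count r)) + fps_X * run_series (Suc r)"
proof (rule fps_ext)
  fix n show "fps_nth (run_series r) n
    = fps_nth (fps_const (of_nat (run_count r)) + fps_X * run_series (Suc r)) n"
    by (cases n) (simp_all add: run_series_def)
qed

text \<open>The recursion of \<open>run_count\<close> is linear in C and says C w = 1, while the
  quadratic equation of D says that w squares to 1 - 4x.\<close>

lemma run_series_square: "(run_series 0)\<^sup>2 * (1 - 4 * fps_X) = (1 :: 'a::comm_ring_1 fps)"
proof -
  define C :: "'a fps" where "C = run_series 0"
  define D :: "'a fps" where "D = Abs_fps (\<lambda>m. of_nat (nested_count m))"
  define x :: "'a fps" where "x = fps_X"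
  \<comment> \<open>The factor x^2 stands for the two endpoints of the arc. For n = 0 there is no
    room for it and both sides are 0.\<close>
  have conv: "fps_nth (x\<^sup>2 * (f * g)) (Suc n) = (\<Sum>i<n. fps_nth f i * fps_nth g (n - 1 - i))"
    for f g :: "'a fps" and n
  proof (cases n)
    case (Suc k)
    have "fps_nth (x\<^sup>2 * (f * g)) (Suc n) = fps_nth (f * g) k"
      by (simp add: x_def power2_eq_square mult.assoc Suc)
    then show ?thesis
      by (simp add: fps_mult_nth atLeast0AtMost lessThan_Suc_atMost Suc)
  qed (simp add: x_def power2_eq_square mult.assoc)
  have D: "D = 1 + 2 * x * D + x\<^sup>2 * (D * D)"
  proof (rule fps_ext)
    fix n show "fps_nth D n = fps_nth (1 + 2 * x * D + x\<^sup>2 * (D * D)) n"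
    proof (cases n)
      case (Suc k)
      have "fps_nth (2 * x * D) (Suc k) = 2 * fps_nth D k"
        by (simp add: x_def mult.assoc numeral_fps_const)
      then show ?thesis using Suc
        by (simp add: conv) (simp add: D_def)
    qed (simp add: D_def x_def power2_eq_square mult.assoc)
  qed
  have C: "C = 1 + 2 * x * C + 2 * (x\<^sup>2 * (D * C))"
  proof (rule fps_ext)
    fix n show "fps_nth C n = fps_nth (1 + 2 * x * C + 2 * (x\<^sup>2 * (D * C))) n"
    proof (cases n)
      case (Suc k)
      have "fps_nth (2 * x * C) (Suc k) = 2 * fps_nth C k"
        by (simp add: x_def mult.assoc numeral_fps_const)
      moreover have "fps_nth (2 * (x\<^sup>2 * (D * C))) (Suc k) = 2 * fps_nth (x\<^sup>2 * (D * C)) (Suc k)"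
        by (simp add: numeral_fps_const)
      ultimately show ?thesis using Suc
        by (simp add: conv) (simp add: C_def D_def run_series_def)
    qed (simp add: C_def run_series_def x_def power2_eq_square mult.assoc)
  qed
  \<comment> \<open>The square root of the discriminant (1 - 2x)^2 - 4x^2 of the quadratic equation
    for D.\<close>
  define w where "w = 1 - 2 * x - 2 * (x\<^sup>2 * D)"
  have "C * w = 1" using C unfolding w_def by (simp add: algebra_simps)
  moreover have "w\<^sup>2 = 1 - 4 * x"
  proof -
    have "x\<^sup>2 * (D * D) = D - 1 - 2 * x * D" using D by (simp add: algebra_simps)
    moreover have "w\<^sup>2 = (1 - 2 * x)\<^sup>2 - 4 * x\<^sup>2 * D * (1 - 2 * x) + 4 * x\<^sup>2 * (x\<^sup>2 * (D * D))"
      by (simp add: w_def power2_eq_square algebra_simps)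
    ultimately have "w\<^sup>2 = (1 - 2 * x)\<^sup>2 - 4 * x\<^sup>2 * D * (1 - 2 * x) + 4 * x\<^sup>2 * (D - 1 - 2 * x * D)"
      by simp
    then show ?thesis by (simp add: power2_eq_square algebra_simps)
  qed
  moreover have "C\<^sup>2 * w\<^sup>2 = (C * w)\<^sup>2" by (simp add: power_mult_distrib)
  ultimately show ?thesis by (simp add: C_def x_def)
qed

section \<open>Words weighted by runs\<close>

text \<open>This is O(t)/(2t): the coefficient of t^k belongs to the letter k + 1. Dividing by t
  reflects that such a letter raises the height by k.\<close>

definition P_odd_series :: "mseries fps" where
  "P_odd_series = Abs_fps (\<lambda>k. if even k then sym_P (Suc k) else 0)"

text \<open>Put u = f/z, and let e and 2fa be the even and odd parts of Q at f. Inserting e = u -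
  2fa into e^2 = 1 + 4(fa)^2 cancels the squares of fa. With f = zu there remains u^2 (1 - 4za) = 1,
  the equation of the run series at za, and a series with constant term 1 is determined by
  it.\<close>

lemma run_series_lagrange:
  assumes f: "f = fps_X * (Q_series oo f)"
  shows "f = fps_X * (run_series 0 oo (fps_X * (P_odd_series oo f)))"
proof -
  define Ev where "Ev = Abs_fps (\<lambda>k. if even k then sym_q k else 0)"
  have Q: "Q_series = Ev + 2 * (fps_X * P_odd_series)"
  proof (rule fps_ext)
    fix n show "fps_nth Q_series n = fps_nth (Ev + 2 * (fps_X * P_odd_series)) n"
      by (cases n) (auto simp: Q_series_def Ev_def P_odd_series_def numeral_fps_const sym_P_double)
  qed
  have Qm: "fps_flip Q_series = Ev - 2 * (fps_X * P_odd_series)"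
  proof (rule fps_ext)
    fix n show "fps_nth (fps_flip Q_series) n = fps_nth (Ev - 2 * (fps_X * P_odd_series)) n"
      by (cases n) (auto simp: Q_series_def Ev_def P_odd_series_def numeral_fps_const sym_P_double fps_flip_def)
  qed
  have f0: "fps_nth f 0 = 0" by (subst f) simp
  define u where "u = Q_series oo f"
  define a where "a = P_odd_series oo f"
  define e where "e = Ev oo f"
  note comp = fps_compose_mult_distrib_ring[OF f0] fps_compose_add_distrib fps_compose_sub_distrib
  have two: "(2 :: mseries fps) oo f = 2"
    using fps_const_compose[of 2 f] by (simp add: numeral_fps_const)
  have u: "u = e + 2 * (f * a)" unfolding u_def by (subst Q) (simp add: comp two e_def a_def f0)
  have um: "fps_flip Q_series oo f = e - 2 * (f * a)" by (subst Qm) (simp add: comp two e_def a_def f0)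
  have "(Q_series * fps_flip Q_series) oo f = 1" by (simp add: Q_series_flip)
  then have e2: "e\<^sup>2 = 1 + 4 * (f * a)\<^sup>2"
    by (simp add: comp um u flip: u_def) (simp add: power2_eq_square algebra_simps)
  have fu: "f = fps_X * u" using f by (simp add: u_def)
  have "(u - 2 * (f * a))\<^sup>2 = 1 + 4 * (f * a)\<^sup>2" using u e2 by simp
  then have "u\<^sup>2 = 1 + 4 * (u * (f * a))" by (simp add: power2_eq_square algebra_simps)
  moreover have "u * (f * a) = u\<^sup>2 * (fps_X * a)" by (subst fu) (simp add: power2_eq_square mult_ac)
  ultimately have "u\<^sup>2 = 1 + 4 * (u\<^sup>2 * (fps_X * a))" by (simp only:)
  moreover have "u\<^sup>2 * (1 - 4 * (fps_X * a)) = u\<^sup>2 - 4 * (u\<^sup>2 * (fps_X * a))"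
    by (simp add: algebra_simps)
  ultimately have u2: "u\<^sup>2 * (1 - 4 * (fps_X * a)) = 1" by (metis add_diff_cancel_right')
  define y where "y = (run_series 0 :: mseries fps) oo (fps_X * a)"
  have X0: "fps_nth (fps_X * a) 0 = 0" by simp
  have four: "(4 :: mseries fps) oo (fps_X * a) = 4"
    using fps_const_compose[of 4 "fps_X * a"] by (simp add: numeral_fps_const)
  have "((run_series 0)\<^sup>2 * (1 - 4 * fps_X)) oo (fps_X * a) = 1" by (simp add: run_series_square)
  then have y2: "y\<^sup>2 * (1 - 4 * (fps_X * a)) = 1"
    by (simp add: fps_compose_mult_distrib_ring[OF X0] fps_compose_sub_distrib four power2_eq_square y_def)
  have "u = y"
  proof (rule fps_square_unique[OF u2 y2])
    show "fps_nth u 0 = 1" by (simp add: u_def Q_series_def)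
    show "fps_nth y 0 = 1" by (simp add: y_def run_series_def)
    show "x = 0" if "2 * x = 0" for x :: mseries
      using mseries_of_nat_mult_cancel[of 2 x 0] that by simp
  qed
  then show ?thesis using fu by (simp add: y_def a_def)
qed

text \<open>Words as paths: from height j, a letter a is a step a - 1, the height never drops below
  0 and ends at 0. The condition j + a \<ge> 1 also guards the truncated subtraction.\<close>

fun luk :: "nat \<Rightarrow> nat list \<Rightarrow> bool" where
  "luk j [] \<longleftrightarrow> j = 0"
| "luk j (a # w) \<longleftrightarrow> j + a \<ge> 1 \<and> luk (j + a - 1) w"

lemma luk_sum_list: "luk j w \<Longrightarrow> j + sum_list w = length w"
  by (induction j w rule: luk.induct) auto

lemma finite_luk: "finite {w. length w = N \<and> luk j w}"
proof (rule finite_subset)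
  show "{w. length w = N \<and> luk j w} \<subseteq> {w. set w \<subseteq> {..N} \<and> length w = N}"
    using luk_sum_list member_le_sum_list by fastforce
qed (simp add: finite_lists_length_eq)

text \<open>By \<open>luk_sum_list\<close> the letters of an admissible word add up to at most its
  length, so bounding the first letter by \<open>Suc N\<close> loses nothing.\<close>

lemma sum_luk_Suc:
  fixes F :: "nat list \<Rightarrow> 'a::comm_monoid_add"
  shows "(\<Sum>w | length w = Suc N \<and> luk j w. F w)
    = (\<Sum>a\<le>Suc N. if j + a = 0 then 0 else \<Sum>w | length w = N \<and> luk (j + a - 1) w. F (a # w))"
proof -
  let ?A = "{a. a \<le> Suc N \<and> j + a \<noteq> 0}"
  have "(\<Sum>w | length w = Suc N \<and> luk j w. F w)
      = (\<Sum>(a, w)\<in>(SIGMA a:?A. {w. length w = N \<and> luk (j + a - 1) w}). F (a # w))"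
  proof (rule sum.reindex_bij_witness[of _ "\<lambda>(a, w). a # w" "\<lambda>w. (hd w, tl w)"])
    fix w assume w: "w \<in> {w. length w = Suc N \<and> luk j w}"
    then obtain a v where [simp]: "w = a # v" by (cases w) auto
    have "j + a - 1 + sum_list v = N" using w luk_sum_list[of "j + a - 1" v] by auto
    with w show "(hd w, tl w) \<in> (SIGMA a:?A. {w. length w = N \<and> luk (j + a - 1) w})" by auto
  qed (auto simp: Suc_le_eq length_Suc_conv)
  also have "\<dots> = (\<Sum>a\<in>?A. \<Sum>w | length w = N \<and> luk (j + a - 1) w. F (a # w))"
    by (rule sum.Sigma[symmetric]) (auto simp: finite_luk)
  also have "\<dots> = (\<Sum>a\<le>Suc N. if j + a = 0 then 0 else \<Sum>w | length w = N \<and> luk (j + a - 1) w. F (a # w))"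
    by (rule sum.mono_neutral_cong_left) auto
  finally show ?thesis .
qed

lemma sum_luk_0:
  "(\<Sum>w | length w = 0 \<and> luk j w. F w) = (if j = 0 then F [] else 0)"
proof -
  have "{w. length w = 0 \<and> luk j w} = (if j = 0 then {[]} else {})" by auto
  then show ?thesis by simp
qed

text \<open>Splitting off the first letter of a word is the expansion of one factor of
  \<open>f\<^bsup>j+1\<^esup> = f\<^bsup>j\<^esup> z Q(f)\<close>.\<close>

lemma sum_luk_lagrange:
  fixes f q :: "'a::comm_ring_1 fps"
  assumes f: "f = fps_X * (q oo f)" and q0: "fps_nth q 0 = 1"
  shows "(\<Sum>w | length w = N \<and> luk j w. \<Prod>a\<leftarrow>w. fps_nth q a) = fps_nth (f ^ Suc j) (Suc N)"
proof (induction N arbitrary: j)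
  case 0
  have f0: "fps_nth f 0 = 0" by (subst f) simp
  have f1: "fps_nth f 1 = 1" by (subst f) (simp add: q0)
  have "fps_nth (f ^ Suc j) 1 = 0" if "j > 0"
    using fps_power_nth_below[OF f0, of 1 "Suc j"] that by simp
  then show ?case using f1 unfolding sum_luk_0 by (cases "j = 0") auto
next
  case (Suc N)
  have f0: "fps_nth f 0 = 0" by (subst f) simp
  have "f ^ Suc j = fps_X * (f ^ j * (q oo f))"
    by (subst power_Suc, subst (1) f) (simp add: mult_ac)
  then have "fps_nth (f ^ Suc j) (Suc (Suc N)) = fps_nth (f ^ j * (q oo f)) (Suc N)" by simp
  also have "\<dots> = (\<Sum>a\<le>Suc N. fps_nth q a * fps_nth (f ^ (j + a)) (Suc N))"
    by (simp only: fps_mult_compose_nth[OF f0] power_add)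
  also have "\<dots> = (\<Sum>a\<le>Suc N. if j + a = 0 then 0
      else \<Sum>w | length w = N \<and> luk (j + a - 1) w. \<Prod>a\<leftarrow>a # w. fps_nth q a)"
  proof (rule sum.cong)
    fix a
    show "fps_nth q a * fps_nth (f ^ (j + a)) (Suc N) = (if j + a = 0 then 0
      else \<Sum>w | length w = N \<and> luk (j + a - 1) w. \<Prod>a\<leftarrow>a # w. fps_nth q a)"
    proof (cases "j + a")
      case (Suc i)
      then show ?thesis using Suc.IH[of i] by (simp add: sum_distrib_left[symmetric])
    qed simp
  qed simp
  finally show ?case by (simp only: sum_luk_Suc)
qed

text \<open>The product of \<open>run_count\<close> over the maximal runs of nonzero letters, where
  the run at the start of the word already has r letters behind it. A zero letter closes a
  run.\<close>

fun run_weight :: "nat \<Rightarrow> nat list \<Rightarrow> nat" where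
  "run_weight r [] = run_count r"
| "run_weight r (a # w) = (if a = 0 then run_count r * run_weight 0 w else run_weight (Suc r) w)"

text \<open>The state of the reading is the pair of height j and current run length r, and its
  generating series is Y_r f^j. A letter 0 closes the run and descends one level; an odd letter i +
  1 lengthens the run and climbs by i. These are the two summands of \<open>Y_rec\<close>.\<close>

lemma sum_luk_runs:
  assumes f: "f = fps_X * (run_series 0 oo (fps_X * (P_odd_series oo f)))"
  shows "(\<Sum>w | length w = N \<and> luk j w.
      if \<forall>a\<in>set w. a = 0 \<or> odd a then of_nat (run_weight r w) * (\<Prod>a\<leftarrow>w. sym_P a) else 0)
    = fps_nth ((run_series r oo (fps_X * (P_odd_series oo f))) * f ^ j) N"
proof -
  define Y where "Y r = (run_series r :: mseries fps) oo (fps_X * (P_odd_series oo f))" for r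
  have f0: "fps_nth f 0 = 0" by (subst f) simp
  have fY: "f = fps_X * Y 0" using f by (simp add: Y_def)
  have Y_rec: "Y r = fps_const (of_nat (run_count r)) + fps_X * ((P_odd_series oo f) * Y (Suc r))" for r
    unfolding Y_def
    by (subst run_series_rec) (simp add: fps_compose_add_distrib fps_compose_mult_distrib_ring mult.assoc)
  let ?F = "\<lambda>r w. if \<forall>a\<in>set w. a = 0 \<or> odd a then of_nat (run_weight r w) * (\<Prod>a\<leftarrow>w. sym_P a) else 0"
  have "(\<Sum>w | length w = N \<and> luk j w. ?F r w) = fps_nth (Y r * f ^ j) N"
  proof (induction N arbitrary: j r)
    case 0
    show ?case unfolding sum_luk_0 by (cases "j = 0") (auto simp: Y_def run_series_def fps_power_nth_below[OF f0])
  next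
    case (Suc N)
    have P_sum: "fps_nth ((Y (Suc r) * f ^ j) * (P_odd_series oo f)) N
        = (\<Sum>i\<le>N. if even i then sym_P (Suc i) * fps_nth (Y (Suc r) * f ^ (j + i)) N else 0)"
      unfolding fps_mult_compose_nth[OF f0]
      by (rule sum.cong) (simp_all add: P_odd_series_def power_add mult.assoc)
    have "Y r * f ^ j = fps_const (of_nat (run_count r)) * f ^ j
        + fps_X * ((Y (Suc r) * f ^ j) * (P_odd_series oo f))"
      by (subst Y_rec) (simp add: algebra_simps)
    then have "fps_nth (Y r * f ^ j) (Suc N) = of_nat (run_count r) * fps_nth (f ^ j) (Suc N)
        + (\<Sum>i\<le>N. if even i then sym_P (Suc i) * fps_nth (Y (Suc r) * f ^ (j + i)) N else 0)"
      by (simp add: P_sum)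
    \<comment> \<open>The letter 0 resets the run length: f^j = z Y_0 f^(j-1) accounts for this
      letter and all that follows. At height 0 it is forbidden, and there f^0 has no coefficient in
      positive degree.\<close>
    moreover have "of_nat (run_count r) * fps_nth (f ^ j) (Suc N)
        = (if j + 0 = 0 then 0 else \<Sum>w | length w = N \<and> luk (j + 0 - 1) w. ?F r (0 # w))"
    proof (cases j)
      case (Suc i)
      have "f ^ j = fps_X * (Y 0 * f ^ i)" unfolding Suc power_Suc by (subst (1) fY) (simp add: mult_ac)
      then have "fps_nth (f ^ j) (Suc N) = (\<Sum>w | length w = N \<and> luk i w. ?F 0 w)" using Suc.IH by simp
      then show ?thesis using Suc
        by (auto simp: sum_distrib_left sym_P_def mult.assoc intro!: sum.cong)
    qed simp
    moreover have "(\<Sum>i\<le>N. if even i then sym_P (Suc i) * fps_nth (Y (Suc r) * f ^ (j + i)) N else 0)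
        = (\<Sum>i\<le>N. if j + Suc i = 0 then 0 else \<Sum>w | length w = N \<and> luk (j + Suc i - 1) w. ?F r (Suc i # w))"
    proof (rule sum.cong)
      fix i
      show "(if even i then sym_P (Suc i) * fps_nth (Y (Suc r) * f ^ (j + i)) N else 0)
        = (if j + Suc i = 0 then 0 else \<Sum>w | length w = N \<and> luk (j + Suc i - 1) w. ?F r (Suc i # w))"
        by (auto simp flip: Suc.IH simp: sum_distrib_left mult_ac intro!: sum.cong)
    qed simp
    ultimately show ?case
      unfolding sum_luk_Suc by (subst sum.atMost_Suc_shift) simp
  qed
  then show ?thesis by (simp add: Y_def)
qed

text \<open>Both sides are the coefficient of degree n + 1 in one solution f of the Lagrange
  equation; the factor z in front of the composed run series lowers the degree to n.\<close>

lemma sum_luk_sym_q_eq_runs: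
  "(\<Sum>w | length w = n \<and> luk 0 w. \<Prod>a\<leftarrow>w. sym_q a)
    = (\<Sum>w | length w = n \<and> luk 0 w.
        if \<forall>a\<in>set w. a = 0 \<or> odd a then of_nat (run_weight 0 w) * (\<Prod>a\<leftarrow>w. sym_P a) else 0)"
proof -
  obtain f where f: "f = fps_X * (Q_series oo f)" using fps_lagrange_exists by blast
  note f' = run_series_lagrange[OF f]
  have "(\<Sum>w | length w = n \<and> luk 0 w. \<Prod>a\<leftarrow>w. sym_q a) = fps_nth f (Suc n)"
    using sum_luk_lagrange[OF f, of n 0] by (simp add: Q_series_def)
  also have "\<dots> = fps_nth (run_series 0 oo (fps_X * (P_odd_series oo f))) n"
    by (subst f') simp
  finally show ?thesis using sum_luk_runs[OF f', where N = n and j = 0 and r = 0] by simp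
qed

section \<open>Signed matchings\<close>

text \<open>The value 0 off A agrees with the default of \<open>bar\<close>, so a sign vector is
  determined as a function by its restriction to A.\<close>

definition sign_map :: "nat set \<Rightarrow> (nat \<Rightarrow> int) \<Rightarrow> bool" where
  "sign_map A \<epsilon> \<longleftrightarrow> (\<forall>k. if k \<in> A then \<epsilon> k = -1 \<or> \<epsilon> k = 1 else \<epsilon> k = 0)"

text \<open>Containment of the whole interval covers both the membership of the endpoints and
  condition (2).\<close>

definition arcs_ok :: "int set \<Rightarrow> nat set \<Rightarrow> (nat \<Rightarrow> int) \<Rightarrow> (nat \<times> nat) set \<Rightarrow> bool" where
  "arcs_ok T A \<epsilon> \<tau> \<longleftrightarrow> (\<forall>x y. (x, y) \<in> \<tau> \<longrightarrow> x < y \<and> {x..y} \<subseteq> A \<and> \<epsilon> x \<in> T \<and> \<epsilon> y = - \<epsilon> x)"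

text \<open>For two arcs: equal, side by side, or strictly nested with equal starting signs. This
  one alternative combines disjointness of endpoints, the absence of crossings and condition
  (3).\<close>

definition arcs_compat :: "(nat \<Rightarrow> int) \<Rightarrow> (nat \<times> nat) set \<Rightarrow> bool" where
  "arcs_compat \<epsilon> \<tau> \<longleftrightarrow> (\<forall>x y z w. (x, y) \<in> \<tau> \<longrightarrow> (z, w) \<in> \<tau> \<longrightarrow>
     x = z \<and> y = w \<or> y < z \<or> w < x \<or> x < z \<and> w < y \<and> \<epsilon> x = \<epsilon> z \<or> z < x \<and> y < w \<and> \<epsilon> x = \<epsilon> z)"

text \<open>The pairs of a sign vector and a matching allowed on the value set \<open>A\<close>, where in addition every
  arc must start with a sign in \<open>T\<close>. Inside an arc starting with \<open>s\<close> one has \<open>T = {s}\<close>.\<close>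

definition arc_structs :: "int set \<Rightarrow> nat set \<Rightarrow> ((nat \<Rightarrow> int) \<times> (nat \<times> nat) set) set" where
  "arc_structs T A = {(\<epsilon>, \<tau>). sign_map A \<epsilon> \<and> arcs_ok T A \<epsilon> \<tau> \<and> arcs_compat \<epsilon> \<tau>}"

lemma arcs_okD:
  assumes "arcs_ok T A \<epsilon> \<tau>" "(x, y) \<in> \<tau>"
  shows "x < y" "{x..y} \<subseteq> A" "\<epsilon> x \<in> T" "\<epsilon> y = - \<epsilon> x" "x \<in> A" "y \<in> A"
proof -
  show "x < y" "{x..y} \<subseteq> A" "\<epsilon> x \<in> T" "\<epsilon> y = - \<epsilon> x"
    using assms unfolding arcs_ok_def by blast+
  then show "x \<in> A" "y \<in> A" by auto
qed

lemma finite_arc_structs: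
  assumes "finite A" shows "finite (arc_structs T A)"
proof (rule finite_subset)
  show "arc_structs T A \<subseteq> {\<epsilon>. \<forall>k. (k \<in> A \<longrightarrow> \<epsilon> k \<in> {-1, 1}) \<and> (k \<notin> A \<longrightarrow> \<epsilon> k = 0)} \<times> Pow (A \<times> A)"
    unfolding arc_structs_def by (auto simp: sign_map_def split: if_splits dest: arcs_okD)
  show "finite ({\<epsilon> :: nat \<Rightarrow> int. \<forall>k. (k \<in> A \<longrightarrow> \<epsilon> k \<in> {-1, 1}) \<and> (k \<notin> A \<longrightarrow> \<epsilon> k = 0)} \<times> Pow (A \<times> A))"
    using assms by (intro finite_cartesian_product finite_set_of_finite_funs) auto
qed

lemma arc_structs_empty: "arc_structs T {} = {(\<lambda>_. 0, {})}"
  unfolding arc_structs_def by (auto simp: sign_map_def arcs_compat_def fun_eq_iff arcs_ok_def[of T "{}" _ "{}"] dest: arcs_okD)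

text \<open>As the least value, a cannot be the right end of an arc and cannot lie below one. If it
  starts none either, its sign is free and deleting it loses nothing else.\<close>

lemma card_arc_structs_unmatched:
  assumes a: "\<And>k. k \<in> A \<Longrightarrow> a < k"
  shows "card {(\<epsilon>, \<tau>) \<in> arc_structs T (insert a A). \<forall>y. (a, y) \<notin> \<tau>} = 2 * card (arc_structs T A)"
proof -
  let ?U = "{(\<epsilon>, \<tau>) \<in> arc_structs T (insert a A). \<forall>y. (a, y) \<notin> \<tau>}"
  have aA: "a \<notin> A" using a by blast
  have "bij_betw (\<lambda>(s, \<epsilon>, \<tau>). (\<epsilon>(a := s), \<tau>)) ({-1, 1} \<times> arc_structs T A) ?U"
  proof (rule bij_betw_byWitness[where f' = "\<lambda>(\<epsilon>, \<tau>). (\<epsilon> a, \<epsilon>(a := 0), \<tau>)"])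
    show "\<forall>t\<in>{-1, 1} \<times> arc_structs T A.
        (\<lambda>(\<epsilon>, \<tau>). (\<epsilon> a, \<epsilon>(a := 0), \<tau>)) ((\<lambda>(s, \<epsilon>, \<tau>). (\<epsilon>(a := s), \<tau>)) t) = t"
      using aA by (auto simp: arc_structs_def sign_map_def fun_eq_iff)
    show "(\<lambda>(s, \<epsilon>, \<tau>). (\<epsilon>(a := s), \<tau>)) ` ({-1, 1} \<times> arc_structs T A) \<subseteq> ?U"
    proof (clarify, intro CollectI case_prodI conjI)
      fix s \<epsilon> \<tau> assume s: "s \<in> {-1, 1 :: int}" and st: "(\<epsilon>, \<tau>) \<in> arc_structs T A"
      then have ok: "arcs_ok T A \<epsilon> \<tau>" by (simp add: arc_structs_def)
      have ne: "x \<noteq> a \<and> y \<noteq> a" if "(x, y) \<in> \<tau>" for x y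
        using arcs_okD[OF ok that] aA by metis
      have "sign_map (insert a A) (\<epsilon>(a := s))"
        using st s by (auto simp: arc_structs_def sign_map_def)
      moreover have "arcs_ok T (insert a A) (\<epsilon>(a := s)) \<tau>"
        unfolding arcs_ok_def using arcs_okD[OF ok] ne by (metis fun_upd_other subset_insertI2)
      moreover have "arcs_compat (\<epsilon>(a := s)) \<tau>"
        using st ne unfolding arcs_compat_def arc_structs_def by auto
      ultimately show "(\<epsilon>(a := s), \<tau>) \<in> arc_structs T (insert a A)" by (simp add: arc_structs_def)
      show "\<forall>y. (a, y) \<notin> \<tau>" using ne by blast
    qed
    show "(\<lambda>(\<epsilon>, \<tau>). (\<epsilon> a, \<epsilon>(a := 0), \<tau>)) ` ?U \<subseteq> {-1, 1} \<times> arc_structs T A"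
    proof clarify
      fix \<epsilon> \<tau> assume st: "(\<epsilon>, \<tau>) \<in> arc_structs T (insert a A)" and ne: "\<forall>y. (a, y) \<notin> \<tau>"
      then have ok: "arcs_ok T (insert a A) \<epsilon> \<tau>" and comp: "arcs_compat \<epsilon> \<tau>"
        and sm: "sign_map (insert a A) \<epsilon>"
        by (auto simp: arc_structs_def)
      have gt: "a < x" if "(x, y) \<in> \<tau>" for x y
        using arcs_okD(5)[OF ok that] that ne a by auto
      have "sign_map A (\<epsilon>(a := 0))" using sm aA by (auto simp: sign_map_def split: if_splits)
      moreover have "arcs_ok T A (\<epsilon>(a := 0)) \<tau>"
        unfolding arcs_ok_def
      proof (intro allI impI)
        fix x y assume xy: "(x, y) \<in> \<tau>"
        have "a \<notin> {x..y}" using gt[OF xy] by simp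
        then show "x < y \<and> {x..y} \<subseteq> A \<and> (\<epsilon>(a := 0)) x \<in> T \<and> (\<epsilon>(a := 0)) y = - (\<epsilon>(a := 0)) x"
          using arcs_okD[OF ok xy] gt[OF xy] by auto
      qed
      moreover have "arcs_compat (\<epsilon>(a := 0)) \<tau>"
        using comp gt unfolding arcs_compat_def by (metis fun_upd_other less_irrefl)
      moreover have "\<epsilon> a = -1 \<or> \<epsilon> a = 1" using sm by (auto simp: sign_map_def split: if_splits)
      ultimately show "\<epsilon> a \<in> {-1, 1} \<and> (\<epsilon>(a := 0), \<tau>) \<in> arc_structs T A"
        by (simp add: arc_structs_def)
    qed
  qed auto
  then have "card ?U = card ({-1, 1 :: int} \<times> arc_structs T A)" by (rule bij_betw_same_card[symmetric])
  then show ?thesis by (simp add: card_cartesian_product)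
qed

text \<open>The arc (a, b) separates the structure into independent halves. Arcs strictly inside
  must start with the sign s of a, so T shrinks to \<open>{s}\<close> there; arcs to the right of b
  keep the restriction T.\<close>

lemma card_arc_structs_matched:
  assumes a: "\<And>k. k \<in> A \<Longrightarrow> a < k" and T: "T \<subseteq> {-1, 1}" "finite T"
    and b: "a < b" "{a..b} \<subseteq> insert a A" and fin: "finite A"
  shows "card {(\<epsilon>, \<tau>) \<in> arc_structs T (insert a A). (a, b) \<in> \<tau>}
    = (\<Sum>s\<in>T. card (arc_structs {s} {a<..<b})) * card (arc_structs T {k \<in> A. b < k})"
proof -
  let ?M = "{(\<epsilon>, \<tau>) \<in> arc_structs T (insert a A). (a, b) \<in> \<tau>}"
  let ?I = "{a<..<b}" and ?R = "{k \<in> A. b < k}"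
  let ?D = "(SIGMA s:T. arc_structs {s} ?I) \<times> arc_structs T ?R"
  let ?f = "\<lambda>((s, \<epsilon>1, \<tau>1), (\<epsilon>2, \<tau>2)).
      ((\<lambda>k. if k = a then s else if k = b then - s else if k < b then \<epsilon>1 k else \<epsilon>2 k),
       insert (a, b) (\<tau>1 \<union> \<tau>2))"
  let ?g = "\<lambda>(\<epsilon>, \<tau>). ((\<epsilon> a, (\<lambda>k. if k \<in> ?I then \<epsilon> k else 0), {(x, y) \<in> \<tau>. a < x \<and> y < b}),
      ((\<lambda>k. if b < k then \<epsilon> k else 0), {(x, y) \<in> \<tau>. b < x}))"
  have inA: "t \<in> A" if "a < t" "t \<le> b" for t using subsetD[OF b(2), of t] that by simp
  then have IA: "?I \<subseteq> A" and bA: "b \<in> A" using b(1) by auto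
  have "bij_betw ?f ?D ?M"
  proof (rule bij_betw_byWitness[where f' = ?g])
    show "\<forall>t\<in>?D. ?g (?f t) = t"
    proof
      fix t assume "t \<in> ?D"
      then obtain s \<epsilon>1 \<tau>1 \<epsilon>2 \<tau>2 where t: "t = ((s, \<epsilon>1, \<tau>1), (\<epsilon>2, \<tau>2))"
        and s: "s \<in> T" and st1: "(\<epsilon>1, \<tau>1) \<in> arc_structs {s} ?I" and st2: "(\<epsilon>2, \<tau>2) \<in> arc_structs T ?R"
        by auto
      have ok1: "arcs_ok {s} ?I \<epsilon>1 \<tau>1" and ok2: "arcs_ok T ?R \<epsilon>2 \<tau>2"
        using st1 st2 by (auto simp: arc_structs_def)
      have sm: "\<epsilon>1 k = 0" if "k \<notin> ?I" for k
        using st1 that by (auto simp: arc_structs_def sign_map_def split: if_splits)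
      have sm2: "\<epsilon>2 k = 0" if "k \<notin> ?R" for k
        using st2 that by (auto simp: arc_structs_def sign_map_def split: if_splits)
      have o1: "\<forall>(x, y)\<in>\<tau>1. a < x \<and> x < b \<and> y < b" using arcs_okD(5,6)[OF ok1] by auto
      have o2: "\<forall>(x, y)\<in>\<tau>2. b < x \<and> b < y" using arcs_okD(5,6)[OF ok2] by auto
      have "{(x, y) \<in> insert (a, b) (\<tau>1 \<union> \<tau>2). a < x \<and> y < b} = \<tau>1"
        using o1 o2 by fastforce
      moreover have "{(x, y) \<in> insert (a, b) (\<tau>1 \<union> \<tau>2). b < x} = \<tau>2"
        using o1 o2 b by fastforce
      moreover have "(\<lambda>k. if k \<in> ?I then if k = a then s else if k = b then - s else if k < b then \<epsilon>1 k else \<epsilon>2 k else 0) = \<epsilon>1"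
        using sm by (auto simp: fun_eq_iff)
      moreover have "(\<lambda>k. if b < k then if k = a then s else if k = b then - s else if k < b then \<epsilon>1 k else \<epsilon>2 k else 0) = \<epsilon>2"
        using sm2 b by (auto simp: fun_eq_iff)
      ultimately show "?g (?f t) = t" unfolding t using b by simp
    qed
    show "\<forall>t\<in>?M. ?f (?g t) = t"
    proof
      fix t assume "t \<in> ?M"
      then obtain \<epsilon> \<tau> where t: "t = (\<epsilon>, \<tau>)" and st: "(\<epsilon>, \<tau>) \<in> arc_structs T (insert a A)"
        and ab: "(a, b) \<in> \<tau>" by auto
      then have ok: "arcs_ok T (insert a A) \<epsilon> \<tau>" and comp: "arcs_compat \<epsilon> \<tau>"
        and sm: "sign_map (insert a A) \<epsilon>" by (auto simp: arc_structs_def)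
      \<comment> \<open>No arc starts before the least value a, so compatibility with (a, b) leaves
        only these three positions.\<close>
      have arcs: "(x, y) = (a, b) \<or> a < x \<and> y < b \<or> b < x" if "(x, y) \<in> \<tau>" for x y
      proof -
        have "x < y" "a \<le> x" using arcs_okD[OF ok that] a by force+
        then show ?thesis using comp[unfolded arcs_compat_def, rule_format, OF ab that] by auto
      qed
      have "\<epsilon> b = - \<epsilon> a" using arcs_okD(4)[OF ok ab] .
      moreover have "\<epsilon> k = 0" if "k < a" for k
        using sm[unfolded sign_map_def, rule_format, of k] that a[of k] by (auto split: if_splits)
      ultimately have "(\<lambda>k. if k = a then \<epsilon> a else if k = b then - \<epsilon> a
          else if k < b then (if k \<in> ?I then \<epsilon> k else 0) else (if b < k then \<epsilon> k else 0)) = \<epsilon>"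
        using b by (auto simp: fun_eq_iff)
      moreover have "insert (a, b) ({(x, y) \<in> \<tau>. a < x \<and> y < b} \<union> {(x, y) \<in> \<tau>. b < x}) = \<tau>"
        using arcs ab by auto
      ultimately show "?f (?g t) = t" unfolding t by (simp only: prod.case)
    qed
    show "?f ` ?D \<subseteq> ?M"
    proof (rule image_subsetI)
      fix t assume "t \<in> ?D"
      then obtain s \<epsilon>1 \<tau>1 \<epsilon>2 \<tau>2 where t: "t = ((s, \<epsilon>1, \<tau>1), (\<epsilon>2, \<tau>2))"
        and s: "s \<in> T" and st1: "(\<epsilon>1, \<tau>1) \<in> arc_structs {s} ?I" and st2: "(\<epsilon>2, \<tau>2) \<in> arc_structs T ?R"
        by auto
      define e where "e = (\<lambda>k. if k = a then s else if k = b then - s else if k < b then \<epsilon>1 k else \<epsilon>2 k)"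
      let ?t = "insert (a, b) (\<tau>1 \<union> \<tau>2)"
      have ok1: "arcs_ok {s} ?I \<epsilon>1 \<tau>1" and ok2: "arcs_ok T ?R \<epsilon>2 \<tau>2"
        and sm1: "sign_map ?I \<epsilon>1" and sm2: "sign_map ?R \<epsilon>2"
        and c1: "arcs_compat \<epsilon>1 \<tau>1" and c2: "arcs_compat \<epsilon>2 \<tau>2"
        using st1 st2 by (auto simp: arc_structs_def)
      have s1: "s = -1 \<or> s = 1" using s T by auto
      have in1: "a < x \<and> x < y \<and> y < b \<and> e x = s \<and> e y = - s \<and> e x = \<epsilon>1 x" if "(x, y) \<in> \<tau>1" for x y
        using arcs_okD[OF ok1 that] by (auto simp: e_def)
      have in2: "b < x \<and> x < y \<and> e x = \<epsilon>2 x \<and> e y = \<epsilon>2 y" if "(x, y) \<in> \<tau>2" for x y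
        using arcs_okD[OF ok2 that] b by (auto simp: e_def)
      have eab: "e a = s" "e b = - s" using b by (auto simp: e_def)
      have "sign_map (insert a A) e"
        unfolding sign_map_def
      proof
        fix k
        show "if k \<in> insert a A then e k = - 1 \<or> e k = 1 else e k = 0"
          using sm1[unfolded sign_map_def, rule_format, of k] sm2[unfolded sign_map_def, rule_format, of k]
            s1 IA bA b a by (cases "k = a"; cases "k = b"; cases "k < b") (auto simp: e_def split: if_splits)
      qed
      moreover have "arcs_ok T (insert a A) e ?t"
        unfolding arcs_ok_def
      proof (intro allI impI)
        fix x y assume "(x, y) \<in> ?t"
        then consider "(x, y) = (a, b)" | "(x, y) \<in> \<tau>1" | "(x, y) \<in> \<tau>2" by blast
        then show "x < y \<and> {x..y} \<subseteq> insert a A \<and> e x \<in> T \<and> e y = - e x"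
        proof cases
          case 1
          then show ?thesis using b s eab by auto
        next
          case 2
          have "{x..y} \<subseteq> insert a A" using arcs_okD(2)[OF ok1 2] IA by blast
          with in1[OF 2] s show ?thesis by auto
        next
          case 3
          have "{x..y} \<subseteq> insert a A" using arcs_okD(2)[OF ok2 3] by blast
          with in2[OF 3] arcs_okD[OF ok2 3] show ?thesis by auto
        qed
      qed
      moreover have "arcs_compat e ?t"
        unfolding arcs_compat_def
      proof (intro allI impI)
        fix x y z w assume "(x, y) \<in> ?t" "(z, w) \<in> ?t"
        then consider "(x, y) = (a, b)" "(z, w) = (a, b)" | "(x, y) = (a, b)" "(z, w) \<in> \<tau>1"
          | "(x, y) = (a, b)" "(z, w) \<in> \<tau>2" | "(x, y) \<in> \<tau>1" "(z, w) = (a, b)"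
          | "(x, y) \<in> \<tau>1" "(z, w) \<in> \<tau>1" | "(x, y) \<in> \<tau>1" "(z, w) \<in> \<tau>2"
          | "(x, y) \<in> \<tau>2" "(z, w) = (a, b)" | "(x, y) \<in> \<tau>2" "(z, w) \<in> \<tau>1"
          | "(x, y) \<in> \<tau>2" "(z, w) \<in> \<tau>2" by blast
        then show "x = z \<and> y = w \<or> y < z \<or> w < x \<or> x < z \<and> w < y \<and> e x = e z
            \<or> z < x \<and> y < w \<and> e x = e z"
        proof cases
          case 1 then show ?thesis by simp
        next
          case 2 then show ?thesis using in1[OF 2(2)] eab by auto
        next
          case 3 then show ?thesis using in2[OF 3(2)] by auto
        next
          case 4 then show ?thesis using in1[OF 4(1)] eab by auto
        next
          case 5
          then show ?thesis using in1[OF 5(1)] in1[OF 5(2)] c1[unfolded arcs_compat_def, rule_format, OF 5] by auto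
        next
          case 6 then show ?thesis using in1[OF 6(1)] in2[OF 6(2)] by auto
        next
          case 7 then show ?thesis using in2[OF 7(1)] by auto
        next
          case 8 then show ?thesis using in2[OF 8(1)] in1[OF 8(2)] by auto
        next
          case 9
          then show ?thesis using in2[OF 9(1)] in2[OF 9(2)] c2[unfolded arcs_compat_def, rule_format, OF 9] by auto
        qed
      qed
      ultimately have "(e, ?t) \<in> arc_structs T (insert a A)" by (simp add: arc_structs_def)
      then show "?f t \<in> ?M" unfolding t e_def by simp
    qed
    show "?g ` ?M \<subseteq> ?D"
    proof (rule image_subsetI)
      fix t assume "t \<in> ?M"
      then obtain \<epsilon> \<tau> where t: "t = (\<epsilon>, \<tau>)" and st: "(\<epsilon>, \<tau>) \<in> arc_structs T (insert a A)"
        and ab: "(a, b) \<in> \<tau>" by auto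
      then have ok: "arcs_ok T (insert a A) \<epsilon> \<tau>" and comp: "arcs_compat \<epsilon> \<tau>"
        and sm: "sign_map (insert a A) \<epsilon>" by (auto simp: arc_structs_def)
      note okD = arcs_okD[OF ok]
      let ?e1 = "\<lambda>k. if k \<in> ?I then \<epsilon> k else 0" and ?t1 = "{(x, y) \<in> \<tau>. a < x \<and> y < b}"
      let ?e2 = "\<lambda>k. if b < k then \<epsilon> k else 0" and ?t2 = "{(x, y) \<in> \<tau>. b < x}"
      have smk: "if k \<in> insert a A then \<epsilon> k = - 1 \<or> \<epsilon> k = 1 else \<epsilon> k = 0" for k
        using sm by (simp add: sign_map_def)
      have "sign_map ?I ?e1" unfolding sign_map_def
      proof
        fix k show "if k \<in> ?I then ?e1 k = - 1 \<or> ?e1 k = 1 else ?e1 k = 0"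
          using smk[of k] inA[of k] by auto
      qed
      moreover have "arcs_ok {\<epsilon> a} ?I ?e1 ?t1"
        unfolding arcs_ok_def
      proof (intro allI impI)
        fix x y assume "(x, y) \<in> ?t1"
        then have xy: "(x, y) \<in> \<tau>" "a < x" "y < b" by auto
        \<comment> \<open>Nesting below (a, b) transfers the starting sign; this is the source of
          the singleton restriction.\<close>
        have "\<epsilon> x = \<epsilon> a"
          using comp[unfolded arcs_compat_def, rule_format, OF ab xy(1)] xy okD(1)[OF xy(1)] b by auto
        then show "x < y \<and> {x..y} \<subseteq> ?I \<and> ?e1 x \<in> {\<epsilon> a} \<and> ?e1 y = - ?e1 x"
          using okD[OF xy(1)] xy by auto
      qed
      moreover have "arcs_compat ?e1 ?t1"
        unfolding arcs_compat_def
      proof (intro allI impI)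
        fix x y z w assume t: "(x, y) \<in> ?t1" "(z, w) \<in> ?t1"
        then have "x < y" "z < w" using okD(1) by auto
        with t comp[unfolded arcs_compat_def, rule_format, of x y z w]
        show "x = z \<and> y = w \<or> y < z \<or> w < x \<or> x < z \<and> w < y \<and> ?e1 x = ?e1 z
            \<or> z < x \<and> y < w \<and> ?e1 x = ?e1 z" by auto
      qed
      ultimately have st1: "(?e1, ?t1) \<in> arc_structs {\<epsilon> a} ?I" by (simp add: arc_structs_def)
      have "sign_map ?R ?e2" unfolding sign_map_def
      proof
        fix k show "if k \<in> ?R then ?e2 k = - 1 \<or> ?e2 k = 1 else ?e2 k = 0"
          using smk[of k] b by auto
      qed
      moreover have "arcs_ok T ?R ?e2 ?t2"
        unfolding arcs_ok_def
      proof (intro allI impI)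
        fix x y assume "(x, y) \<in> ?t2"
        then have xy: "(x, y) \<in> \<tau>" "b < x" by auto
        have "a \<notin> {x..y}" using xy b by auto
        then show "x < y \<and> {x..y} \<subseteq> ?R \<and> ?e2 x \<in> T \<and> ?e2 y = - ?e2 x"
          using okD[OF xy(1)] xy by auto
      qed
      moreover have "arcs_compat ?e2 ?t2"
        unfolding arcs_compat_def
      proof (intro allI impI)
        fix x y z w assume t: "(x, y) \<in> ?t2" "(z, w) \<in> ?t2"
        with comp[unfolded arcs_compat_def, rule_format, of x y z w]
        show "x = z \<and> y = w \<or> y < z \<or> w < x \<or> x < z \<and> w < y \<and> ?e2 x = ?e2 z
            \<or> z < x \<and> y < w \<and> ?e2 x = ?e2 z" by auto
      qed
      ultimately have st2: "(?e2, ?t2) \<in> arc_structs T ?R" by (simp add: arc_structs_def)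
      show "?g t \<in> ?D" unfolding t using st1 st2 okD(3)[OF ab] by simp
    qed
  qed
  then have "card ?M = card ?D" by (rule bij_betw_same_card[symmetric])
  also have "\<dots> = (\<Sum>s\<in>T. card (arc_structs {s} ?I)) * card (arc_structs T ?R)"
    using T fin by (simp add: card_cartesian_product finite_arc_structs)
  finally show ?thesis .
qed

lemma card_arc_structs_insert:
  assumes a: "\<And>k. k \<in> A \<Longrightarrow> a < k" and T: "T \<subseteq> {-1, 1}" "finite T" and fin: "finite A"
  shows "card (arc_structs T (insert a A)) = 2 * card (arc_structs T A)
    + (\<Sum>b\<in>{b \<in> A. {a..b} \<subseteq> insert a A}.
        (\<Sum>s\<in>T. card (arc_structs {s} {a<..<b})) * card (arc_structs T {k \<in> A. b < k}))"
proof -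
  let ?S = "arc_structs T (insert a A)"
  let ?U = "{(\<epsilon>, \<tau>) \<in> ?S. \<forall>y. (a, y) \<notin> \<tau>}"
  let ?M = "\<lambda>b. {(\<epsilon>, \<tau>) \<in> ?S. (a, b) \<in> \<tau>}"
  let ?B = "{b \<in> A. {a..b} \<subseteq> insert a A}"
  have finS: "finite ?S" using fin by (simp add: finite_arc_structs)
  have "?S = ?U \<union> (\<Union>b\<in>?B. ?M b)"
  proof -
    have "b \<in> ?B" if "(\<epsilon>, \<tau>) \<in> ?S" "(a, b) \<in> \<tau>" for \<epsilon> \<tau> b
    proof -
      have "arcs_ok T (insert a A) \<epsilon> \<tau>" using that by (simp add: arc_structs_def)
      from arcs_okD[OF this that(2)] show ?thesis by auto
    qed
    then show ?thesis by fast
  qed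
  then have "card ?S = card (?U \<union> (\<Union>b\<in>?B. ?M b))" by simp
  also have "\<dots> = card ?U + card (\<Union>b\<in>?B. ?M b)"
    by (rule card_Un_disjoint) (auto intro: finite_subset[OF _ finS] simp: fin)
  also have "card (\<Union>b\<in>?B. ?M b) = (\<Sum>b\<in>?B. card (?M b))"
  proof (rule card_UN_disjoint)
    show "\<forall>b\<in>?B. \<forall>b'\<in>?B. b \<noteq> b' \<longrightarrow> ?M b \<inter> ?M b' = {}"
    proof (intro ballI impI equals0I)
      fix b b' t assume b: "b \<in> ?B" "b' \<in> ?B" "b \<noteq> b'" and t: "t \<in> ?M b \<inter> ?M b'"
      obtain \<epsilon> \<tau> where comp: "arcs_compat \<epsilon> \<tau>" and \<tau>: "(a, b) \<in> \<tau>" "(a, b') \<in> \<tau>"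
        using t by (auto simp: arc_structs_def)
      show False
        using comp[unfolded arcs_compat_def, rule_format, OF \<tau>] b a[of b] a[of b'] by auto
    qed
  qed (auto intro: finite_subset[OF _ finS] simp: fin)
  also have "\<dots> = (\<Sum>b\<in>?B. (\<Sum>s\<in>T. card (arc_structs {s} {a<..<b})) * card (arc_structs T {k \<in> A. b < k}))"
    by (rule sum.cong) (use a T fin in \<open>auto intro!: card_arc_structs_matched\<close>)
  also have "card ?U = 2 * card (arc_structs T A)" by (rule card_arc_structs_unmatched[OF a])
  finally show ?thesis .
qed

text \<open>The position right after the run is missing, so the partner of the first value stays
  inside the run. The index i is the number of values enclosed by the arc.\<close>

lemma card_arc_structs_run:
  assumes B: "\<And>k. k \<in> B \<Longrightarrow> x + Suc n < k" "finite B" and T: "T \<subseteq> {-1, 1}"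
  shows "card (arc_structs T ({x..<x + Suc n} \<union> B)) = 2 * card (arc_structs T ({Suc x..<Suc x + n} \<union> B))
    + (\<Sum>i<n. (\<Sum>s\<in>T. card (arc_structs {s} {Suc x..<Suc x + i}))
        * card (arc_structs T ({x + 2 + i..<x + 2 + i + (n - 1 - i)} \<union> B)))"
proof -
  let ?A = "{Suc x..<Suc x + n} \<union> B"
  have fT: "finite T" using T by (rule finite_subset) simp
  have A: "{x..<x + Suc n} \<union> B = insert x ?A" by auto
  have "{b \<in> ?A. {x..b} \<subseteq> insert x ?A} = (\<lambda>i. Suc x + i) ` {..<n}"
  proof (intro equalityI subsetI)
    fix b assume b: "b \<in> {b \<in> ?A. {x..b} \<subseteq> insert x ?A}"
    \<comment> \<open>An arc from x into B would have to cover this gap.\<close>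
    have "x + Suc n \<notin> insert x ?A" using B by auto
    have "\<not> x + Suc n \<le> b"
    proof
      assume "x + Suc n \<le> b"
      then have "x + Suc n \<in> {x..b}" by simp
      with b \<open>x + Suc n \<notin> insert x ?A\<close> show False by blast
    qed
    moreover have "Suc x \<le> b" using b B(1) by force
    ultimately show "b \<in> (\<lambda>i. Suc x + i) ` {..<n}" by (intro image_eqI[of _ _ "b - Suc x"]) auto
  qed auto
  then have "(\<Sum>b\<in>{b \<in> ?A. {x..b} \<subseteq> insert x ?A}.
        (\<Sum>s\<in>T. card (arc_structs {s} {x<..<b})) * card (arc_structs T {k \<in> ?A. b < k}))
      = (\<Sum>i<n. (\<Sum>s\<in>T. card (arc_structs {s} {x<..<Suc x + i})) * card (arc_structs T {k \<in> ?A. Suc x + i < k}))"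
    by (simp only:) (subst sum.reindex, auto simp: inj_on_def)
  also have "\<dots> = (\<Sum>i<n. (\<Sum>s\<in>T. card (arc_structs {s} {Suc x..<Suc x + i}))
        * card (arc_structs T ({x + 2 + i..<x + 2 + i + (n - 1 - i)} \<union> B)))"
  proof (rule sum.cong)
    fix i assume "i \<in> {..<n}"
    then have "{k \<in> ?A. Suc x + i < k} = {x + 2 + i..<x + 2 + i + (n - 1 - i)} \<union> B"
      using B(1) by force
    moreover have "{x<..<Suc x + i} = {Suc x..<Suc x + i}" by auto
    ultimately show "(\<Sum>s\<in>T. card (arc_structs {s} {x<..<Suc x + i})) * card (arc_structs T {k \<in> ?A. Suc x + i < k})
      = (\<Sum>s\<in>T. card (arc_structs {s} {Suc x..<Suc x + i}))
        * card (arc_structs T ({x + 2 + i..<x + 2 + i + (n - 1 - i)} \<union> B))" by simp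
  qed simp
  moreover have "card (arc_structs T (insert x ?A)) = 2 * card (arc_structs T ?A)
      + (\<Sum>b\<in>{b \<in> ?A. {x..b} \<subseteq> insert x ?A}.
        (\<Sum>s\<in>T. card (arc_structs {s} {x<..<b})) * card (arc_structs T {k \<in> ?A. b < k}))"
  proof (rule card_arc_structs_insert)
    show "x < k" if "k \<in> ?A" for k using B(1)[of k] that by auto
  qed (use B T fT in auto)
  ultimately show ?thesis unfolding A by (simp only:)
qed

lemma card_arc_structs_nested:
  assumes "s \<in> {-1, 1}" shows "card (arc_structs {s} {x..<x + n}) = nested_count n"
proof (induction n arbitrary: x rule: less_induct)
  case (less n)
  show ?case
  proof (cases n)
    case 0
    then show ?thesis by (simp add: arc_structs_empty)
  next
    case (Suc m)
    have "card (arc_structs {s} ({x..<x + Suc m} \<union> {})) = nested_count (Suc m)"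
    proof (subst card_arc_structs_run)
      have "(\<Sum>i<m. (\<Sum>s\<in>{s}. card (arc_structs {s} {Suc x..<Suc x + i}))
          * card (arc_structs {s} ({x + 2 + i..<x + 2 + i + (m - 1 - i)} \<union> {})))
        = (\<Sum>i<m. nested_count i * nested_count (m - 1 - i))"
      proof (rule sum.cong)
        fix i assume "i \<in> {..<m}"
        then show "(\<Sum>s\<in>{s}. card (arc_structs {s} {Suc x..<Suc x + i}))
            * card (arc_structs {s} ({x + 2 + i..<x + 2 + i + (m - 1 - i)} \<union> {}))
          = nested_count i * nested_count (m - 1 - i)"
          using less.IH[of i "Suc x"] less.IH[of "m - 1 - i" "x + 2 + i"] Suc by simp
      qed simp
      then show "2 * card (arc_structs {s} ({Suc x..<Suc x + m} \<union> {})) +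
          (\<Sum>i<m. (\<Sum>s\<in>{s}. card (arc_structs {s} {Suc x..<Suc x + i}))
            * card (arc_structs {s} ({x + 2 + i..<x + 2 + i + (m - 1 - i)} \<union> {})))
        = nested_count (Suc m)"
        using less.IH[of m "Suc x"] Suc by simp
    qed (use assms in auto)
    then show ?thesis using Suc by simp
  qed
qed

text \<open>The set B is carried unchanged through the recursion for the run, so its count factors
  out. Summing over both starting signs of the first arc turns \<open>nested_count\<close> into
  twice \<open>nested_count\<close>, as in the recursion of \<open>run_count\<close>.\<close>

lemma card_arc_structs_split_run:
  assumes "\<And>k. k \<in> B \<Longrightarrow> x + n < k" "finite B"
  shows "card (arc_structs {-1, 1} ({x..<x + n} \<union> B)) = run_count n * card (arc_structs {-1, 1} B)"
  using assms(1)
proof (induction n arbitrary: x rule: less_induct)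
  case (less n)
  show ?case
  proof (cases n)
    case (Suc m)
    have "card (arc_structs {-1, 1} ({x + 2 + i..<x + 2 + i + (m - 1 - i)} \<union> B))
        = run_count (m - 1 - i) * card (arc_structs {-1, 1} B)" if "i < m" for i
      by (rule less.IH) (use Suc that less.prems in force)+
    moreover have "card (arc_structs {-1, 1} ({Suc x..<Suc x + m} \<union> B)) = run_count m * card (arc_structs {-1, 1} B)"
      by (rule less.IH) (use Suc less.prems in force)+
    moreover have "(\<Sum>s\<in>{-1, 1}. card (arc_structs {s} {Suc x..<Suc x + i})) = 2 * nested_count i" for i
      using card_arc_structs_nested[of "-1" "Suc x" i] card_arc_structs_nested[of 1 "Suc x" i] by simp
    ultimately have "card (arc_structs {-1, 1} ({x..<x + Suc m} \<union> B))
        = 2 * (run_count m * card (arc_structs {-1, 1} B))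
          + (\<Sum>i<m. 2 * nested_count i * (run_count (m - 1 - i) * card (arc_structs {-1, 1} B)))"
      using less.prems assms(2) Suc by (subst card_arc_structs_run) (auto intro!: sum.cong)
    then show ?thesis using Suc
      by (simp add: algebra_simps sum_distrib_left sum_distrib_right)
  qed simp
qed

text \<open>The interval is the run read so far, and letter i of w governs the value x + r + i. A
  nonzero letter extends the interval; a zero letter leaves a gap, across which the count
  factors.\<close>

lemma card_arc_structs_word:
  "card (arc_structs {-1, 1} ({x..<x + r} \<union> {x + r + i | i. i < length w \<and> w ! i \<noteq> 0})) = run_weight r w"
proof (induction w arbitrary: x r)
  case Nil
  show ?case using card_arc_structs_split_run[of "{}" x r] by (simp add: arc_structs_empty)
next
  case (Cons a w)
  let ?B = "{x + r + 1 + i | i. i < length w \<and> w ! i \<noteq> 0}"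
  have fin: "finite ?B" by simp
  have split: "{x + r + i | i. i < length (a # w) \<and> (a # w) ! i \<noteq> 0}
      = (if a = 0 then {} else {x + r}) \<union> ?B"
  proof (intro equalityI subsetI)
    fix k assume "k \<in> {x + r + i | i. i < length (a # w) \<and> (a # w) ! i \<noteq> 0}"
    then obtain i where "k = x + r + i" "i < length (a # w)" "(a # w) ! i \<noteq> 0" by blast
    then show "k \<in> (if a = 0 then {} else {x + r}) \<union> ?B" by (cases i) auto
  next
    fix k assume "k \<in> (if a = 0 then {} else {x + r}) \<union> ?B"
    then consider "a \<noteq> 0" "k = x + r" | i where "k = x + r + 1 + i" "i < length w" "w ! i \<noteq> 0"
      by (auto split: if_splits)
    then show "k \<in> {x + r + i | i. i < length (a # w) \<and> (a # w) ! i \<noteq> 0}"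
    proof cases
      case 1 then show ?thesis by (intro CollectI exI[of _ 0]) auto
    next
      case 2 then show ?thesis by (intro CollectI exI[of _ "Suc i"]) auto
    qed
  qed
  show ?case
  proof (cases "a = 0")
    case True
    have "card (arc_structs {-1, 1} ({x..<x + r} \<union> ?B)) = run_count r * card (arc_structs {-1, 1} ?B)"
      by (rule card_arc_structs_split_run) (auto simp: fin)
    moreover have "card (arc_structs {-1, 1} ?B) = run_weight 0 w"
      using Cons.IH[of "x + r + 1" 0] by simp
    ultimately show ?thesis unfolding split using True by simp
  next
    case False
    then have "{x..<x + r} \<union> ((if a = 0 then {} else {x + r}) \<union> ?B)
        = {x..<x + Suc r} \<union> {x + Suc r + i | i. i < length w \<and> w ! i \<noteq> 0}" by auto
    then show ?thesis unfolding split using False Cons.IH[of x "Suc r"] by simp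
  qed
qed

section \<open>Expansion over sorted odd shifted parking functions\<close>

lemma count_list_mset: "count_list p k = count (mset p) k"
  by (induction p) auto

lemma luk_iff:
  "luk j w \<longleftrightarrow> (\<forall>k\<le>length w. k \<le> j + sum_list (take k w)) \<and> j + sum_list w = length w"
proof (induction w arbitrary: j)
  case (Cons a w)
  have "(\<forall>k\<le>length (a # w). k \<le> j + sum_list (take k (a # w)))
      \<longleftrightarrow> (\<forall>k\<le>length w. Suc k \<le> j + a + sum_list (take k w))"
  proof (intro iffI allI impI)
    fix k assume *: "\<forall>k\<le>length (a # w). k \<le> j + sum_list (take k (a # w))" "k \<le> length w"
    show "Suc k \<le> j + a + sum_list (take k w)"
      using *(1)[rule_format, of "Suc k"] *(2) by simp
  next
    fix k assume *: "\<forall>k\<le>length w. Suc k \<le> j + a + sum_list (take k w)" "k \<le> length (a # w)"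
    show "k \<le> j + sum_list (take k (a # w))"
      using *(1)[rule_format, of "k - 1"] *(2) by (cases k) auto
  qed
  also have "\<dots> \<longleftrightarrow> j + a \<ge> 1 \<and> (\<forall>k\<le>length w. k \<le> j + a - 1 + sum_list (take k w))"
    by (auto simp: le_diff_conv2 Suc_le_eq)
  finally show ?case using Cons.IH[of "j + a - 1"] by auto
qed simp

lemma length_content [simp]: "length (content p) = length p"
  by (simp add: content_def del: upt_Suc)

lemma sum_list_take_content:
  assumes "\<forall>x\<in>set p. x \<ge> 1" "k \<le> length p"
  shows "sum_list (take k (content p)) = length (filter (\<lambda>x. x \<le> k) p)"
proof -
  have "take k (content p) = map (\<lambda>k. count_list p k) [1..<k + 1]"
    using assms(2) by (simp add: content_def take_map take_upt del: upt_Suc)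
  also have "sum_list \<dots> = (\<Sum>i\<in>{1..<k + 1}. count (mset p) i)"
    by (simp add: count_list_mset sum_list_distinct_conv_sum_set del: upt_Suc)
  also have "\<dots> = size (filter_mset (\<lambda>x. x \<le> k) (mset p))"
  proof -
    have "size (filter_mset (\<lambda>x. x \<le> k) (mset p)) = (\<Sum>i\<in>set_mset (filter_mset (\<lambda>x. x \<le> k) (mset p)). count (filter_mset (\<lambda>x. x \<le> k) (mset p)) i)"
      by (rule size_multiset_overloaded_eq)
    also have "\<dots> = (\<Sum>i\<in>{1..<k + 1}. count (mset p) i)"
      by (rule sum.mono_neutral_cong_left) (use assms in \<open>auto simp: count_eq_zero_iff Suc_le_eq\<close>)
    finally show ?thesis by simp
  qed
  finally show ?thesis by (metis mset_filter size_mset)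
qed

text \<open>Rewrites the order statistic in the definition of parking functions as a count of small
  entries, which is a prefix sum of the content.\<close>

lemma sorted_nth_le_iff:
  fixes s :: "nat list"
  assumes "sorted s" "1 \<le> i" "i \<le> length s"
  shows "s ! (i - 1) \<le> i \<longleftrightarrow> i \<le> length (filter (\<lambda>x. x \<le> i) s)"
proof -
  have eq: "length (filter (\<lambda>x. x \<le> i) s) = card {j. j < length s \<and> s ! j \<le> i}"
    by (rule length_filter_conv_card)
  show ?thesis
  proof
    assume "s ! (i - 1) \<le> i"
    then have "{..<i} \<subseteq> {j. j < length s \<and> s ! j \<le> i}"
      using assms by (auto intro: order_trans[OF sorted_nth_mono[of s _ "i - 1"]])
    then have "card {..<i} \<le> card {j. j < length s \<and> s ! j \<le> i}" by (intro card_mono) auto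
    then show "i \<le> length (filter (\<lambda>x. x \<le> i) s)" by (simp add: eq)
  next
    assume le: "i \<le> length (filter (\<lambda>x. x \<le> i) s)"
    show "s ! (i - 1) \<le> i"
    proof (rule ccontr)
      assume gt: "\<not> s ! (i - 1) \<le> i"
      have "{j. j < length s \<and> s ! j \<le> i} \<subseteq> {..<i - 1}"
      proof
        fix j assume "j \<in> {j. j < length s \<and> s ! j \<le> i}"
        then show "j \<in> {..<i - 1}" using gt sorted_nth_mono[OF assms(1), of "i - 1" j]
          by (cases "i - 1 \<le> j") auto
      qed
      then have "card {j. j < length s \<and> s ! j \<le> i} \<le> card {..<i - 1}" by (intro card_mono) auto
      with le eq assms(2) show False by simp
    qed
  qed
qed

text \<open>After k letters of the content, the path is at height (number of entries at most k)
  minus k, so the parking inequality for k says that the path stays nonnegative. The inequality for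
  k = n bounds all entries by n and brings the path back to 0.\<close>

lemma Pf_iff_luk:
  "p \<in> Pf n \<longleftrightarrow> length p = n \<and> set p \<subseteq> {1..n} \<and> luk 0 (content p)"
proof -
  have fil: "length (filter P (sort p)) = length (filter P p)" for P
    by (metis mset_filter mset_sort size_mset)
  have Pf: "p \<in> Pf n \<longleftrightarrow> length p = n \<and> (\<forall>x\<in>set p. x \<ge> 1) \<and> (\<forall>i\<in>{1..n}. i \<le> length (filter (\<lambda>x. x \<le> i) p))"
    unfolding Pf_def using sorted_nth_le_iff[of "sort p"] by (auto simp: fil)
  have full: "length (filter (\<lambda>x. x \<le> length p) p) = length p \<longleftrightarrow> (\<forall>x\<in>set p. x \<le> length p)"
    by (metis (mono_tags, lifting) filter_True length_filter_less order_less_irrefl)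
  have sum: "sum_list (content p) = length (filter (\<lambda>x. x \<le> length p) p)" if "\<forall>x\<in>set p. x \<ge> 1"
    using sum_list_take_content[OF that, of "length p"] by simp
  show ?thesis
  proof
    assume p: "p \<in> Pf n"
    then have 1: "length p = n" "\<forall>x\<in>set p. x \<ge> 1" and 2: "\<And>i. i \<in> {1..n} \<Longrightarrow> i \<le> length (filter (\<lambda>x. x \<le> i) p)"
      by (auto simp: Pf)
    have "length (filter (\<lambda>x. x \<le> length p) p) = length p"
    proof (cases "n = 0")
      case False
      then show ?thesis using 2[of n] 1 length_filter_le[of "\<lambda>x. x \<le> n" p] by simp
    qed (use 1 in simp)
    moreover have "k \<le> sum_list (take k (content p))" if "k \<le> length p" for k
      using 2[of k] sum_list_take_content[OF 1(2) that] 1(1) that by (cases "k = 0") auto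
    ultimately show "length p = n \<and> set p \<subseteq> {1..n} \<and> luk 0 (content p)"
      using 1 full sum by (auto simp: luk_iff)
  next
    assume p: "length p = n \<and> set p \<subseteq> {1..n} \<and> luk 0 (content p)"
    then have 1: "\<forall>x\<in>set p. x \<ge> 1" by auto
    then show "p \<in> Pf n" using p sum_list_take_content[OF 1] unfolding Pf by (auto simp: luk_iff)
  qed
qed

lemma count_list_eq_content_nth:
  "length p = n \<Longrightarrow> i < n \<Longrightarrow> content p ! i = count_list p (Suc i)"
  by (simp add: content_def del: upt_Suc)

lemma content_sort: "content (sort p) = content p"
  by (simp add: content_def count_list_mset)

lemma shape_sort: "shape (sort p) = shape p"
  by (simp add: shape_def content_sort)

lemma bij_betw_content:
  "bij_betw content {p \<in> Pf n. sorted p} {w. length w = n \<and> luk 0 w}"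
proof (rule bij_betwI')
  fix p p' assume p: "p \<in> {p \<in> Pf n. sorted p}" "p' \<in> {p \<in> Pf n. sorted p}"
  show "content p = content p' \<longleftrightarrow> p = p'"
  proof
    assume eq: "content p = content p'"
    have "count_list p k = count_list p' k" for k
    proof (cases "k \<in> {1..n}")
      case True
      then have "count_list p k = content p ! (k - 1)" "count_list p' k = content p' ! (k - 1)"
        using p count_list_eq_content_nth[of _ n "k - 1"] by (auto simp: Pf_iff_luk)
      with eq show ?thesis by simp
    next
      case False
      then have "k \<notin> set p" "k \<notin> set p'" using p by (auto simp: Pf_iff_luk)
      then show ?thesis by (simp add: count_list_0_iff)
    qed
    then have "mset p = mset p'" by (intro multiset_eqI) (simp add: count_list_mset)
    then show "p = p'" using p by (metis (no_types, lifting) mem_Collect_eq properties_for_sort)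
  qed simp
next
  fix p assume "p \<in> {p \<in> Pf n. sorted p}"
  then show "content p \<in> {w. length w = n \<and> luk 0 w}"
    by (auto simp: Pf_iff_luk)
next
  fix w assume w: "w \<in> {w. length w = n \<and> luk 0 w}"
  define M where "M = (\<Sum>i<n. replicate_mset (w ! i) (Suc i))"
  define p where "p = sorted_list_of_multiset M"
  have cnt: "count_list p (Suc i) = w ! i" if "i < n" for i
    using that by (simp add: count_list_mset p_def M_def count_sum)
  have "size (\<Sum>i<k. replicate_mset (w ! i) (Suc i)) = (\<Sum>i<k. w ! i)" for k
    by (induction k) auto
  then have "size M = sum_list w" using w by (auto simp: M_def sum_list_sum_nth atLeast0LessThan)
  then have len: "length p = n" using w luk_sum_list[of 0 w] by (simp add: p_def flip: size_mset)
  have "set p \<subseteq> {1..n}" by (auto simp: p_def M_def set_mset_sum split: if_splits)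
  moreover have c: "content p = w"
    by (rule nth_equalityI) (use w len cnt in \<open>auto simp: content_def simp del: upt_Suc\<close>)
  ultimately have "p \<in> {p \<in> Pf n. sorted p}" using w len by (simp add: Pf_iff_luk p_def)
  with c show "\<exists>p\<in>{p \<in> Pf n. sorted p}. w = content p" by blast
qed

lemma prod_mset_shape:
  fixes F :: "nat \<Rightarrow> 'a::comm_monoid_mult"
  assumes "F 0 = 1" shows "(\<Prod>k\<in>#shape p. F k) = (\<Prod>a\<leftarrow>content p. F a)"
proof -
  have "(\<Prod>k\<in>#filter_mset (\<lambda>a. a \<noteq> 0) (mset w). F k) = (\<Prod>a\<leftarrow>w. F a)" for w
    using assms by (induction w) auto
  then show ?thesis by (simp add: shape_def)
qed

lemma odd_partition_shape: "odd_partition (shape p) \<longleftrightarrow> (\<forall>a\<in>set (content p). a = 0 \<or> odd a)"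
  by (auto simp: odd_partition_def shape_def)

lemma SH_eq_sum_luk: "SH n = (\<Sum>w | length w = n \<and> luk 0 w. \<Prod>a\<leftarrow>w. sym_q a)"
proof -
  have "SH n = (\<Sum>p\<in>{p \<in> Pf n. sorted p}. \<Prod>k\<in>#shape p. sym_q k)"
    unfolding SH_def PF_def sym_h_part_def
    by (simp add: shiftification_sum Sym_prod_mset shiftification_prod_mset shiftification_h)
  also have "\<dots> = (\<Sum>p\<in>{p \<in> Pf n. sorted p}. \<Prod>a\<leftarrow>content p. sym_q a)"
    by (simp add: prod_mset_shape)
  also have "\<dots> = (\<Sum>w | length w = n \<and> luk 0 w. \<Prod>a\<leftarrow>w. sym_q a)"
    by (rule sum.reindex_bij_betw[OF bij_betw_content])
  finally show ?thesis .
qed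

text \<open>With T = \<open>{-1, 1}\<close> the restriction on starting signs is automatic, and what
  remains is a regrouping of the matching conditions into one condition per arc and one per pair of
  arcs.\<close>

lemma arc_structs_iff:
  assumes "sign_map A \<epsilon>"
  shows "(\<epsilon>, \<tau>) \<in> arc_structs {-1, 1} A \<longleftrightarrow> noncrossing_matching A \<tau> \<and>
     (\<forall>(a, b)\<in>\<tau>. \<epsilon> a = - \<epsilon> b) \<and>
     (\<forall>a b c. (a, c) \<in> \<tau> \<and> a < b \<and> b < c \<longrightarrow> b \<in> A) \<and>
     (\<forall>a b c d. (a, d) \<in> \<tau> \<and> (b, c) \<in> \<tau> \<and> a < b \<and> b < c \<and> c < d \<longrightarrow> \<epsilon> a = \<epsilon> b)"
    (is "_ \<longleftrightarrow> ?N \<and> ?C1 \<and> ?C2 \<and> ?C3")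
proof
  assume "(\<epsilon>, \<tau>) \<in> arc_structs {-1, 1} A"
  then have ok: "arcs_ok {-1, 1} A \<epsilon> \<tau>" and comp: "arcs_compat \<epsilon> \<tau>" by (auto simp: arc_structs_def)
  note okD = arcs_okD[OF ok] and compD = comp[unfolded arcs_compat_def, rule_format]
  have ?C1 using okD(4) by fastforce
  moreover have ?C2
  proof (intro allI impI)
    fix a b c assume "(a, c) \<in> \<tau> \<and> a < b \<and> b < c"
    then show "b \<in> A" using subsetD[OF okD(2), of a c b] by auto
  qed
  moreover have ?C3 using compD by (metis less_asym less_irrefl less_trans)
  moreover have ?N unfolding noncrossing_matching_def
  proof (intro conjI)
    show "\<forall>(a, b)\<in>\<tau>. a \<in> A \<and> b \<in> A \<and> a < b" using okD by blast
    show "\<forall>(a, b)\<in>\<tau>. \<forall>(c, d)\<in>\<tau>. (a, b) \<noteq> (c, d) \<longrightarrow> {a, b} \<inter> {c, d} = {}"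
    proof clarify
      fix a b c d assume t: "(a, b) \<in> \<tau>" "(c, d) \<in> \<tau>" "{a, b} \<inter> {c, d} \<noteq> {}"
      show "a = c \<and> b = d" using compD[OF t(1,2)] t(3) okD(1)[OF t(1)] okD(1)[OF t(2)] by auto
    qed
    show "\<not> (\<exists>a b c d. a < b \<and> b < c \<and> c < d \<and> (a, c) \<in> \<tau> \<and> (b, d) \<in> \<tau>)"
    proof clarify
      fix a b c d assume t: "a < b" "b < c" "c < d" "(a, c) \<in> \<tau>" "(b, d) \<in> \<tau>"
      show False using compD[OF t(4,5)] t(1-3) by auto
    qed
  qed
  ultimately show "?N \<and> ?C1 \<and> ?C2 \<and> ?C3" by blast
next
  assume "?N \<and> ?C1 \<and> ?C2 \<and> ?C3"
  then have N: ?N and C1: ?C1 and C2: ?C2 and C3: ?C3 by blast+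
  note N' = N[unfolded noncrossing_matching_def]
  have ends: "x \<in> A \<and> y \<in> A \<and> x < y" if "(x, y) \<in> \<tau>" for x y
    using bspec[OF conjunct1[OF N'] that] by simp
  have disj: "x = z \<and> y = w \<or> {x, y} \<inter> {z, w} = {}" if "(x, y) \<in> \<tau>" "(z, w) \<in> \<tau>" for x y z w
    using bspec[OF conjunct1[OF conjunct2[OF N']] that(1), simplified, THEN bspec, OF that(2)] by auto
  have nc: False if "x < z" "z < y" "y < w" "(x, y) \<in> \<tau>" "(z, w) \<in> \<tau>" for x y z w
    using conjunct2[OF conjunct2[OF N']] that by blast
  have "arcs_ok {-1, 1} A \<epsilon> \<tau>" unfolding arcs_ok_def
  proof (intro allI impI)
    fix x y assume xy: "(x, y) \<in> \<tau>"
    have "{x..y} \<subseteq> A"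
    proof
      fix k assume "k \<in> {x..y}"
      then show "k \<in> A" using ends[OF xy] C2[rule_format, of x y k] xy
        by (cases "k = x"; cases "k = y") auto
    qed
    moreover have "\<epsilon> x = -1 \<or> \<epsilon> x = 1"
      using assms[unfolded sign_map_def, rule_format, of x] ends[OF xy] by simp
    moreover have "\<epsilon> x = - \<epsilon> y" using C1 xy by blast
    ultimately show "x < y \<and> {x..y} \<subseteq> A \<and> \<epsilon> x \<in> {-1, 1} \<and> \<epsilon> y = - \<epsilon> x" using ends[OF xy] by simp
  qed
  moreover have "arcs_compat \<epsilon> \<tau>" unfolding arcs_compat_def
  proof (intro allI impI)
    fix x y z w assume t: "(x, y) \<in> \<tau>" "(z, w) \<in> \<tau>"
    show "x = z \<and> y = w \<or> y < z \<or> w < x \<or> x < z \<and> w < y \<and> \<epsilon> x = \<epsilon> z \<or> z < x \<and> y < w \<and> \<epsilon> x = \<epsilon> z"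
    proof (cases "x = z \<and> y = w")
      case False
      then have ne: "x \<noteq> z" "x \<noteq> w" "y \<noteq> z" "y \<noteq> w" using disj[OF t] by auto
      show ?thesis
      proof (cases "x < z")
        case True
        then show ?thesis using nc[of x z y w] C3[rule_format, of x y z w] t ne ends[OF t(2)]
          by (cases "y < z"; cases "w < y") auto
      next
        case False
        then show ?thesis using nc[of z x w y] C3[rule_format, of z w x y] t ne ends[OF t(1)]
          by (cases "w < x"; cases "y < w") auto
      qed
    qed simp
  qed
  ultimately show "(\<epsilon>, \<tau>) \<in> arc_structs {-1, 1} A" using assms by (simp add: arc_structs_def)
qed

section \<open>Odd shifted parking functions as arc structures\<close>

lemma sign_map_bar:
  assumes "length \<sigma> = length p" "set \<sigma> \<subseteq> {-1, 1}"
  shows "sign_map (set p) (bar p \<sigma>)"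
proof -
  have "(\<Prod>i\<in>I. \<sigma> ! i) = -1 \<or> (\<Prod>i\<in>I. \<sigma> ! i) = 1" if "I \<subseteq> {..<length p}" for I
  proof -
    have "finite I" using that finite_subset by blast
    then show ?thesis using that
    proof (induction I)
      case (insert i I)
      then have "\<sigma> ! i \<in> set \<sigma>" using assms(1) by (auto intro: nth_mem)
      with assms(2) have "\<sigma> ! i = -1 \<or> \<sigma> ! i = 1" by auto
      with insert show ?case by auto
    qed simp
  qed
  from this[of "{i. i < length p \<and> p ! i = _}"] show ?thesis
    by (auto simp: sign_map_def bar_def count_list_mset)
qed

lemma OShPf_iff:
  "(p, \<sigma>, \<tau>) \<in> OShPf n \<longleftrightarrow> p \<in> Pf n \<and> odd_partition (shape p) \<and>
     length \<sigma> = n \<and> set \<sigma> \<subseteq> {-1, 1} \<and> (bar p \<sigma>, \<tau>) \<in> arc_structs {-1, 1} (set p)"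
proof (cases "p \<in> Pf n \<and> length \<sigma> = n \<and> set \<sigma> \<subseteq> {-1, 1}")
  case True
  then have "sign_map (set p) (bar p \<sigma>)" by (intro sign_map_bar) (auto simp: Pf_def)
  then show ?thesis by (simp only: OShPf_def mem_Collect_eq prod.case arc_structs_iff)
next
  case False
  then show ?thesis unfolding OShPf_def mem_Collect_eq prod.case by blast
qed

lemma Pf_sort: "sort p \<in> Pf n \<longleftrightarrow> p \<in> Pf n"
  by (simp add: Pf_def sorted_sort_id)

lemma bar_map:
  assumes "odd (count_list p k)"
  shows "bar p (map \<epsilon> p) k = \<epsilon> k ^ count_list p k"
proof -
  have "count_list p k = card {i. i < length p \<and> p ! i = k}"
    by (simp add: count_list_eq_length_filter length_filter_conv_card eq_commute[of k])
  moreover have "(\<Prod>i\<in>{i. i < length p \<and> p ! i = k}. map \<epsilon> p ! i) = (\<Prod>i\<in>{i. i < length p \<and> p ! i = k}. \<epsilon> k)"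
    by (rule prod.cong) auto
  ultimately show ?thesis using assms by (auto simp: bar_def odd_pos)
qed

text \<open>Any admissible sign vector on the values lifts to positions:
  \<open>map \<epsilon> p\<close> gives each position the sign of its value. Since every
  multiplicity is odd, the product of the equal signs in a block is that sign again, so
  \<open>bar\<close> recovers \<epsilon>.\<close>

lemma sorted_OShPf_iff:
  "(p, e, \<tau>) \<in> sorted_OShPf n \<longleftrightarrow> p \<in> Pf n \<and> sorted p \<and> odd_partition (shape p) \<and>
    (\<exists>\<epsilon>. e = map \<epsilon> [1..<n + 1] \<and> (\<epsilon>, \<tau>) \<in> arc_structs {-1, 1} (set p))"
proof
  assume "(p, e, \<tau>) \<in> sorted_OShPf n"
  then obtain p' \<sigma> where p': "(p', \<sigma>, \<tau>) \<in> OShPf n" "p = sort p'" "e = bar_tuple p' \<sigma>"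
    by (auto simp: sorted_OShPf_def)
  moreover have "length p' = n" using p'(1) by (simp add: OShPf_iff Pf_def)
  ultimately show "p \<in> Pf n \<and> sorted p \<and> odd_partition (shape p) \<and>
    (\<exists>\<epsilon>. e = map \<epsilon> [1..<n + 1] \<and> (\<epsilon>, \<tau>) \<in> arc_structs {-1, 1} (set p))"
    by (auto simp: OShPf_iff Pf_sort shape_sort bar_tuple_def simp del: upt_Suc)
next
  assume "p \<in> Pf n \<and> sorted p \<and> odd_partition (shape p) \<and>
    (\<exists>\<epsilon>. e = map \<epsilon> [1..<n + 1] \<and> (\<epsilon>, \<tau>) \<in> arc_structs {-1, 1} (set p))"
  then obtain \<epsilon> where p: "p \<in> Pf n" "sorted p" "odd_partition (shape p)"
    and e: "e = map \<epsilon> [1..<n + 1]" and st: "(\<epsilon>, \<tau>) \<in> arc_structs {-1, 1} (set p)" by blast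
  have sm: "if k \<in> set p then \<epsilon> k = -1 \<or> \<epsilon> k = 1 else \<epsilon> k = 0" for k
    using st by (auto simp: arc_structs_def sign_map_def)
  have len: "length p = n" using p by (simp add: Pf_def)
  have sgn: "set (map \<epsilon> p) \<subseteq> {-1, 1}"
  proof
    fix v assume "v \<in> set (map \<epsilon> p)"
    then obtain k where "k \<in> set p" "v = \<epsilon> k" by auto
    with sm[of k] show "v \<in> {-1, 1}" by simp
  qed
  have "bar p (map \<epsilon> p) k = \<epsilon> k" for k
  proof (cases "k \<in> set p")
    case True
    then have k: "k \<in> {1..n}" using p by (auto simp: Pf_iff_luk)
    then have "count_list p k = content p ! (k - 1)"
      using count_list_eq_content_nth[OF len, of "k - 1"] by auto
    then have "count_list p k \<in> set (content p)"
      using k len nth_mem[of "k - 1" "content p"] by auto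
    moreover have "count_list p k \<noteq> 0" using True by (simp add: count_list_0_iff)
    ultimately have "odd (count_list p k)" using p(3) by (auto simp: odd_partition_shape)
    then show ?thesis using bar_map[of p k \<epsilon>] sm[of k] True by auto
  next
    case False
    then show ?thesis using sm[of k] by (simp add: bar_def count_list_0_iff)
  qed
  then have bar: "bar p (map \<epsilon> p) = \<epsilon>" by blast
  have "(p, map \<epsilon> p, \<tau>) \<in> OShPf n"
    unfolding OShPf_iff bar using p st len sgn by auto
  moreover have "sort_shpf (p, map \<epsilon> p, \<tau>) = (p, e, \<tau>)"
    using p len by (simp add: bar_tuple_def bar e sorted_sort_id del: upt_Suc)
  ultimately show "(p, e, \<tau>) \<in> sorted_OShPf n" unfolding sorted_OShPf_def by (metis imageI)
qed

lemma finite_Pf: "finite (Pf n)"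
  by (rule finite_subset[OF _ finite_lists_length_eq[of "{1..n}" n]]) (use Pf_iff_luk in blast)+

lemma card_arc_structs_content:
  assumes "p \<in> Pf n"
  shows "card (arc_structs {-1, 1} (set p)) = run_weight 0 (content p)"
proof -
  have len: "length p = n" and sub: "set p \<subseteq> {1..n}" using assms by (auto simp: Pf_iff_luk)
  have "k \<in> set p \<longleftrightarrow> k \<in> {1 + 0 + i | i. i < length (content p) \<and> content p ! i \<noteq> 0}" for k
  proof
    assume k: "k \<in> set p"
    then have "1 \<le> k" "k \<le> n" using sub by auto
    with k show "k \<in> {1 + 0 + i | i. i < length (content p) \<and> content p ! i \<noteq> 0}"
      using len count_list_eq_content_nth[OF len, of "k - 1"]
      by (intro CollectI exI[of _ "k - 1"]) (auto simp: count_list_0_iff)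
  next
    assume "k \<in> {1 + 0 + i | i. i < length (content p) \<and> content p ! i \<noteq> 0}"
    then obtain i where i: "k = Suc i" "i < length (content p)" "content p ! i \<noteq> 0" by auto
    then have "count_list p k \<noteq> 0"
      using count_list_eq_content_nth[OF len, of i] len by simp
    then show "k \<in> set p" by (simp add: count_list_0_iff)
  qed
  \<comment> \<open>Letter 0 of the content belongs to the value 1, hence x = 1, with an empty run
    before it.\<close>
  then have "{1..<1 + 0} \<union> {1 + 0 + i | i. i < length (content p) \<and> content p ! i \<noteq> 0} = set p" by auto
  then show ?thesis using card_arc_structs_word[of 1 0 "content p"] by simp
qed

lemma SH_eq_sum_sorted_OShPf:
  "SH n = (\<Sum>(p, \<sigma>, \<tau>)\<in>sorted_OShPf n. sym_V (shape p))"
proof -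
  let ?A = "{p \<in> Pf n. sorted p}"
  let ?O = "{p \<in> ?A. odd_partition (shape p)}"
  let ?S = "\<lambda>p. (\<lambda>(\<epsilon>, \<tau>). (map \<epsilon> [1..<n + 1], \<tau>)) ` arc_structs {-1, 1} (set p)"
  have finO: "finite ?O" by (rule finite_subset[OF _ finite_Pf[of n]]) auto
  have card: "card (?S p) = run_weight 0 (content p)" if "p \<in> Pf n" for p
  proof -
    \<comment> \<open>Sign vectors vanish outside the values of p, which lie in 1..n, so listing
      them on 1..n keeps all information.\<close>
    have "inj_on (\<lambda>(\<epsilon>, \<tau>). (map \<epsilon> [1..<n + 1], \<tau> :: (nat \<times> nat) set)) (arc_structs {-1, 1} (set p))"
    proof (rule inj_onI)
      fix s t
      assume s: "s \<in> arc_structs {-1, 1} (set p)" and t: "t \<in> arc_structs {-1, 1} (set p)"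
        and "(case s of (\<epsilon>, \<tau>) \<Rightarrow> (map \<epsilon> [1..<n + 1], \<tau>)) = (case t of (\<epsilon>, \<tau>) \<Rightarrow> (map \<epsilon> [1..<n + 1], \<tau>))"
      then obtain \<epsilon> \<epsilon>' \<tau> where st_eq: "s = (\<epsilon>, \<tau>)" "t = (\<epsilon>', \<tau>)"
        and eq: "map \<epsilon> [1..<n + 1] = map \<epsilon>' [1..<n + 1]"
        by (cases s; cases t) (auto simp del: upt_Suc)
      with s t have st: "(\<epsilon>, \<tau>) \<in> arc_structs {-1, 1} (set p)" "(\<epsilon>', \<tau>) \<in> arc_structs {-1, 1} (set p)"
        by auto
      have "\<epsilon> k = \<epsilon>' k" for k
      proof (cases "k \<in> {1..n}")
        case True
        then have "k \<in> set [1..<n + 1]" by auto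
        with eq show ?thesis by (metis map_eq_conv)
      next
        case False
        then have "k \<notin> set p" using that by (auto simp: Pf_iff_luk)
        then show ?thesis using st by (auto simp: arc_structs_def sign_map_def)
      qed
      then show "s = t" by (auto simp: st_eq)
    qed
    then show ?thesis using card_arc_structs_content[OF that] by (simp add: card_image del: upt_Suc)
  qed
  have S_iff: "(e, \<tau>) \<in> ?S p \<longleftrightarrow>
      (\<exists>\<epsilon>. e = map \<epsilon> [1..<n + 1] \<and> (\<epsilon>, \<tau>) \<in> arc_structs {-1, 1} (set p))" for e \<tau> p
  proof
    assume "\<exists>\<epsilon>. e = map \<epsilon> [1..<n + 1] \<and> (\<epsilon>, \<tau>) \<in> arc_structs {-1, 1} (set p)"
    then obtain \<epsilon> where "e = map \<epsilon> [1..<n + 1]" "(\<epsilon>, \<tau>) \<in> arc_structs {-1, 1} (set p)" by blast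
    then show "(e, \<tau>) \<in> ?S p" by (intro image_eqI[of _ _ "(\<epsilon>, \<tau>)"]) (simp_all del: upt_Suc)
  qed (auto simp del: upt_Suc)
  have "sorted_OShPf n = Sigma ?O ?S"
  proof (rule set_eqI)
    fix t :: shpf
    obtain p e \<tau> where t: "t = (p, e, \<tau>)" by (cases t)
    show "t \<in> sorted_OShPf n \<longleftrightarrow> t \<in> Sigma ?O ?S"
      unfolding t sorted_OShPf_iff mem_Sigma_iff S_iff by blast
  qed
  then have "(\<Sum>(p, \<sigma>, \<tau>)\<in>sorted_OShPf n. sym_V (shape p)) = (\<Sum>(p, _)\<in>Sigma ?O ?S. sym_V (shape p))"
    by (simp add: split_def)
  also have "\<dots> = (\<Sum>p\<in>?O. \<Sum>_\<in>?S p. sym_V (shape p))"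
    by (rule sum.Sigma[symmetric]) (use finO in \<open>auto simp: finite_arc_structs simp del: upt_Suc\<close>)
  also have "\<dots> = (\<Sum>p\<in>?O. of_nat (run_weight 0 (content p)) * (\<Prod>a\<leftarrow>content p. sym_P a))"
  proof (rule sum.cong)
    fix p assume "p \<in> ?O"
    moreover have "sym_V (shape p) = (\<Prod>a\<leftarrow>content p. sym_P a)"
      unfolding sym_V_def by (rule prod_mset_shape) (simp add: sym_P_def)
    ultimately show "(\<Sum>_\<in>?S p. sym_V (shape p))
        = of_nat (run_weight 0 (content p)) * (\<Prod>a\<leftarrow>content p. sym_P a)"
      using card[of p] by (simp only: sum_constant mem_Collect_eq)
  qed simp
  also have "\<dots> = (\<Sum>p\<in>?A. if \<forall>a\<in>set (content p). a = 0 \<or> odd a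
      then of_nat (run_weight 0 (content p)) * (\<Prod>a\<leftarrow>content p. sym_P a) else 0)"
    by (rule sum.mono_neutral_cong_left) (auto simp: finite_Pf odd_partition_shape)
  also have "\<dots> = (\<Sum>w | length w = n \<and> luk 0 w.
      if \<forall>a\<in>set w. a = 0 \<or> odd a then of_nat (run_weight 0 w) * (\<Prod>a\<leftarrow>w. sym_P a) else 0)"
    by (rule sum.reindex_bij_betw[OF bij_betw_content])
  also have "\<dots> = SH n" by (simp add: SH_eq_sum_luk sum_luk_sym_q_eq_runs)
  finally show ?thesis by simp
qed

section \<open>Cycle types and averages over the symmetric group\<close>

lemma image_mset_eq_implies_bij_betw:
  assumes "finite A" "finite B" "image_mset f (mset_set A) = image_mset g (mset_set B)"
  shows "\<exists>h. bij_betw h A B \<and> (\<forall>x\<in>A. g (h x) = f x)"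
  using assms
proof (induction A arbitrary: B)
  case empty
  then have "B = {}" by (simp add: mset_set_empty_iff)
  then show ?case by (auto simp: bij_betw_def)
next
  case (insert x A)
  have "f x \<in># image_mset g (mset_set B)" using insert.hyps by (simp flip: insert.prems(2))
  then obtain y where y: "y \<in> B" "g y = f x" using insert.prems(1) by auto
  have "mset_set B = add_mset y (mset_set (B - {y}))"
    using y insert.prems(1) by (metis mset_set.remove)
  then have "image_mset f (mset_set A) = image_mset g (mset_set (B - {y}))"
    using insert.prems(2) insert.hyps y by simp
  then obtain h where h: "bij_betw h A (B - {y})" "\<forall>x\<in>A. g (h x) = f x"
    using insert.IH[of "B - {y}"] insert.prems(1) by auto
  have "bij_betw (h(x := y)) A (B - {y})"
    using h(1) insert.hyps(2) by (subst bij_betw_cong[of A _ h]) auto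
  then have "bij_betw (h(x := y)) (A \<union> {x}) ((B - {y}) \<union> {(h(x := y)) x})"
    using insert.hyps(2) by (intro notIn_Un_bij_betw) auto
  then have "bij_betw (h(x := y)) (insert x A) B" using y(1) by (simp add: insert_absorb del: fun_upd_apply) (simp add: insert_absorb)
  then show ?case using h(2) y(2) insert.hyps(2) by (intro exI[of _ "h(x := y)"] conjI) (assumption | auto)+
qed

text \<open>Exponents are addresses on a cycle, unique modulo its length; this makes it possible to
  transport addresses between cycles of equal length.\<close>

lemma permutation_funpow_eq_iff:
  assumes "permutation f"
  shows "(f ^^ k) x = (f ^^ l) x \<longleftrightarrow> k mod card (orbit f x) = l mod card (orbit f x)"
proof -
  have self: "x \<in> orbit f x" using assms by (rule permutation_self_in_orbit)
  define c where "c = funpow_dist1 f x x"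
  have inj: "inj_on (\<lambda>n. (f ^^ n) x) {0..<c}" unfolding c_def by (rule inj_on_funpow_dist1[OF self])
  have card: "card (orbit f x) = c"
    using card_image[OF inj] orbit_conv_funpow_dist1[OF self] by (simp add: c_def)
  have "(f ^^ c) x = x" unfolding c_def by (rule funpow_dist1_prop[OF self])
  then have "(f ^^ k) x = (f ^^ (k mod c)) x" "(f ^^ l) x = (f ^^ (l mod c)) x"
    by (simp_all add: funpow_mod_eq)
  moreover have "c > 0" by (simp add: c_def)
  ultimately show ?thesis unfolding card using inj_onD[OF inj, of "k mod c" "l mod c"] by auto
qed

lemma permutes_lessThan_permutation: "w permutes {..<n} \<Longrightarrow> permutation w" for n :: nat
  by (auto simp: permutation_permutes)

lemma orbit_eq_of_mem:
  assumes "permutation f" "y \<in> orbit f x" shows "orbit f y = orbit f x"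
  using cyclic_on_orbit'[OF assms(1), of x] assms(2) by (rule orbit_cyclic_eq3)

text \<open>Pair the cycles of w with cycles of w' of the same length by h, choose a base point on
  each, and send the point with address k on a cycle of w to the point with address k on its
  partner. Both permutations advance the address by one, so the map intertwines them.\<close>

lemma conjugate_of_cycle_type_eq:
  assumes w: "w permutes {..<n}" and w': "w' permutes {..<n}" and ct: "cycle_type n w = cycle_type n w'"
  shows "\<exists>u. u permutes {..<n} \<and> u \<circ> w = w' \<circ> u"
proof -
  note pw = permutes_lessThan_permutation[OF w] and pw' = permutes_lessThan_permutation[OF w']
  obtain h where h: "bij_betw h (orbit w ` {..<n}) (orbit w' ` {..<n})"
    and hc: "\<forall>C\<in>orbit w ` {..<n}. card (h C) = card C"
    using image_mset_eq_implies_bij_betw[of "orbit w ` {..<n}" "orbit w' ` {..<n}" card card] ct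
    unfolding cycle_type_def by auto
  define r where "r C = (SOME y. y \<in> C)" for C :: "nat set"
  have r: "r (orbit f x) \<in> orbit f x" for f x
    unfolding r_def using orbit_nonempty[of f x] by (metis some_in_eq)
  \<comment> \<open>\<open>R x\<close> is the base point of the cycle of x, and \<open>R' x\<close>
    that of the partner cycle; both depend on x only through its cycle.\<close>
  define R where "R x = r (orbit w x)" for x
  define R' where "R' x = r (h (orbit w x))" for x
  have hO: "\<exists>y<n. h (orbit w x) = orbit w' y" if "x < n" for x
    using bij_betwE[OF h] that by blast
  have oR: "orbit w (R x) = orbit w x" for x
    unfolding R_def by (rule orbit_eq_of_mem[OF pw r])
  have oR': "orbit w' (R' x) = h (orbit w x)" if xn: "x < n" for x
  proof -
    obtain y where "h (orbit w x) = orbit w' y" using hO[OF xn] by blast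
    then show ?thesis unfolding R'_def using orbit_eq_of_mem[OF pw' r, of y] by simp
  qed
  have "\<exists>k. (w ^^ k) (R x) = x" for x
  proof -
    have "x \<in> orbit w (R x)" unfolding oR by (rule permutation_self_in_orbit[OF pw])
    then obtain k where "x = (w ^^ k) (R x)" unfolding orbit_altdef_permutation[OF pw] by blast
    from this[symmetric] show ?thesis by (rule exI)
  qed
  then obtain k where k: "\<And>x. (w ^^ k x) (R x) = x" by metis
  define u where "u x = (if x < n then (w' ^^ k x) (R' x) else x)" for x
  have step: "R (w x) = R x" "R' (w x) = R' x" for x
    by (simp_all add: R_def R'_def permutation_orbit_step[OF pw])
  have eq_iff: "(w ^^ i) (R x) = (w ^^ j) (R x) \<longleftrightarrow> (w' ^^ i) (R' x) = (w' ^^ j) (R' x)" if "x < n" for i j x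
    unfolding permutation_funpow_eq_iff[OF pw] permutation_funpow_eq_iff[OF pw'] oR oR'[OF that]
    using hc that by simp
  have wn: "w x < n \<longleftrightarrow> x < n" for x using permutes_in_image[OF w, of x] by simp
  have comm: "u (w x) = w' (u x)" for x
  proof (cases "x < n")
    case True
    have "(w ^^ k (w x)) (R x) = (w ^^ Suc (k x)) (R x)" using k[of "w x"] k[of x] step by simp
    then have "(w' ^^ k (w x)) (R' x) = (w' ^^ Suc (k x)) (R' x)" using eq_iff[OF True] by blast
    then show ?thesis using True wn by (simp add: u_def step)
  next
    case False
    then show ?thesis using wn permutes_not_in[OF w'] permutes_not_in[OF w] by (simp add: u_def)
  qed
  have uO: "u x \<in> h (orbit w x)" if "x < n" for x
    using that by (simp add: u_def flip: oR') (simp add: orbit_altdef_permutation[OF pw'], blast)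
  have "u permutes {..<n}"
  proof (rule inj_imp_permutes)
    show "inj_on u {..<n}"
    proof (rule inj_onI)
      fix x y assume xy: "x \<in> {..<n}" "y \<in> {..<n}" "u x = u y"
      obtain a b where ab: "h (orbit w x) = orbit w' a" "h (orbit w y) = orbit w' b"
        using hO xy by (meson lessThan_iff)
      have "u x \<in> orbit w' a" "u x \<in> orbit w' b" using uO[of x] uO[of y] xy ab by auto
      then have "orbit w' (u x) = h (orbit w x)" "orbit w' (u x) = h (orbit w y)"
        using ab orbit_eq_of_mem[OF pw', of "u x" a] orbit_eq_of_mem[OF pw', of "u x" b] by simp_all
      then have "h (orbit w x) = h (orbit w y)" by simp
      then have C: "orbit w x = orbit w y" using h xy unfolding bij_betw_def by (auto dest: inj_onD)
      then have "R x = R y" "R' x = R' y" by (simp_all add: R_def R'_def)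
      then have "(w' ^^ k x) (R' x) = (w' ^^ k y) (R' x)" using xy by (simp add: u_def)
      then have "(w ^^ k x) (R x) = (w ^^ k y) (R x)" using eq_iff xy by auto
      then show "x = y" using k \<open>R x = R y\<close> by metis
    qed
    show "u x \<in> {..<n}" if xn: "x \<in> {..<n}" for x
    proof -
      obtain y where "y < n" "h (orbit w x) = orbit w' y" using hO xn by auto
      then show ?thesis using uO[of x] xn permutes_orbit_subset[OF w', of y] by auto
    qed
  qed (auto simp: u_def)
  moreover have "u \<circ> w = w' \<circ> u" using comm by auto
  ultimately show ?thesis by blast
qed

lemma cycle_type_conj:
  assumes w: "w permutes {..<n}" and u: "u permutes {..<n}"
  shows "cycle_type n (u \<circ> w \<circ> inv u) = cycle_type n w"
proof -
  have "orbit (u \<circ> w \<circ> inv u) (u x) = u ` orbit w x" for x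
  proof -
    have "((u \<circ> w \<circ> inv u) ^^ k) (u x) = u ((w ^^ k) x)" for k
      by (induction k) (simp_all add: permutes_inverses[OF u])
    then show ?thesis unfolding orbit_altdef by auto
  qed
  then have "orbit (u \<circ> w \<circ> inv u) ` u ` {..<n} = (`) u ` orbit w ` {..<n}" by (simp add: image_image)
  then have im: "orbit (u \<circ> w \<circ> inv u) ` {..<n} = (`) u ` orbit w ` {..<n}"
    by (simp add: permutes_image[OF u])
  have inj: "inj_on ((`) u) X" for X
    using permutes_inj[OF u] by (meson inj_on_image inj_image_eq_iff inj_onI)
  have "image_mset card (mset_set ((`) u ` orbit w ` {..<n}))
      = image_mset (\<lambda>C. card (u ` C)) (mset_set (orbit w ` {..<n}))"
    by (simp add: image_mset.compositionality o_def flip: image_mset_mset_set[OF inj])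
  also have "\<dots> = image_mset card (mset_set (orbit w ` {..<n}))"
    by (intro image_mset_cong card_image inj_on_subset[OF permutes_inj[OF u] subset_UNIV])
  finally show ?thesis unfolding cycle_type_def im .
qed

lemma cycle_type_in_partitions:
  assumes w: "w permutes {..<n}" shows "cycle_type n w \<in> partitions n"
proof -
  note pw = permutes_lessThan_permutation[OF w]
  let ?X = "orbit w ` {..<n}"
  have fin: "finite C" if "C \<in> ?X" for C
    using that finite_orbit[OF permutation_self_in_orbit[OF pw]] by auto
  have "sum card ?X = card (\<Union> ?X)"
  proof (rule card_Union_disjoint[symmetric])
    show "pairwise disjnt ?X"
      unfolding pairwise_def disjnt_iff using orbit_eq_of_mem[OF pw] by (auto simp: image_iff) (metis+)
  qed (use fin in auto)
  also have "\<Union> ?X = {..<n}"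
    using permutes_orbit_subset[OF w] permutation_self_in_orbit[OF pw] by fastforce
  finally have "sum card ?X = n" by simp
  moreover have "card C \<noteq> 0" if "C \<in> ?X" for C
    using fin[OF that] that orbit_nonempty[of w] by auto
  then have "0 \<notin># cycle_type n w" unfolding cycle_type_def by fastforce
  ultimately show ?thesis by (simp add: partitions_def cycle_type_def sum_unfold_sum_mset)
qed

text \<open>A part k is realized by adding one k-cycle on the last k positions to a permutation of
  the first n' = n - k positions.\<close>

lemma exists_cycle_type:
  assumes "l \<in> partitions n" shows "\<exists>w. w permutes {..<n} \<and> cycle_type n w = l"
  using assms
proof (induction l arbitrary: n)
  case empty
  then have "n = 0" by (simp add: partitions_def)
  then show ?case by (intro exI[of _ id]) (auto simp: cycle_type_def id_def)
next
  case (add k l)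
  then obtain n' where n: "n = n' + k" and k: "k > 0" and "l \<in> partitions n'"
    by (auto simp: partitions_def)
  then obtain v where v: "v permutes {..<n'}" and ct: "cycle_type n' v = l" using add.IH by blast
  let ?B = "{n'..<n' + k}"
  define w where "w x = (if x < n' then v x else if x + 1 < n' + k then x + 1 else if x + 1 = n' + k then n' else x)" for x
  have vn: "v x < n' \<longleftrightarrow> x < n'" for x using permutes_in_image[OF v, of x] by simp
  have w: "w permutes {..<n}"
  proof (rule inj_imp_permutes)
    show "inj_on w {..<n}"
    proof (rule inj_onI)
      fix x y assume "x \<in> {..<n}" "y \<in> {..<n}" "w x = w y"
      then show "x = y" using vn[of x] vn[of y] permutes_inj[OF v, THEN injD, of x y] n
        by (auto simp: w_def split: if_splits)
    qed
    show "w x \<in> {..<n}" if "x \<in> {..<n}" for x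
      using that vn[of x] n k by (auto simp: w_def)
    show "w x = x" if "x \<notin> {..<n}" for x using that n by (simp add: w_def)
  qed simp
  have low: "orbit w x = orbit v x" if "x < n'" for x
    by (rule orbit_cong0[of _ "{..<n'}", symmetric]) (use that vn in \<open>auto simp: w_def\<close>)
  have pow: "(w ^^ i) n' = n' + i" if "i < k" for i
    using that by (induction i) (auto simp: w_def)
  have "orbit w n' = ?B"
  proof
    have B: "w y \<in> ?B" if "y \<in> ?B" for y using that k by (auto simp: w_def)
    have "y \<in> ?B" if "y \<in> orbit w n'" for y
      using that by (induction rule: orbit.induct) (rule B, use k in simp)+
    then show "orbit w n' \<subseteq> ?B" by blast
    show "?B \<subseteq> orbit w n'"
    proof
      fix y assume "y \<in> ?B"
      then have "(w ^^ (y - n')) n' = y" using pow[of "y - n'"] by auto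
      then show "y \<in> orbit w n'"
        unfolding orbit_altdef_permutation[OF permutes_lessThan_permutation[OF w]]
        by (intro CollectI exI[of _ "y - n'"]) simp
    qed
  qed
  then have high: "orbit w x = ?B" if "x \<in> ?B" for x
    using orbit_eq_of_mem[OF permutes_lessThan_permutation[OF w], of x n'] that by simp
  have "orbit w ` {..<n} = orbit w ` {..<n'} \<union> orbit w ` ?B"
    unfolding image_Un[symmetric] n by (rule arg_cong[of _ _ "image _"]) auto
  also have "orbit w ` {..<n'} = orbit v ` {..<n'}" using low by (intro image_cong) auto
  also have "orbit w ` ?B = {?B}" using high k by (auto simp: image_def)
  finally have im: "orbit w ` {..<n} = insert ?B (orbit v ` {..<n'})" by simp
  have "?B \<notin> orbit v ` {..<n'}"
  proof
    assume "?B \<in> orbit v ` {..<n'}"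
    then obtain x where "x < n'" "orbit v x = ?B" by auto
    then have "n' \<in> {..<n'}" using permutes_orbit_subset[OF v, of x] k by auto
    then show False by simp
  qed
  then have "cycle_type n w = add_mset k l" by (simp add: cycle_type_def im flip: ct)
  with w show ?case by blast
qed

text \<open>The fibres of the map u -> u.x are left cosets of the stabilizer. It serves twice: for
  conjugation of permutations and for rearrangement of words.\<close>

lemma orbit_stabilizer:
  fixes act :: "('b \<Rightarrow> 'b) \<Rightarrow> 'a \<Rightarrow> 'a"
  assumes fin: "finite A"
    and act: "\<And>u v x. u permutes A \<Longrightarrow> v permutes A \<Longrightarrow> act (u \<circ> v) x = act u (act v x)" "\<And>x. act id x = x"
  shows "card ((\<lambda>u. act u x) ` {u. u permutes A}) * card {u. u permutes A \<and> act u x = x} = fact (card A)"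
proof -
  let ?G = "{u. u permutes A}" and ?S = "{u. u permutes A \<and> act u x = x}"
  have finG: "finite ?G" using fin by (rule finite_permutations)
  have fiber: "card {u \<in> ?G. act u x = y} = card ?S" if y: "y \<in> (\<lambda>u. act u x) ` ?G" for y
  proof -
    obtain v where v: "v permutes A" "y = act v x" using y by blast
    have iv: "inv v permutes A" using v(1) by (rule permutes_inv)
    have "bij_betw ((\<circ>) v) ?S {u \<in> ?G. act u x = y}"
    proof (rule bij_betw_byWitness[where f' = "(\<circ>) (inv v)"])
      show "\<forall>u\<in>?S. inv v \<circ> (v \<circ> u) = u" "\<forall>u\<in>{u \<in> ?G. act u x = y}. v \<circ> (inv v \<circ> u) = u"
        by (simp_all add: fun_eq_iff permutes_inverses[OF v(1)])
      show "(\<circ>) v ` ?S \<subseteq> {u \<in> ?G. act u x = y}"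
        using v by (auto simp: act permutes_compose)
      have "act (inv v) y = x"
        using act(1)[OF iv v(1), of x] by (simp add: v(2) permutes_inv_o(2)[OF v(1)] act(2))
      then show "(\<circ>) (inv v) ` {u \<in> ?G. act u x = y} \<subseteq> ?S"
        using iv by (auto simp: act permutes_compose)
    qed
    then show ?thesis by (rule bij_betw_same_card[symmetric])
  qed
  have "fact (card A) = card ?G" using fin by (simp add: card_permutations)
  also have "\<dots> = (\<Sum>y\<in>(\<lambda>u. act u x) ` ?G. card {u \<in> ?G. act u x = y})"
    using sum.image_gen[OF finG, of "\<lambda>_. 1 :: nat" "\<lambda>u. act u x"] by simp
  also have "\<dots> = card ((\<lambda>u. act u x) ` ?G) * card ?S" using fiber by simp
  finally show ?thesis by simp
qed

lemma perm_of_type: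
  assumes "l \<in> partitions n"
  shows "perm_of_type n l permutes {..<n}" "cycle_type n (perm_of_type n l) = l"
  using someI_ex[OF exists_cycle_type[OF assms]] unfolding perm_of_type_def by blast+

text \<open>The permutations of cycle type l form one orbit under conjugation, and the stabilizer of
  the chosen representative is its centralizer.\<close>

lemma card_cycle_type_class:
  assumes "l \<in> partitions n"
  shows "card {w. w permutes {..<n} \<and> cycle_type n w = l} * centralizer_order n l = fact n"
proof -
  let ?w = "perm_of_type n l"
  note w = perm_of_type[OF assms]
  have "card ((\<lambda>u. u \<circ> ?w \<circ> inv u) ` {u. u permutes {..<n}})
      * card {u. u permutes {..<n} \<and> u \<circ> ?w \<circ> inv u = ?w} = fact (card {..<n})"
    by (rule orbit_stabilizer[where act = "\<lambda>u w. u \<circ> w \<circ> inv u"])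
      (auto simp: permutes_bij o_inv_distrib o_assoc)
  moreover have "(\<lambda>u. u \<circ> ?w \<circ> inv u) ` {u. u permutes {..<n}} = {w. w permutes {..<n} \<and> cycle_type n w = l}"
  proof (intro equalityI subsetI)
    fix v assume "v \<in> (\<lambda>u. u \<circ> ?w \<circ> inv u) ` {u. u permutes {..<n}}"
    then show "v \<in> {w. w permutes {..<n} \<and> cycle_type n w = l}"
      using w cycle_type_conj[OF w(1)] by (auto intro!: permutes_compose permutes_inv)
  next
    fix v assume v: "v \<in> {w. w permutes {..<n} \<and> cycle_type n w = l}"
    then obtain u where u: "u permutes {..<n}" "u \<circ> ?w = v \<circ> u"
      using conjugate_of_cycle_type_eq[OF w(1), of v] w(2) by auto
    then have "v = u \<circ> ?w \<circ> inv u" by (simp add: comp_assoc permutes_inv_o[OF u(1)])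
    with u(1) show "v \<in> (\<lambda>u. u \<circ> ?w \<circ> inv u) ` {u. u permutes {..<n}}" by blast
  qed
  moreover have "u \<circ> ?w \<circ> inv u = ?w \<longleftrightarrow> u \<circ> ?w = ?w \<circ> u" if "u permutes {..<n}" for u
  proof
    assume "u \<circ> ?w \<circ> inv u = ?w"
    then have "u \<circ> ?w \<circ> inv u \<circ> u = ?w \<circ> u" by simp
    then show "u \<circ> ?w = ?w \<circ> u" by (simp add: comp_assoc permutes_inv_o[OF that])
  qed (simp add: comp_assoc permutes_inv_o[OF that])
  then have "{u. u permutes {..<n} \<and> u \<circ> ?w \<circ> inv u = ?w} = {u. u permutes {..<n} \<and> u \<circ> ?w = ?w \<circ> u}"
    by blast
  ultimately show ?thesis by (simp add: centralizer_order_def)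
qed

text \<open>The weight 1/z_l is the size of the class divided by n!, so the sum over partitions
  spreads evenly over all permutations as soon as \<chi> is constant on classes.\<close>

lemma frobenius_character_average:
  assumes class_fun: "\<And>u w. u permutes {..<n} \<Longrightarrow> w permutes {..<n} \<Longrightarrow> \<chi> (u \<circ> w \<circ> inv u) = \<chi> w"
  shows "mcoeff (frobenius_character n \<chi>) m
    = (\<Sum>w | w permutes {..<n}. \<chi> w * mcoeff (sym_p_part (cycle_type n w)) m) / fact n"
proof -
  let ?G = "{w. w permutes {..<n}}"
  have finG: "finite ?G" by (rule finite_permutations) simp
  have im: "cycle_type n ` ?G = partitions n"
    using cycle_type_in_partitions exists_cycle_type by (auto simp: image_iff) metis
  have "(\<Sum>w\<in>?G. \<chi> w * mcoeff (sym_p_part (cycle_type n w)) m)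
      = (\<Sum>l\<in>partitions n. \<Sum>w | w \<in> ?G \<and> cycle_type n w = l. \<chi> w * mcoeff (sym_p_part (cycle_type n w)) m)"
    using sum.image_gen[OF finG, of "\<lambda>w. \<chi> w * mcoeff (sym_p_part (cycle_type n w)) m" "cycle_type n"]
    unfolding im .
  also have "\<dots> = (\<Sum>l\<in>partitions n. fact n * (\<chi> (perm_of_type n l) / of_nat (centralizer_order n l) * mcoeff (sym_p_part l) m))"
  proof (rule sum.cong)
    fix l assume l: "l \<in> partitions n"
    note pl = perm_of_type[OF l]
    have \<chi>: "\<chi> w = \<chi> (perm_of_type n l)" if w: "w permutes {..<n}" "cycle_type n w = l" for w
    proof -
      obtain u where u: "u permutes {..<n}" "u \<circ> perm_of_type n l = w \<circ> u"
        using conjugate_of_cycle_type_eq[OF pl(1) w(1)] pl w by auto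
      then have "w = u \<circ> perm_of_type n l \<circ> inv u" by (simp add: comp_assoc permutes_inv_o[OF u(1)])
      then show ?thesis using class_fun[OF u(1) pl(1)] by simp
    qed
    have "(\<Sum>w | w \<in> ?G \<and> cycle_type n w = l. \<chi> w * mcoeff (sym_p_part (cycle_type n w)) m)
        = (\<Sum>w | w \<in> ?G \<and> cycle_type n w = l. \<chi> (perm_of_type n l) * mcoeff (sym_p_part l) m)"
      by (rule sum.cong) (auto simp: \<chi>)
    also have "\<dots> = of_nat (card {w. w permutes {..<n} \<and> cycle_type n w = l}) * (\<chi> (perm_of_type n l) * mcoeff (sym_p_part l) m)"
      by simp
    finally have eq: "(\<Sum>w | w \<in> ?G \<and> cycle_type n w = l. \<chi> w * mcoeff (sym_p_part (cycle_type n w)) m) = \<dots>" .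
    have "of_nat (card {w. w permutes {..<n} \<and> cycle_type n w = l}) * of_nat (centralizer_order n l) = (fact n :: complex)"
      using card_cycle_type_class[OF l] by (metis of_nat_fact of_nat_mult)
    moreover from this have "of_nat (centralizer_order n l) \<noteq> (0 :: complex)"
      by (metis fact_nonzero mult_zero_right)
    ultimately have "of_nat (card {w. w permutes {..<n} \<and> cycle_type n w = l}) = (fact n / of_nat (centralizer_order n l) :: complex)"
      by (simp add: field_simps)
    then show "(\<Sum>w | w \<in> ?G \<and> cycle_type n w = l. \<chi> w * mcoeff (sym_p_part (cycle_type n w)) m)
      = fact n * (\<chi> (perm_of_type n l) / of_nat (centralizer_order n l) * mcoeff (sym_p_part l) m)"
      unfolding eq by simp
  qed simp
  also have "\<dots> = fact n * mcoeff (frobenius_character n \<chi>) m"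
    by (simp add: frobenius_character_def mcoeff_sum sum_distrib_left)
  finally show ?thesis by simp
qed

section \<open>The character of the module\<close>

lemma tuple_act_eq_iff:
  assumes "w permutes {..<length a}"
  shows "tuple_act w a = a \<longleftrightarrow> (\<forall>i<length a. a ! w i = a ! i)"
proof
  assume "tuple_act w a = a"
  then show "\<forall>i<length a. a ! w i = a ! i" using tuple_act_nth[OF assms] by metis
next
  assume fix_w: "\<forall>i<length a. a ! w i = a ! i"
  have iw: "inv w permutes {..<length a}" using assms by (rule permutes_inv)
  show "tuple_act w a = a"
  proof (rule nth_equalityI)
    fix i assume "i < length (tuple_act w a)"
    then have i: "i < length a" by (simp add: tuple_act_def)
    then have "inv w i < length a" using permutes_in_image[OF iw, of i] by simp
    with fix_w have "a ! w (inv w i) = a ! inv w i" by blast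
    then show "tuple_act w a ! i = a ! i"
      using i by (simp add: tuple_act_def permute_list_nth[OF iw] permutes_inverses[OF assms])
  qed (simp add: tuple_act_def)
qed

definition neg_pos :: "int list \<Rightarrow> nat set" where
  "neg_pos \<sigma> = {i. i < length \<sigma> \<and> \<sigma> ! i = -1}"

lemma perm_restrict_permutes:
  assumes "inj w" "finite A" "\<And>i. i \<in> A \<Longrightarrow> w i \<in> A"
  shows "perm_restrict w A permutes A"
proof (rule inj_imp_permutes)
  show "inj_on (perm_restrict w A) A"
    using assms(1) by (auto simp: perm_restrict_def inj_on_def dest: injD)
qed (use assms in \<open>auto simp: perm_restrict_def\<close>)

text \<open>When w fixes \<sigma> it permutes the negative positions. Numbering these increasingly,
  the permutation that sorts their images is the inverse of the restriction of w, and a permutation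
  has the same sign as its inverse.\<close>

lemma act_sign_eq:
  assumes w: "w permutes {..<length \<sigma>}" and fix_w: "\<forall>i<length \<sigma>. \<sigma> ! w i = \<sigma> ! i"
  shows "act_sign w \<sigma> = sign (perm_restrict w (neg_pos \<sigma>))"
proof -
  define A where "A = neg_pos \<sigma>"
  define xs where "xs = filter (\<lambda>i. \<sigma> ! i = -1) [0..<length \<sigma>]"
  define k where "k = length xs"
  have xs: "sorted xs" "distinct xs" "set xs = A"
    by (auto simp: xs_def A_def neg_pos_def sorted_wrt_filter)
  have finA: "finite A" by (simp flip: xs(3))
  have wA: "w i \<in> A" if "i \<in> A" for i
    using that fix_w permutes_in_image[OF w, of i] by (auto simp: A_def neg_pos_def)
  define v where "v = inv (perm_restrict w A)"
  have r: "perm_restrict w A permutes A"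
    by (rule perm_restrict_permutes[OF permutes_inj[OF w] finA wA])
  have v: "v permutes A" unfolding v_def by (rule permutes_inv[OF r])
  have wv: "w (v a) = a" if "a \<in> A" for a
    using permutes_inverses(1)[OF r, of a] permutes_in_image[OF v, of a] that
    by (simp add: v_def perm_restrict_simps)
  have bij: "bij_betw ((!) xs) {..<k} A"
    using bij_betw_nth[OF xs(2), of "{..<k}" A] xs(3) by (simp add: k_def)
  define f where "f = inv_into {..<k} ((!) xs)"
  have f: "bij_betw f A {..<k}" unfolding f_def by (rule bij_betw_inv_into[OF bij])
  define \<pi> where "\<pi> = map_permutation A f v"
  have \<pi>: "\<pi> permutes {..<k}" unfolding \<pi>_def by (rule map_permutation_permutes[OF f v])
  have nth_\<pi>: "xs ! \<pi> i = v (xs ! i)" if "i < k" for i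
  proof -
    have "xs ! i \<in> A" using that xs(3) by (auto simp: k_def)
    moreover have "f (xs ! i) = i" using bij that by (simp add: f_def bij_betw_def inv_into_f_f)
    ultimately have "\<pi> i = f (v (xs ! i))"
      using map_permutation_apply[OF bij_betw_imp_inj_on[OF f], of "xs ! i" v] by (simp add: \<pi>_def)
    moreover have "v (xs ! i) \<in> A" using permutes_in_image[OF v] \<open>xs ! i \<in> A\<close> by simp
    ultimately show ?thesis using bij by (simp add: f_def bij_betw_def f_inv_into_f)
  qed
  let ?ys = "map w xs"
  have \<pi>': "\<pi> permutes {..<length ?ys}" using \<pi> by (simp add: k_def)
  have sorted: "permute_list \<pi> ?ys = xs"
  proof (rule nth_equalityI)
    fix i assume "i < length (permute_list \<pi> ?ys)"
    then have i: "i < k" by (simp add: k_def)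
    then have "\<pi> i < k" using permutes_in_image[OF \<pi>, of i] by simp
    moreover have "xs ! i \<in> A" using i xs(3) by (auto simp: k_def)
    ultimately show "permute_list \<pi> ?ys ! i = xs ! i"
      using i nth_\<pi>[OF i] wv by (simp add: permute_list_nth[OF \<pi>'] k_def)
  qed simp
  \<comment> \<open>The images under w are distinct, so only one permutation sorts them.\<close>
  have "(THE \<pi>. \<pi> permutes {..<length ?ys} \<and> sorted (permute_list \<pi> ?ys)) = \<pi>"
  proof (rule the_equality)
    show "\<pi> permutes {..<length ?ys} \<and> sorted (permute_list \<pi> ?ys)" using \<pi>' sorted xs(1) by simp
  next
    fix \<rho> assume \<rho>: "\<rho> permutes {..<length ?ys} \<and> sorted (permute_list \<rho> ?ys)"
    have "mset (permute_list \<rho> ?ys) = mset (permute_list \<pi> ?ys)" using \<rho> \<pi>' by simp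
    then have "permute_list \<rho> ?ys = permute_list \<pi> ?ys"
      using \<rho> sorted xs(1) by (metis properties_for_sort)
    then have eq: "?ys ! \<rho> i = ?ys ! \<pi> i" if "i < length ?ys" for i
      using that \<rho> \<pi>' by (metis permute_list_nth)
    have d: "distinct ?ys" using xs(2) permutes_inj[OF w] by (simp add: distinct_map inj_on_def inj_def)
    have "\<rho> i = \<pi> i" if "i < length ?ys" for i
      using eq[OF that] d permutes_in_image[of \<rho> "{..<length ?ys}" i] permutes_in_image[OF \<pi>', of i] \<rho> that
      by (simp add: nth_eq_iff_index_eq del: length_map nth_map)
    moreover have "\<rho> i = \<pi> i" if "\<not> i < length ?ys" for i
      using that \<rho> \<pi>' by (simp add: permutes_def)
    ultimately show "\<rho> = \<pi>" by blast
  qed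
  then have "act_sign w \<sigma> = sign \<pi>" by (simp add: act_sign_def sorting_sign_def flip: xs_def)
  also have "\<dots> = sign v"
    unfolding \<pi>_def by (rule sign_map_permutation[OF bij_betw_imp_inj_on[OF f] v finA])
  also have "\<dots> = sign (perm_restrict w A)"
    unfolding v_def by (rule sign_inverse) (use r finA in \<open>auto simp: permutation_permutes\<close>)
  finally show ?thesis by (simp add: A_def)
qed

section \<open>Traces and their invariance under conjugation\<close>

lemma finite_OShPf: "finite (OShPf n)"
proof (rule finite_subset)
  show "OShPf n \<subseteq> Pf n \<times> {\<sigma>. set \<sigma> \<subseteq> {-1, 1} \<and> length \<sigma> = n} \<times> Pow ({1..n} \<times> {1..n})"
  proof
    fix t assume "t \<in> OShPf n"
    then obtain p \<sigma> \<tau> where t: "t = (p, \<sigma>, \<tau>)" "(p, \<sigma>, \<tau>) \<in> OShPf n" by (cases t) auto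
    then have ok: "arcs_ok {-1, 1} (set p) (bar p \<sigma>) \<tau>" and sub: "set p \<subseteq> {1..n}"
      by (auto simp: OShPf_iff Pf_iff_luk arc_structs_def)
    have "\<tau> \<subseteq> {1..n} \<times> {1..n}"
      by (rule subrelI) (use arcs_okD(5,6)[OF ok] sub in blast)
    with t show "t \<in> Pf n \<times> {\<sigma>. set \<sigma> \<subseteq> {-1, 1} \<and> length \<sigma> = n} \<times> Pow ({1..n} \<times> {1..n})"
      by (auto simp: OShPf_iff)
  qed
  show "finite (Pf n \<times> {\<sigma> :: int list. set \<sigma> \<subseteq> {-1, 1} \<and> length \<sigma> = n} \<times> Pow ({1..n} \<times> {1..n}))"
    by (intro finite_cartesian_product finite_Pf finite_lists_length_eq) auto
qed

text \<open>Each basis vector goes to a signed basis vector, so only the fixed triples meet the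
  diagonal; on these \<open>act_sign_eq\<close> evaluates the sign.\<close>

lemma OShPf_character_eq:
  assumes w: "w permutes {..<n}"
  shows "OShPf_character n w = (\<Sum>(p, \<sigma>, \<tau>) \<in> OShPf n.
    if tuple_act w p = p \<and> tuple_act w \<sigma> = \<sigma> then of_int (sign (perm_restrict w (neg_pos \<sigma>))) else 0)"
  unfolding OShPf_character_def trace_on_def
proof (rule sum.cong)
  fix t assume "t \<in> OShPf n"
  then obtain p \<sigma> \<tau> where t: "t = (p, \<sigma>, \<tau>)" and len: "length \<sigma> = n"
    by (cases t) (auto simp: OShPf_iff)
  have "shpf_act w (Poly_Mapping.single t 1) = basis_act w t"
    by (simp add: shpf_act_def) (rule poly_mapping_eqI, simp add: map.rep_eq when_def)
  moreover have "act_sign w \<sigma> = sign (perm_restrict w (neg_pos \<sigma>))" if "tuple_act w \<sigma> = \<sigma>"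
    using act_sign_eq[of w \<sigma>] tuple_act_eq_iff[of w \<sigma>] that len w by simp
  ultimately show "Poly_Mapping.lookup (shpf_act w (Poly_Mapping.single t 1)) t
      = (case t of (p, \<sigma>, \<tau>) \<Rightarrow> if tuple_act w p = p \<and> tuple_act w \<sigma> = \<sigma>
          then of_int (sign (perm_restrict w (neg_pos \<sigma>))) else 0)"
    by (auto simp: t lookup_single when_def)
qed simp

text \<open>Shows that \<open>bar\<close> depends only on the multiset of (value, sign) pairs, which
  makes it invariant under simultaneous rearrangement.\<close>

lemma bar_eq_prod_mset:
  assumes "length \<sigma> = length p"
  shows "bar p \<sigma> k = (if k \<in> set p then \<Prod>x\<in>#filter_mset (\<lambda>x. fst x = k) (mset (zip p \<sigma>)). snd x else 0)"
proof -
  have "mset (zip p \<sigma>) = image_mset (\<lambda>i. (p ! i, \<sigma> ! i)) (mset_set {..<length p})"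
  proof -
    have "zip p \<sigma> = map (\<lambda>i. (p ! i, \<sigma> ! i)) [0..<length p]"
      using assms by (intro nth_equalityI) auto
    then show ?thesis by (simp add: atLeast0LessThan)
  qed
  then have "filter_mset (\<lambda>x. fst x = k) (mset (zip p \<sigma>))
      = image_mset (\<lambda>i. (p ! i, \<sigma> ! i)) (mset_set {i \<in> {..<length p}. p ! i = k})"
    by (simp add: filter_mset_image_mset filter_mset_mset_set)
  then have "(\<Prod>x\<in>#filter_mset (\<lambda>x. fst x = k) (mset (zip p \<sigma>)). snd x) = (\<Prod>i\<in>{i. i < length p \<and> p ! i = k}. \<sigma> ! i)"
    by (simp add: image_mset.compositionality o_def prod_unfold_prod_mset lessThan_def)
  then show ?thesis by (simp add: bar_def count_list_mset count_greater_zero_iff)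
qed

lemma tuple_act_mset:
  assumes "u permutes {..<length a}"
  shows "mset (tuple_act u a) = mset a" "set (tuple_act u a) = set a" "length (tuple_act u a) = length a"
  using permutes_inv[OF assms] by (simp_all add: tuple_act_def)

lemma bar_tuple_act:
  assumes "u permutes {..<length p}" "length \<sigma> = length p"
  shows "bar (tuple_act u p) (tuple_act u \<sigma>) = bar p \<sigma>"
proof
  fix k
  have iu: "inv u permutes {..<length p}" using assms(1) by (rule permutes_inv)
  have "zip (tuple_act u p) (tuple_act u \<sigma>) = permute_list (inv u) (zip p \<sigma>)"
    unfolding tuple_act_def by (rule permute_list_zip[symmetric, OF iu]) (use assms in auto)
  then have "mset (zip (tuple_act u p) (tuple_act u \<sigma>)) = mset (zip p \<sigma>)"
    using iu assms(2) by simp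
  then show "bar (tuple_act u p) (tuple_act u \<sigma>) k = bar p \<sigma> k"
    using assms by (subst (1 2) bar_eq_prod_mset) (simp_all add: tuple_act_mset)
qed

lemma sort_mset_cong: "mset p = mset p' \<Longrightarrow> sort p = sort p'"
  by (rule properties_for_sort) simp_all

lemma Pf_mset_cong: "mset p = mset p' \<Longrightarrow> p \<in> Pf n \<longleftrightarrow> p' \<in> Pf n"
  by (metis Pf_sort sort_mset_cong)

lemma shape_mset_cong: "mset p = mset p' \<Longrightarrow> shape p = shape p'"
  by (metis shape_sort sort_mset_cong)

lemma OShPf_tuple_act:
  assumes u: "u permutes {..<n}" and t: "(p, \<sigma>, \<tau>) \<in> OShPf n"
  shows "(tuple_act u p, tuple_act u \<sigma>, \<tau>) \<in> OShPf n"
proof -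
  have len: "length p = n" "length \<sigma> = n" using t by (auto simp: OShPf_iff Pf_def)
  have "mset (tuple_act u p) = mset p" using tuple_act_mset[of u p] u len by simp
  then show ?thesis
    using t u len tuple_act_mset[of u p] tuple_act_mset[of u \<sigma>] bar_tuple_act[of u p \<sigma>]
      Pf_mset_cong shape_mset_cong unfolding OShPf_iff by metis
qed

lemma tuple_act_compose:
  assumes "u permutes {..<length a}" "v permutes {..<length a}"
  shows "tuple_act (u \<circ> v) a = tuple_act u (tuple_act v a)"
proof -
  have "inv (u \<circ> v) = inv v \<circ> inv u" using assms by (simp add: o_inv_distrib permutes_bij)
  then show ?thesis unfolding tuple_act_def
    using permute_list_compose[OF permutes_inv[OF assms(1)], of "inv v"] by simp
qed

lemma tuple_act_id [simp]: "tuple_act id a = a"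
  by (simp add: tuple_act_def)

lemma neg_pos_tuple_act:
  assumes u: "u permutes {..<length \<sigma>}"
  shows "neg_pos (tuple_act u \<sigma>) = u ` neg_pos \<sigma>"
proof (intro equalityI subsetI)
  fix j assume j: "j \<in> neg_pos (tuple_act u \<sigma>)"
  then have "j < length \<sigma>" "tuple_act u \<sigma> ! j = -1" by (auto simp: neg_pos_def tuple_act_mset[OF u])
  moreover have "inv u j < length \<sigma>" using permutes_in_image[OF permutes_inv[OF u], of j] calculation by simp
  moreover have "u (inv u j) = j" by (rule permutes_inverses[OF u])
  ultimately show "j \<in> u ` neg_pos \<sigma>"
    using tuple_act_nth[OF u, of "inv u j"] by (intro image_eqI[of _ _ "inv u j"]) (auto simp: neg_pos_def)
next
  fix j assume "j \<in> u ` neg_pos \<sigma>"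
  then obtain i where "j = u i" "i < length \<sigma>" "\<sigma> ! i = -1" by (auto simp: neg_pos_def)
  then show "j \<in> neg_pos (tuple_act u \<sigma>)"
    using tuple_act_nth[OF u, of i] permutes_in_image[OF u, of i]
    by (simp add: neg_pos_def tuple_act_mset[OF u])
qed

text \<open>Acting by u carries the triples fixed by w to those fixed by its conjugate and moves the
  negative positions along, so the restricted permutations are conjugate and have equal
  sign.\<close>

lemma OShPf_character_conj:
  assumes u: "u permutes {..<n}" and w: "w permutes {..<n}"
  shows "OShPf_character n (u \<circ> w \<circ> inv u) = OShPf_character n w"
proof -
  have iu: "inv u permutes {..<n}" using u by (rule permutes_inv)
  have c: "u \<circ> w \<circ> inv u permutes {..<n}" by (intro permutes_compose u w iu)
  let ?F = "\<lambda>w (p, \<sigma>, \<tau>). if tuple_act w p = p \<and> tuple_act w \<sigma> = \<sigma>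
    then of_int (sign (perm_restrict w (neg_pos \<sigma>))) else (0 :: complex)"
  have canc: "tuple_act (inv u) (tuple_act u a) = a" "tuple_act u (tuple_act (inv u) a) = a"
    if "length a = n" for a :: "'x list"
    using tuple_act_compose[of "inv u" a u] tuple_act_compose[of u a "inv u"] that u iu
    by (simp_all add: permutes_inv_o[OF u])
  have conj_act: "tuple_act (u \<circ> w \<circ> inv u) (tuple_act u a) = tuple_act u (tuple_act w a)"
    if "length a = n" for a :: "'x list"
  proof -
    have "tuple_act (u \<circ> w \<circ> inv u) (tuple_act u a) = tuple_act u (tuple_act w (tuple_act (inv u) (tuple_act u a)))"
      using tuple_act_compose[of "u \<circ> w" "tuple_act u a" "inv u"]
        tuple_act_compose[of u "tuple_act (inv u) (tuple_act u a)" w]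
        that u iu w permutes_compose[OF w u] by (simp add: tuple_act_mset)
    then show ?thesis by (simp add: canc that)
  qed
  have fix_iff: "tuple_act (u \<circ> w \<circ> inv u) (tuple_act u a) = tuple_act u a \<longleftrightarrow> tuple_act w a = a"
    if "length a = n" for a :: "'x list"
    using conj_act[OF that] canc(1)[of a] canc(1)[of "tuple_act w a"] that w by (metis tuple_act_mset(3))
  have "(\<Sum>t\<in>OShPf n. ?F w t) = (\<Sum>t\<in>OShPf n. ?F (u \<circ> w \<circ> inv u) t)"
  proof (rule sum.reindex_bij_witness[of _ "\<lambda>(p, \<sigma>, \<tau>). (tuple_act (inv u) p, tuple_act (inv u) \<sigma>, \<tau>)"
        "\<lambda>(p, \<sigma>, \<tau>). (tuple_act u p, tuple_act u \<sigma>, \<tau>)"])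
    fix t assume "t \<in> OShPf n"
    then obtain p \<sigma> \<tau> where t: "t = (p, \<sigma>, \<tau>)" "(p, \<sigma>, \<tau>) \<in> OShPf n" by (cases t) auto
    then have len: "length p = n" "length \<sigma> = n" by (auto simp: OShPf_iff Pf_def)
    show "(case (case t of (p, \<sigma>, \<tau>) \<Rightarrow> (tuple_act u p, tuple_act u \<sigma>, \<tau>)) of
        (p, \<sigma>, \<tau>) \<Rightarrow> (tuple_act (inv u) p, tuple_act (inv u) \<sigma>, \<tau>)) = t"
      by (simp add: t canc len)
    show "(case (case t of (p, \<sigma>, \<tau>) \<Rightarrow> (tuple_act (inv u) p, tuple_act (inv u) \<sigma>, \<tau>)) of
        (p, \<sigma>, \<tau>) \<Rightarrow> (tuple_act u p, tuple_act u \<sigma>, \<tau>)) = t"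
      by (simp add: t canc len)
    show "(case t of (p, \<sigma>, \<tau>) \<Rightarrow> (tuple_act u p, tuple_act u \<sigma>, \<tau>)) \<in> OShPf n"
      using OShPf_tuple_act[OF u t(2)] by (simp add: t)
    show "(case t of (p, \<sigma>, \<tau>) \<Rightarrow> (tuple_act (inv u) p, tuple_act (inv u) \<sigma>, \<tau>)) \<in> OShPf n"
      using OShPf_tuple_act[OF iu t(2)] by (simp add: t)
    have "sign (perm_restrict (u \<circ> w \<circ> inv u) (neg_pos (tuple_act u \<sigma>))) = sign (perm_restrict w (neg_pos \<sigma>))"
      if fw: "tuple_act w \<sigma> = \<sigma>"
    proof -
      have fw': "\<forall>i<length \<sigma>. \<sigma> ! w i = \<sigma> ! i" using fw tuple_act_eq_iff[of w \<sigma>] w len by simp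
      have r: "perm_restrict w (neg_pos \<sigma>) permutes neg_pos \<sigma>"
        by (rule perm_restrict_permutes[OF permutes_inj[OF w]])
          (use fw' permutes_in_image[OF w] len in \<open>auto simp: neg_pos_def\<close>)
      have fin: "finite (neg_pos \<sigma>)" by (simp add: neg_pos_def)
      have mem: "inv u x \<in> A \<longleftrightarrow> x \<in> u ` A" for x A
        using permutes_inverses[OF u] by (metis image_iff)
      have "perm_restrict (u \<circ> w \<circ> inv u) (u ` neg_pos \<sigma>) = u \<circ> perm_restrict w (neg_pos \<sigma>) \<circ> inv u"
        using permutes_inverses[OF u] by (auto simp: perm_restrict_def fun_eq_iff mem)
      moreover have pu: "permutation u" "permutation (inv u)" using u iu by (auto simp: permutation_permutes)
      moreover have "permutation (perm_restrict w (neg_pos \<sigma>))" using r fin by (auto simp: permutation_permutes)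
      ultimately show ?thesis
        using neg_pos_tuple_act[of u \<sigma>] u len
        by (simp add: sign_compose permutation_compose sign_inverse)
    qed
    then show "(case (case t of (p, \<sigma>, \<tau>) \<Rightarrow> (tuple_act u p, tuple_act u \<sigma>, \<tau>)) of
        (p, \<sigma>, \<tau>) \<Rightarrow> if tuple_act (u \<circ> w \<circ> inv u) p = p \<and> tuple_act (u \<circ> w \<circ> inv u) \<sigma> = \<sigma>
          then of_int (sign (perm_restrict (u \<circ> w \<circ> inv u) (neg_pos \<sigma>))) else (0 :: complex)) = ?F w t"
      by (auto simp: t fix_iff len)
  qed
  then show ?thesis by (simp add: OShPf_character_eq w c)
qed

section \<open>Coefficients of products and stabilizers\<close>

text \<open>If each factor enumerates a weighted set, the product enumerates choices of one element
  from each, with added weights. The sets themselves may be infinite; only the fibres over each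
  weight must be finite.\<close>

lemma mcoeff_prod_card:
  fixes F :: "'k \<Rightarrow> mseries" and Y :: "'k \<Rightarrow> 'y set" and wt :: "'k \<Rightarrow> 'y \<Rightarrow> nat multiset"
  assumes "finite K"
    and "\<And>k a. k \<in> K \<Longrightarrow> finite {y \<in> Y k. wt k y = a}"
    and "\<And>k a. k \<in> K \<Longrightarrow> mcoeff (F k) a = of_nat (card {y \<in> Y k. wt k y = a})"
  shows "finite {g \<in> PiE K Y. (\<Sum>k\<in>K. wt k (g k)) = m} \<and>
    mcoeff (\<Prod>k\<in>K. F k) m = of_nat (card {g \<in> PiE K Y. (\<Sum>k\<in>K. wt k (g k)) = m})"
  using assms
proof (induction K arbitrary: m)
  case empty
  have "{g \<in> PiE {} Y. (\<Sum>k\<in>{}. wt k (g k)) = m} = (if m = {#} then {\<lambda>_. undefined} else {})" by auto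
  then show ?case by (simp add: mcoeff_1)
next
  case (insert x K)
  let ?G = "\<lambda>m. {g \<in> PiE K Y. (\<Sum>k\<in>K. wt k (g k)) = m}"
  let ?G' = "{g \<in> PiE (insert x K) Y. (\<Sum>k\<in>insert x K. wt k (g k)) = m}"
  let ?Y = "\<lambda>a. {y \<in> Y x. wt x y = a}"
  let ?D = "SIGMA ab:msplits m. ?Y (fst ab) \<times> ?G (snd ab)"
  have IH: "finite (?G b)" "mcoeff (\<Prod>k\<in>K. F k) b = of_nat (card (?G b))" for b
    using insert.IH[of b] insert.prems by auto
  have wt_upd: "(\<Sum>k\<in>K. wt k ((g(x := y)) k)) = (\<Sum>k\<in>K. wt k (g k))" for g y
    by (rule sum.cong) (use insert.hyps(2) in auto)
  have bij: "bij_betw (\<lambda>(ab, y, g). g(x := y)) ?D ?G'"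
  proof (rule bij_betw_byWitness[where f' = "\<lambda>g. ((wt x (g x), \<Sum>k\<in>K. wt k (g k)), g x, g(x := undefined))"])
    show "\<forall>t\<in>?D. (\<lambda>g. ((wt x (g x), \<Sum>k\<in>K. wt k (g k)), g x, g(x := undefined)))
        ((\<lambda>(ab, y, g). g(x := y)) t) = t"
    proof
      fix t assume "t \<in> ?D"
      then obtain a b y g where t: "t = ((a, b), y, g)" and g: "y \<in> Y x" "wt x y = a" "g \<in> PiE K Y"
        "(\<Sum>k\<in>K. wt k (g k)) = b" by auto
      have "g x = undefined" using g(3) insert.hyps(2) by (auto simp: PiE_def extensional_def)
      then have "(g(x := y))(x := undefined) = g" by auto
      moreover have "(\<Sum>k\<in>K. wt k ((g(x := y)) k)) = b" using wt_upd[of g y] g(4) by simp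
      ultimately show "(\<lambda>g. ((wt x (g x), \<Sum>k\<in>K. wt k (g k)), g x, g(x := undefined)))
          ((\<lambda>(ab, y, g). g(x := y)) t) = t"
        unfolding t using g(2) by (simp del: fun_upd_apply) simp
    qed
    show "(\<lambda>(ab, y, g). g(x := y)) ` ?D \<subseteq> ?G'"
    proof (rule image_subsetI)
      fix t assume "t \<in> ?D"
      then obtain a b y g where t: "t = ((a, b), y, g)" and m: "a + b = m" and g: "y \<in> Y x" "wt x y = a" "g \<in> PiE K Y"
        "(\<Sum>k\<in>K. wt k (g k)) = b" by auto
      have "g(x := y) \<in> PiE (insert x K) Y" using g by (auto simp: PiE_def Pi_def extensional_def)
      moreover have "(\<Sum>k\<in>insert x K. wt k ((g(x := y)) k)) = m"
        using insert.hyps m g wt_upd[of g y] by simp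
      ultimately show "(\<lambda>(ab, y, g). g(x := y)) t \<in> ?G'" unfolding t by (simp del: fun_upd_apply)
    qed
    show "(\<lambda>g. ((wt x (g x), \<Sum>k\<in>K. wt k (g k)), g x, g(x := undefined))) ` ?G' \<subseteq> ?D"
    proof (rule image_subsetI)
      fix g assume g: "g \<in> ?G'"
      have "g(x := undefined) \<in> PiE K Y" using g insert.hyps(2) by (auto simp: PiE_def Pi_def extensional_def)
      moreover have "g x \<in> Y x" using g by auto
      ultimately show "((wt x (g x), \<Sum>k\<in>K. wt k (g k)), g x, g(x := undefined)) \<in> ?D"
        using g insert.hyps wt_upd[of g undefined] by (simp del: fun_upd_apply)
    qed
  qed auto
  have finD: "finite ?D" using IH(1) insert.prems(1)[of x] by (intro finite_SigmaI finite_cartesian_product) auto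
  have fin': "finite ?G'" using bij_betw_finite[OF bij] finD by simp
  have "mcoeff (\<Prod>k\<in>insert x K. F k) m = (\<Sum>(a, b)\<in>msplits m. mcoeff (F x) a * mcoeff (\<Prod>k\<in>K. F k) b)"
    using insert.hyps by (simp add: mcoeff_mult)
  also have "\<dots> = (\<Sum>ab\<in>msplits m. of_nat (card (?Y (fst ab) \<times> ?G (snd ab))))"
    by (rule sum.cong) (auto simp: insert.prems IH card_cartesian_product)
  also have "\<dots> = of_nat (card ?D)"
    by (subst card_SigmaI) (use IH(1) insert.prems(1)[of x] in auto)
  also have "card ?D = card ?G'" by (rule bij_betw_same_card[OF bij])
  finally show ?case using fin' by blast
qed

text \<open>Expanding the product of power sums picks one variable per cycle. Writing this variable
  at all positions of the cycle gives a word constant on cycles, which is the same as a word fixed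
  by w.\<close>

lemma mcoeff_sym_p_part_cycle_type:
  assumes w: "w permutes {..<n}"
  shows "mcoeff (sym_p_part (cycle_type n w)) m
    = of_nat (card {f. length f = n \<and> mset f = m \<and> (\<forall>i<n. f ! w i = f ! i)})"
proof -
  note pw = permutes_lessThan_permutation[OF w]
  let ?X = "orbit w ` {..<n}"
  let ?G = "{g \<in> PiE ?X (\<lambda>_. UNIV). (\<Sum>C\<in>?X. replicate_mset (card C) (g C)) = m}"
  let ?F = "{f. length f = n \<and> mset f = m \<and> (\<forall>i<n. f ! w i = f ! i)}"
  let ?h = "\<lambda>g. map (\<lambda>i. g (orbit w i)) [0..<n]"
  have pos: "card C > 0" if "C \<in> ?X" for C
    using that finite_orbit[OF permutation_self_in_orbit[OF pw]] orbit_nonempty[of w] by (auto simp: card_gt_0_iff)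
  have block: "{i \<in> {..<n}. orbit w i = C} = C" if "C \<in> ?X" for C
    using that permutes_orbit_subset[OF w] permutation_self_in_orbit[OF pw] orbit_eq_of_mem[OF pw] by fastforce
  have "sym_p_part (cycle_type n w) = (\<Prod>C\<in>?X. sym_p (card C))"
    by (simp add: sym_p_part_def cycle_type_def image_mset.compositionality o_def prod_unfold_prod_mset)
  moreover have "mcoeff (\<Prod>C\<in>?X. sym_p (card C)) m = of_nat (card ?G)"
  proof (rule mcoeff_prod_card[THEN conjunct2])
    fix C and a :: "nat multiset" assume C: "C \<in> ?X"
    let ?S = "{i \<in> UNIV. replicate_mset (card C) i = a}"
    \<comment> \<open>Cycles are nonempty, so the repeated variable can be read off.\<close>
    have uniq: "i = j" if "replicate_mset (card C) i = replicate_mset (card C) j" for i j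
      using arg_cong[OF that, of set_mset] pos[OF C] by simp
    have "finite ?S \<and> mcoeff (sym_p (card C)) a = of_nat (card ?S)"
    proof (cases "\<exists>j. a = replicate_mset (card C) j")
      case True
      then obtain j where "a = replicate_mset (card C) j" by blast
      then have "?S = {j}" by (auto dest: uniq)
      then show ?thesis using True by (simp add: sym_p.rep_eq)
    next
      case False
      then have "?S = {}" by auto
      then show ?thesis using False by (simp only: sym_p.rep_eq if_False) simp
    qed
    then show "finite ?S" "mcoeff (sym_p (card C)) a = of_nat (card ?S)" by blast+
  qed simp
  ultimately have "mcoeff (sym_p_part (cycle_type n w)) m = of_nat (card ?G)" by simp
  also have "card ?G = card ?F"
  proof (rule bij_betw_same_card, rule bij_betw_imageI)
    show "inj_on ?h ?G"
    proof (rule inj_onI)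
      fix g g' assume g: "g \<in> ?G" "g' \<in> ?G" and eq: "?h g = ?h g'"
      have "g C = g' C" if C: "C \<in> ?X" for C
        using C eq by auto
      moreover have "g C = g' C" if "C \<notin> ?X" for C
        using that g by (auto simp: PiE_def extensional_def)
      ultimately show "g = g'" by (intro ext) (rule case_split)
    qed
    have mset_h: "mset (?h g) = (\<Sum>C\<in>?X. replicate_mset (card C) (g C))" for g :: "nat set \<Rightarrow> nat"
    proof -
      have const_sum: "(\<Sum>i\<in>S. {#y#}) = replicate_mset (card S) y" for S :: "nat set" and y :: nat
        by (induction S rule: infinite_finite_induct) auto
      have "mset (map (\<lambda>i. g (orbit w i)) [0..<k]) = (\<Sum>i<k. {#g (orbit w i)#})" for k
        by (induction k) auto
      then have "mset (?h g) = (\<Sum>i<n. {#g (orbit w i)#})" .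
      also have "\<dots> = (\<Sum>C\<in>?X. \<Sum>i\<in>{i \<in> {..<n}. orbit w i = C}. {#g (orbit w i)#})"
        by (rule sum.image_gen) simp
      also have "\<dots> = (\<Sum>C\<in>?X. replicate_mset (card C) (g C))"
      proof (rule sum.cong)
        fix C assume C: "C \<in> ?X"
        have "(\<Sum>i\<in>{i \<in> {..<n}. orbit w i = C}. {#g (orbit w i)#}) = (\<Sum>i\<in>{i \<in> {..<n}. orbit w i = C}. {#g C#})"
          by (rule sum.cong) auto
        also have "\<dots> = replicate_mset (card C) (g C)"
          unfolding block[OF C] by (rule const_sum)
        finally show "(\<Sum>i\<in>{i \<in> {..<n}. orbit w i = C}. {#g (orbit w i)#}) = replicate_mset (card C) (g C)" .
      qed simp
      finally show ?thesis .
    qed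
    show "?h ` ?G = ?F"
    proof (intro equalityI subsetI)
      fix f assume "f \<in> ?h ` ?G"
      then obtain g where g: "g \<in> ?G" "f = ?h g" by blast
      have "f ! w i = f ! i" if "i < n" for i
        using that permutes_in_image[OF w, of i] by (simp add: g(2) permutation_orbit_step[OF pw])
      then show "f \<in> ?F" using g mset_h[of g] by simp
    next
      fix f assume f: "f \<in> ?F"
      \<comment> \<open>Which position of the cycle is chosen is immaterial, as f is constant
        there.\<close>
      define g where "g = restrict (\<lambda>C. f ! (SOME i. i \<in> C)) ?X"
      have const: "j < n \<and> f ! j = f ! i" if "i < n" "j \<in> orbit w i" for i j
        using that(2)
      proof induction
        case base
        then show ?case using f that(1) permutes_in_image[OF w, of i] by simp
      next
        case (step y)
        then show ?case using f permutes_in_image[OF w, of y] by simp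
      qed
      have "g (orbit w i) = f ! i" if "i < n" for i
      proof -
        have "(SOME j. j \<in> orbit w i) \<in> orbit w i" using orbit_nonempty[of w i] by (metis some_in_eq)
        then show ?thesis using const[OF that] that by (simp add: g_def)
      qed
      then have h: "?h g = f" using f by (intro nth_equalityI) auto
      then have "g \<in> ?G" using f mset_h[of g] by (simp add: g_def)
      with h show "f \<in> ?h ` ?G" by blast
    qed
  qed
  finally show ?thesis .
qed

definition stabilizer :: "'c list \<Rightarrow> (nat \<Rightarrow> nat) set" where
  "stabilizer L = {w. w permutes {..<length L} \<and> (\<forall>i<length L. L ! w i = L ! i)}"

lemma count_mset_eq_card: "count (mset L) x = card {i. i < length L \<and> L ! i = x}"
  by (simp add: count_mset count_list_eq_length_filter length_filter_conv_card eq_commute[of x])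

text \<open>If no label in N repeats, stabilizing the word forces all its positions to stay fixed,
  and every sign is 1. Otherwise composing with the swap of two equally labelled positions is a
  sign-reversing involution of the stabilizer.\<close>

lemma sum_sign_stabilizer:
  "(\<Sum>w\<in>stabilizer L. sign (perm_restrict w {i. i < length L \<and> N (L ! i)}))
    = (if \<forall>x. N x \<longrightarrow> count (mset L) x \<le> 1 then int (card (stabilizer L)) else 0)"
proof (cases "\<forall>x. N x \<longrightarrow> count (mset L) x \<le> 1")
  case True
  have "perm_restrict w {i. i < length L \<and> N (L ! i)} = id" if w: "w \<in> stabilizer L" for w
  proof
    fix i
    show "perm_restrict w {i. i < length L \<and> N (L ! i)} i = id i"
    proof (cases "i < length L \<and> N (L ! i)")
      case i: True
      let ?S = "{j. j < length L \<and> L ! j = L ! i}"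
      have "card ?S \<le> Suc 0" using True i count_mset_eq_card[of L "L ! i"] by auto
      moreover have "i \<in> ?S" using i by simp
      moreover have "w i \<in> ?S"
        using i w permutes_in_image[of w "{..<length L}" i] by (auto simp: stabilizer_def)
      ultimately have "w i = i" using card_le_Suc0_iff_eq[of ?S] by auto
      then show ?thesis by (simp add: perm_restrict_def)
    qed (auto simp: perm_restrict_def)
  qed
  with True show ?thesis by simp
next
  case False
  then obtain x where x: "N x" "count (mset L) x > 1" by auto
  let ?S = "{j. j < length L \<and> L ! j = x}"
  have "\<not> card ?S \<le> Suc 0" using x count_mset_eq_card[of L x] by simp
  then obtain i j where ij: "i \<in> ?S" "j \<in> ?S" "i \<noteq> j" using card_le_Suc0_iff_eq[of ?S] by auto
  define t where "t = transpose i j"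
  let ?A = "{i. i < length L \<and> N (L ! i)}"
  have t: "t permutes {..<length L}" unfolding t_def by (rule permutes_swap_id) (use ij in auto)
  have Lt: "L ! t k = L ! k" for k using ij by (auto simp: t_def transpose_def)
  have tA: "t k \<in> ?A \<longleftrightarrow> k \<in> ?A" for k
    using Lt[of k] permutes_in_image[OF t, of k] by simp
  have tt: "t \<circ> t = id" by (simp add: t_def)
  have stab: "w \<circ> t \<in> stabilizer L" if "w \<in> stabilizer L" for w
    using that t Lt permutes_in_image[OF t] by (auto simp: stabilizer_def intro!: permutes_compose)
  have sgn: "sign (perm_restrict (w \<circ> t) ?A) = - sign (perm_restrict w ?A)" if w: "w \<in> stabilizer L" for w
  proof -
    have ijA: "i \<in> ?A" "j \<in> ?A" using ij x by auto
    have "perm_restrict (w \<circ> t) ?A = perm_restrict w ?A \<circ> t"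
    proof
      fix k show "perm_restrict (w \<circ> t) ?A k = (perm_restrict w ?A \<circ> t) k"
        using tA[of k] ijA by (auto simp: perm_restrict_def t_def transpose_def)
    qed
    moreover have "perm_restrict w ?A permutes ?A"
    proof (rule inj_imp_permutes)
      show "inj_on (perm_restrict w ?A) ?A"
        using w permutes_inj[of w] by (auto simp: stabilizer_def perm_restrict_def inj_on_def dest: injD)
      show "perm_restrict w ?A k \<in> ?A" if "k \<in> ?A" for k
        using that w permutes_in_image[of w "{..<length L}" k] by (auto simp: stabilizer_def perm_restrict_def)
    qed (auto simp: perm_restrict_def)
    then have "permutation (perm_restrict w ?A)" by (auto simp: permutation_permutes)
    moreover have "permutation t" using t by (auto simp: permutation_permutes)
    moreover have "sign t = -1" using ij by (simp add: t_def sign_swap_id)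
    ultimately show ?thesis by (simp add: sign_compose)
  qed
  have "(\<Sum>w\<in>stabilizer L. sign (perm_restrict w ?A)) = (\<Sum>w\<in>stabilizer L. - sign (perm_restrict w ?A))"
    by (rule sum.reindex_bij_witness[of _ "\<lambda>w. w \<circ> t" "\<lambda>w. w \<circ> t"])
      (auto simp: stab sgn comp_assoc tt)
  then have "(\<Sum>w\<in>stabilizer L. sign (perm_restrict w ?A)) = 0" by (simp add: sum_negf)
  then show ?thesis by (simp only: if_not_P[OF False])
qed

text \<open>The words with letter multiset M form a single orbit under rearrangement; adding the
  stabilizer orders over an orbit yields the group order.\<close>

lemma sum_card_stabilizer: "(\<Sum>L | mset L = M. card (stabilizer L)) = fact (size M)"
proof -
  define n where "n = size M"
  let ?O = "{L. mset L = M}"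
  \<comment> \<open>Words of other lengths are left alone, which makes this an action on all lists,
    as \<open>orbit_stabilizer\<close> requires.\<close>
  define act where "act u L = (if length L = n then tuple_act u L else L)" for u and L :: "'a list"
  obtain L0 where L0: "mset L0 = M" using ex_mset by blast
  have len: "length L = n" if "mset L = M" for L using that by (auto simp: n_def)
  have orb: "(\<lambda>u. act u L) ` {u. u permutes {..<n}} = ?O" if L: "mset L = M" for L
  proof (intro equalityI subsetI)
    fix L' assume "L' \<in> (\<lambda>u. act u L) ` {u. u permutes {..<n}}"
    then obtain u where "u permutes {..<n}" "L' = act u L" by blast
    then show "L' \<in> ?O" using L len[OF L] tuple_act_mset(1)[of u L] by (simp add: act_def)
  next
    fix L' assume "L' \<in> ?O"
    then have "mset L' = mset L" using L by simp
    then obtain p where p: "p permutes {..<length L}" "permute_list p L = L'" by (rule mset_eq_permutation)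
    then have "L' = act (inv p) L" using len[OF L] by (simp add: act_def tuple_act_def permutes_inv_inv)
    moreover have "inv p permutes {..<n}" using p(1) len[OF L] permutes_inv by auto
    ultimately show "L' \<in> (\<lambda>u. act u L) ` {u. u permutes {..<n}}" by blast
  qed
  have os: "card ?O * card (stabilizer L) = fact n" if L: "mset L = M" for L
  proof -
    have "card ((\<lambda>u. act u L) ` {u. u permutes {..<n}}) * card {u. u permutes {..<n} \<and> act u L = L}
        = fact (card {..<n})"
    proof (rule orbit_stabilizer)
      fix u v and K :: "'a list" assume "u permutes {..<n}" "v permutes {..<n}"
      then show "act (u \<circ> v) K = act u (act v K)"
        using tuple_act_compose[of u K v] tuple_act_mset(3)[of v K] by (auto simp: act_def)
    next
      fix K :: "'a list"
      show "act id K = K" by (simp only: act_def tuple_act_id if_cancel)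
    qed simp
    moreover have "{u. u permutes {..<n} \<and> act u L = L} = stabilizer L"
      using len[OF L] tuple_act_eq_iff[of _ L] by (auto simp: act_def stabilizer_def)
    ultimately show ?thesis using orb[OF L] by simp
  qed
  have "card ?O > 0" using os[OF L0] by (metis fact_nonzero gr0I mult_is_0)
  then have "card (stabilizer L) = card (stabilizer L0)" if "mset L = M" for L
    using os[OF that] os[OF L0] by (metis less_not_refl mult_left_cancel)
  then have "(\<Sum>L\<in>?O. card (stabilizer L)) = card ?O * card (stabilizer L0)" by simp
  then show ?thesis using os[OF L0] by (simp add: n_def)
qed

section \<open>Multisets of signed labels\<close>

lemma count_image_mset_inj: "inj f \<Longrightarrow> count (image_mset f M) (f x) = count M x"
  by (induction M) (auto dest: injD)

definition signed_block :: "nat \<Rightarrow> int \<Rightarrow> 'k \<Rightarrow> ('k \<times> int \<times> nat) multiset set" where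
  "signed_block a s k = {N. (\<forall>x\<in>#N. fst x = k \<and> fst (snd x) \<in> {-1, 1}) \<and> size N = a \<and>
     (\<Prod>x\<in>#N. fst (snd x)) = s \<and> (\<forall>x. fst (snd x) = -1 \<longrightarrow> count N x \<le> 1)}"

text \<open>A block splits into the multiset \<open>H\<close> of its positive and the set \<open>E\<close> of its negative entries,
  which are counted by \<open>h\<close> and \<open>e\<close>.\<close>

lemma mcoeff_sym_P_eq_card_block:
  assumes "a > 0" "s \<in> {-1, 1}"
  shows "finite {N \<in> signed_block a s k. image_mset (snd \<circ> snd) N = m} \<and>
    mcoeff (sym_P a) m = of_nat (card {N \<in> signed_block a s k. image_mset (snd \<circ> snd) N = m})"
proof -
  let ?B = "{N \<in> signed_block a s k. image_mset (snd \<circ> snd) N = m}"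
  let ?D = "{(H, E) \<in> msplits m. size m = a \<and> even (size E) = (s = 1) \<and> (\<forall>i. count E i \<le> 1)}"
  let ?f = "\<lambda>(H, E). image_mset (\<lambda>v. (k, 1, v)) H + image_mset (\<lambda>v. (k, -1, v)) E :: ('a \<times> int \<times> nat) multiset"
  let ?g = "\<lambda>N. (image_mset (snd \<circ> snd) (filter_mset (\<lambda>x. fst (snd x) = 1) N),
      image_mset (snd \<circ> snd) (filter_mset (\<lambda>x. fst (snd x) \<noteq> 1) N))"
  have bij: "bij_betw ?f ?D ?B"
  proof (rule bij_betw_byWitness[where f' = ?g])
    show "\<forall>t\<in>?D. ?g (?f t) = t"
      by (auto simp: filter_mset_image_mset image_mset.compositionality o_def)
    show "\<forall>N\<in>?B. ?f (?g N) = N"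
    proof
      fix N assume "N \<in> ?B"
      then have N: "\<forall>x\<in>#N. fst x = k \<and> fst (snd x) \<in> {-1, 1}" by (simp add: signed_block_def)
      have "image_mset (\<lambda>v. (k, 1, v)) (image_mset (snd \<circ> snd) (filter_mset (\<lambda>x. fst (snd x) = 1) N))
          = image_mset (\<lambda>x. x) (filter_mset (\<lambda>x. fst (snd x) = 1) N)"
        unfolding image_mset.compositionality by (rule image_mset_cong) (use N in auto)
      moreover have "image_mset (\<lambda>v. (k, -1, v)) (image_mset (snd \<circ> snd) (filter_mset (\<lambda>x. fst (snd x) \<noteq> 1) N))
          = image_mset (\<lambda>x. x) (filter_mset (\<lambda>x. fst (snd x) \<noteq> 1) N)"
        unfolding image_mset.compositionality by (rule image_mset_cong) (use N in fastforce)
      ultimately show "?f (?g N) = N" by (simp flip: multiset_partition)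
    qed
    show "?f ` ?D \<subseteq> ?B"
    proof (rule image_subsetI)
      fix t assume "t \<in> ?D"
      then obtain H E where t: "t = (H, E)" and HE: "H + E = m" "size m = a" "even (size E) = (s = 1)"
        and E: "\<forall>i. count E i \<le> 1" by auto
      have "(\<Prod>x\<in>#?f t. fst (snd x)) = (-1) ^ size E"
        by (simp add: t image_mset.compositionality o_def)
      also have "\<dots> = s" using HE(3) assms(2) by (cases "even (size E)") auto
      finally have "(\<Prod>x\<in>#?f t. fst (snd x)) = s" .
      moreover have "count (?f t) x \<le> 1" if neg: "fst (snd x) = -1" for x
      proof -
        obtain k' v where x: "x = (k', -1, v)" using neg by (cases x) auto
        have "count (image_mset (\<lambda>v. (k, 1 :: int, v)) H) x = 0" by (auto simp: x count_eq_zero_iff)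
        moreover have "count (image_mset (\<lambda>v. (k, -1 :: int, v)) E) x \<le> 1"
        proof (cases "k' = k")
          case True
          have "count (image_mset (\<lambda>v. (k, -1 :: int, v)) E) ((\<lambda>v. (k, -1, v)) v) = count E v"
            by (rule count_image_mset_inj) (auto simp: inj_def)
          then show ?thesis using E True x by simp
        next
          case False
          then have "count (image_mset (\<lambda>v. (k, -1 :: int, v)) E) x = 0" by (auto simp: x count_eq_zero_iff)
          then show ?thesis by simp
        qed
        ultimately show ?thesis by (simp add: t)
      qed
      ultimately show "?f t \<in> ?B"
        using HE by (auto simp: t signed_block_def image_mset.compositionality o_def)
    qed
    show "?g ` ?B \<subseteq> ?D"
    proof (rule image_subsetI)
      fix N assume N: "N \<in> ?B"
      let ?H = "filter_mset (\<lambda>x. fst (snd x) = 1) N" and ?E = "filter_mset (\<lambda>x. fst (snd x) \<noteq> 1) N"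
      have split: "image_mset (snd \<circ> snd) ?H + image_mset (snd \<circ> snd) ?E = m"
        using N by (simp flip: image_mset_union multiset_partition)
      moreover have "size m = a" using N by (auto simp: signed_block_def)
      moreover have "even (size ?E) = (s = 1)"
      proof -
        have "s = (\<Prod>x\<in>#?H + ?E. fst (snd x))" using N by (simp add: signed_block_def flip: multiset_partition)
        also have "\<dots> = (\<Prod>x\<in>#?H. 1) * (\<Prod>x\<in>#?E. -1)"
          unfolding image_mset_union prod_mset_Un
          by (intro arg_cong2[where f = "(*)"] arg_cong[where f = prod_mset] image_mset_cong)
            (use N in \<open>auto simp: signed_block_def\<close>)
        finally show ?thesis by (cases "even (size ?E)") auto
      qed
      moreover have "count (image_mset (snd \<circ> snd) ?E) v \<le> 1" for v
      proof -
        have "?E = image_mset (\<lambda>v. (k, -1, v)) (image_mset (snd \<circ> snd) ?E)"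
        proof -
          have "image_mset (\<lambda>v. (k, -1, v)) (image_mset (snd \<circ> snd) ?E) = image_mset (\<lambda>x. x) ?E"
            unfolding image_mset.compositionality
            by (rule image_mset_cong) (use N in \<open>fastforce simp: signed_block_def\<close>)
          then show ?thesis by simp
        qed
        then have "count ?E (k, -1, v) = count (image_mset (\<lambda>v. (k, -1 :: int, v)) (image_mset (snd \<circ> snd) ?E)) ((\<lambda>v. (k, -1, v)) v)"
          by simp
        also have "\<dots> = count (image_mset (snd \<circ> snd) ?E) v"
          by (rule count_image_mset_inj) (auto simp: inj_def)
        finally have "count (image_mset (snd \<circ> snd) ?E) v = count N (k, -1, v)" by simp
        then show ?thesis using N by (simp add: signed_block_def)
      qed
      ultimately show "?g N \<in> ?D" by simp
    qed
  qed
  have finD: "finite ?D" by (rule finite_subset[OF _ finite_msplits[of m]]) auto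
  then have finB: "finite ?B" using bij_betw_finite[OF bij] by simp
  \<comment> \<open>The index i counts the negative entries; its parity is dictated by their product
    s.\<close>
  let ?I = "{i. i \<le> a \<and> even i = (s = 1)}"
  have "mcoeff (sym_P a) m = (\<Sum>i\<in>?I. mcoeff (sym_h (a - i) * sym_e i) m)"
    using sym_P_parity[OF assms(1), of "s = 1", symmetric] by (simp add: mcoeff_sum)
  also have "\<dots> = (\<Sum>i\<in>?I. \<Sum>t\<in>msplits m. case t of (H, E) \<Rightarrow>
      if size H = a - i \<and> size E = i \<and> (\<forall>j. count E j \<le> 1) then 1 else 0)"
    by (intro sum.cong refl) (auto simp: mcoeff_mult sym_h.rep_eq sym_e.rep_eq intro!: sum.cong)
  also have "\<dots> = (\<Sum>t\<in>msplits m. \<Sum>i\<in>?I. case t of (H, E) \<Rightarrow>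
      if size H = a - i \<and> size E = i \<and> (\<forall>j. count E j \<le> 1) then 1 else 0)"
    by (rule sum.swap)
  also have "\<dots> = (\<Sum>t\<in>msplits m. if t \<in> ?D then 1 else 0)"
  proof (rule sum.cong)
    fix t assume "t \<in> msplits m"
    then obtain H E where t: "t = (H, E)" "H + E = m" by (cases t) auto
    then have sz: "size m = size H + size E" by auto
    have "(\<Sum>i\<in>?I. case t of (H, E) \<Rightarrow> if size H = a - i \<and> size E = i \<and> (\<forall>j. count E j \<le> 1) then 1 else 0)
        = (\<Sum>i\<in>?I. if i = size E then (if size m = a \<and> (\<forall>j. count E j \<le> 1) then 1 else 0) else (0 :: complex))"
      by (rule sum.cong) (auto simp: t(1) sz)
    also have "\<dots> = (if t \<in> ?D then 1 else 0)" using t sz by auto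
    finally show "(\<Sum>i\<in>?I. case t of (H, E) \<Rightarrow> if size H = a - i \<and> size E = i \<and> (\<forall>j. count E j \<le> 1) then 1 else 0)
        = (if t \<in> ?D then 1 else (0 :: complex))" .
  qed simp
  also have "\<dots> = of_nat (card ?D)"
  proof -
    have "msplits m \<inter> {t. t \<in> ?D} = ?D" by auto
    then show ?thesis by (simp add: sum.If_cases)
  qed
  also have "card ?D = card ?B" by (rule bij_betw_same_card[OF bij])
  finally show ?thesis using finB by blast
qed

text \<open>A label is a triple (value, sign, variable). These are the label multisets of a triple
  sorting to (p, \<epsilon>, \<tau>) zipped with a word of content m.\<close>

definition signed_words :: "nat list \<Rightarrow> (nat \<Rightarrow> int) \<Rightarrow> nat multiset \<Rightarrow> (nat \<times> int \<times> nat) multiset set" where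
  "signed_words p \<epsilon> m = {M. image_mset fst M = mset p \<and> (\<forall>x\<in>#M. fst (snd x) \<in> {-1, 1}) \<and>
     image_mset (snd \<circ> snd) M = m \<and>
     (\<forall>k\<in>set p. (\<Prod>x\<in>#filter_mset (\<lambda>x. fst x = k) M. fst (snd x)) = \<epsilon> k)}"

text \<open>Grouping the labels by value splits the multiset into independent blocks, one for each
  value k of p. The block of k has \<open>count_list p k\<close> labels with sign product
  \<epsilon>_k, and P of that size counts it for either sign.\<close>

lemma card_signed_words:
  assumes "\<And>k. k \<in> set p \<Longrightarrow> \<epsilon> k \<in> {-1, 1}"
  shows "mcoeff (\<Prod>k\<in>set p. sym_P (count_list p k)) m
    = of_nat (card {M \<in> signed_words p \<epsilon> m. \<forall>x. fst (snd x) = -1 \<longrightarrow> count M x \<le> 1})"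
proof -
  let ?Y = "\<lambda>k. signed_block (count_list p k) (\<epsilon> k) k :: (nat \<times> int \<times> nat) multiset set"
  let ?G = "{g \<in> PiE (set p) ?Y. (\<Sum>k\<in>set p. image_mset (snd \<circ> snd) (g k)) = m}"
  let ?M = "{M \<in> signed_words p \<epsilon> m. \<forall>x. fst (snd x) = -1 \<longrightarrow> count M x \<le> 1}"
  have pos: "count_list p k > 0" if "k \<in> set p" for k using that by (simp add: count_list_mset)
  have "mcoeff (\<Prod>k\<in>set p. sym_P (count_list p k)) m = of_nat (card ?G)"
  proof (rule mcoeff_prod_card[THEN conjunct2])
    fix k a assume k: "k \<in> set p"
    note blk = mcoeff_sym_P_eq_card_block[OF pos[OF k] assms[OF k], of k a]
    show "finite {N \<in> ?Y k. image_mset (snd \<circ> snd) N = a}" using blk by (rule conjunct1)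
    show "mcoeff (sym_P (count_list p k)) a = of_nat (card {N \<in> ?Y k. image_mset (snd \<circ> snd) N = a})"
      using blk by (rule conjunct2)
  qed simp
  also have "card ?G = card ?M"
  proof (rule bij_betw_same_card)
    have im: "image_mset h (\<Sum>k\<in>S. f k) = (\<Sum>k\<in>S. image_mset h (f k))"
      for h :: "nat \<times> int \<times> nat \<Rightarrow> nat" and f :: "nat \<Rightarrow> (nat \<times> int \<times> nat) multiset" and S
      by (induction S rule: infinite_finite_induct) auto
    have filt: "filter_mset (\<lambda>x. fst x = k) (\<Sum>j\<in>S. g j) = (if k \<in> S then g k else {#})"
      if "finite S" "\<And>j x. j \<in> S \<Longrightarrow> x \<in># g j \<Longrightarrow> fst x = j" for g k and S :: "nat set"
      using that
    proof (induction S)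
      case (insert j S)
      have "filter_mset (\<lambda>x. fst x = k) (g j) = filter_mset (\<lambda>_. j = k) (g j)"
        using insert.prems[of j] by (intro filter_mset_cong) auto
      then have "filter_mset (\<lambda>x. fst x = k) (g j) = (if j = k then g j else {#})" by simp
      then show ?case using insert by auto
    qed simp
    show "bij_betw (\<lambda>g. \<Sum>k\<in>set p. g k) ?G ?M"
    proof (rule bij_betw_byWitness[where f' = "\<lambda>M. restrict (\<lambda>k. filter_mset (\<lambda>x. fst x = k) M) (set p)"])
      have blk: "fst x = j" if "g \<in> ?G" "j \<in> set p" "x \<in># g j" for g j x
        using that by (auto simp: signed_block_def PiE_def Pi_def)
      have flt: "filter_mset (\<lambda>x. fst x = k) (\<Sum>j\<in>set p. g j) = g k" if "g \<in> ?G" "k \<in> set p" for g k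
        using filt[of "set p" g k] blk[OF that(1)] that(2) by auto
      show "\<forall>g\<in>?G. restrict (\<lambda>k. filter_mset (\<lambda>x. fst x = k) (\<Sum>k\<in>set p. g k)) (set p) = g"
      proof
        fix g assume g: "g \<in> ?G"
        show "restrict (\<lambda>k. filter_mset (\<lambda>x. fst x = k) (\<Sum>k\<in>set p. g k)) (set p) = g"
        proof
          fix k show "restrict (\<lambda>k. filter_mset (\<lambda>x. fst x = k) (\<Sum>k\<in>set p. g k)) (set p) k = g k"
            using flt[OF g, of k] g by (cases "k \<in> set p") (auto simp: PiE_def extensional_def)
        qed
      qed
      have decomp: "(\<Sum>k\<in>set p. filter_mset (\<lambda>x. fst x = k) M) = M" if "fst ` set_mset M \<subseteq> set p" for M :: "(nat \<times> int \<times> nat) multiset"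
      proof (rule multiset_eqI)
        fix x
        have "count (\<Sum>k\<in>set p. filter_mset (\<lambda>x. fst x = k) M) x = (\<Sum>k\<in>set p. if k = fst x then count M x else 0)"
          by (auto simp: count_sum intro!: sum.cong)
        also have "\<dots> = (if fst x \<in> set p then count M x else 0)" by simp
        also have "\<dots> = count M x"
        proof (cases "x \<in># M")
          case True
          then have "fst x \<in> set p" using that by auto
          then show ?thesis by simp
        qed (simp add: not_in_iff)
        finally show "count (\<Sum>k\<in>set p. filter_mset (\<lambda>x. fst x = k) M) x = count M x" .
      qed
      have fsts: "fst ` set_mset M \<subseteq> set p" if "M \<in> ?M" for M
      proof -
        have "image_mset fst M = mset p" using that by (simp add: signed_words_def)
        then show ?thesis by (metis set_image_mset set_mset_mset subset_refl)
      qed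
      show "\<forall>M\<in>?M. (\<Sum>k\<in>set p. restrict (\<lambda>k. filter_mset (\<lambda>x. fst x = k) M) (set p) k) = M"
        using decomp fsts by simp
      show "(\<lambda>g. \<Sum>k\<in>set p. g k) ` ?G \<subseteq> ?M"
      proof (rule image_subsetI)
        fix g assume g: "g \<in> ?G"
        let ?S = "\<Sum>k\<in>set p. g k"
        have gk: "g k \<in> ?Y k" if "k \<in> set p" for k using g that by auto
        have mem: "\<exists>k\<in>set p. x \<in># g k" if "x \<in># ?S" for x
          using that by (auto simp: set_mset_sum)
        have "image_mset fst ?S = mset p"
        proof (rule multiset_eqI)
          fix k
          have "count (image_mset fst ?S) k = size (filter_mset (\<lambda>x. fst x = k) ?S)"
            by (simp add: count_conv_size_mset filter_mset_image_mset eq_commute[of k])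
          also have "\<dots> = count (mset p) k"
          proof (cases "k \<in> set p")
            case True
            then show ?thesis using flt[OF g True] gk[OF True] by (simp add: signed_block_def count_list_mset)
          next
            case False
            then have e: "filter_mset (\<lambda>x. fst x = k) ?S = {#}"
              using filt[of "set p" g k] blk[OF g] by auto
            show ?thesis unfolding e using False by simp
          qed
          finally show "count (image_mset fst ?S) k = count (mset p) k" .
        qed
        moreover have "\<forall>x\<in>#?S. fst (snd x) \<in> {-1, 1}"
        proof
          fix x assume "x \<in># ?S"
          then obtain k where "k \<in> set p" "x \<in># g k" using mem by blast
          then show "fst (snd x) \<in> {-1, 1}" using gk[of k] by (auto simp: signed_block_def)
        qed
        moreover have "image_mset (snd \<circ> snd) ?S = m" using g im by simp
        moreover have "(\<Prod>x\<in>#filter_mset (\<lambda>x. fst x = k) ?S. fst (snd x)) = \<epsilon> k" if "k \<in> set p" for k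
          using flt[OF g that] gk[OF that] by (simp add: signed_block_def)
        moreover have "count ?S x \<le> 1" if "fst (snd x) = -1" for x
        proof (cases "fst x \<in> set p")
          case True
          have "count ?S x = count (filter_mset (\<lambda>y. fst y = fst x) ?S) x" by simp
          also have "\<dots> = count (g (fst x)) x" using flt[OF g True] by simp
          also have "\<dots> \<le> 1" using gk[OF True] that unfolding signed_block_def by blast
          finally show ?thesis .
        next
          case False
          then have "x \<notin># ?S" using mem blk[OF g] by metis
          then show ?thesis by (simp add: not_in_iff)
        qed
        ultimately show "?S \<in> ?M" by (simp add: signed_words_def)
      qed
      show "(\<lambda>M. restrict (\<lambda>k. filter_mset (\<lambda>x. fst x = k) M) (set p)) ` ?M \<subseteq> ?G"
      proof (rule image_subsetI)
        fix M assume M: "M \<in> ?M"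
        have "filter_mset (\<lambda>x. fst x = k) M \<in> ?Y k" if "k \<in> set p" for k
        proof -
          have "size (filter_mset (\<lambda>x. fst x = k) M) = count (image_mset fst M) k"
            by (simp add: count_conv_size_mset filter_mset_image_mset eq_commute[of k])
          also have "\<dots> = count_list p k" using M by (simp add: signed_words_def count_list_mset)
          finally show ?thesis using M that by (auto simp: signed_block_def signed_words_def)
        qed
        moreover have "(\<Sum>k\<in>set p. image_mset (snd \<circ> snd) (filter_mset (\<lambda>x. fst x = k) M)) = m"
        proof -
          have "image_mset (snd \<circ> snd) (\<Sum>k\<in>set p. filter_mset (\<lambda>x. fst x = k) M) = m"
            using decomp[OF fsts[OF M]] M by (simp add: signed_words_def)
          then show ?thesis by (simp only: im)
        qed
        ultimately show "restrict (\<lambda>k. filter_mset (\<lambda>x. fst x = k) M) (set p) \<in> ?G" by simp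
      qed
    qed
  qed
  finally show ?thesis .
qed

section \<open>The Frobenius character\<close>

lemma sym_V_shape:
  assumes "p \<in> Pf n" shows "sym_V (shape p) = (\<Prod>k\<in>set p. sym_P (count_list p k))"
proof -
  have len: "length p = n" and sub: "set p \<subseteq> {1..n}" using assms by (auto simp: Pf_iff_luk)
  have "sym_V (shape p) = (\<Prod>a\<leftarrow>content p. sym_P a)"
    unfolding sym_V_def by (rule prod_mset_shape) (simp add: sym_P_def)
  also have "\<dots> = (\<Prod>k\<in>{1..<n + 1}. sym_P (count_list p k))"
    by (simp add: content_def o_def len prod.distinct_set_conv_list[symmetric] del: upt_Suc)
  also have "\<dots> = (\<Prod>k\<in>set p. sym_P (count_list p k))"
    by (rule prod.mono_neutral_right) (use sub in \<open>auto simp: count_list_0_iff sym_P_def\<close>)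
  finally show ?thesis .
qed

lemma signed_words_lists:
  assumes "mset L \<in> signed_words p \<epsilon> m"
  shows "length L = length p" "mset (map fst L) = mset p" "set (map (fst \<circ> snd) L) \<subseteq> {-1, 1}"
    "mset (map (snd \<circ> snd) L) = m" "L = zip (map fst L) (zip (map (fst \<circ> snd) L) (map (snd \<circ> snd) L))"
proof -
  show "mset (map fst L) = mset p" "mset (map (snd \<circ> snd) L) = m"
    using assms by (simp_all add: signed_words_def)
  then show "length L = length p" by (metis length_map mset_eq_length)
  show "set (map (fst \<circ> snd) L) \<subseteq> {-1, 1}" using assms by (auto simp: signed_words_def)
  show "L = zip (map fst L) (zip (map (fst \<circ> snd) L) (map (snd \<circ> snd) L))"
    by (rule nth_equalityI) auto
qed

lemma finite_signed_words_lists: "finite {L. mset L \<in> signed_words p \<epsilon> m}"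
proof (rule finite_subset)
  show "{L. mset L \<in> signed_words p \<epsilon> m}
      \<subseteq> {L. set L \<subseteq> set p \<times> {-1, 1} \<times> set_mset m \<and> length L = length p}"
  proof
    fix L assume "L \<in> {L. mset L \<in> signed_words p \<epsilon> m}"
    then have L: "mset L \<in> signed_words p \<epsilon> m" by simp
    have "x \<in> set p \<times> {-1, 1} \<times> set_mset m" if "x \<in> set L" for x
    proof -
      have "fst x \<in> set (map fst L)" using that by simp
      then have 1: "fst x \<in> set p" unfolding mset_eq_setD[OF signed_words_lists(2)[OF L]] .
      have 2: "fst (snd x) \<in> {-1, 1}" using signed_words_lists(3)[OF L] that by auto
      have "snd (snd x) \<in> set (map (snd \<circ> snd) L)" using that by force
      then have "snd (snd x) \<in># mset (map (snd \<circ> snd) L)" by (simp only: set_mset_mset)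
      then have "snd (snd x) \<in># m" unfolding signed_words_lists(4)[OF L] .
      with 1 2 show ?thesis by (cases x) auto
    qed
    then show "L \<in> {L. set L \<subseteq> set p \<times> {-1, 1} \<times> set_mset m \<and> length L = length p}"
      using signed_words_lists(1)[OF L] by blast
  qed
qed (intro finite_lists_length_eq finite_cartesian_product; simp)

lemma mset_zip_in_signed_words_iff:
  assumes "length p = length q" "length \<sigma> = length q" "length f = length q"
  shows "mset (zip p (zip \<sigma> f)) \<in> signed_words q \<epsilon> m \<longleftrightarrow>
    mset p = mset q \<and> set \<sigma> \<subseteq> {-1, 1} \<and> mset f = m \<and> (\<forall>k\<in>set q. bar p \<sigma> k = \<epsilon> k)"
proof (cases "mset p = mset q")
  case True
  let ?L = "zip p (zip \<sigma> f)"
  have 1: "image_mset fst (mset ?L) = mset p" using assms by (simp flip: mset_map)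
  have "map (snd \<circ> snd) ?L = f" using assms by (intro nth_equalityI) auto
  then have 2: "image_mset (snd \<circ> snd) (mset ?L) = mset f" by (simp flip: mset_map)
  have "map (fst \<circ> snd) ?L = \<sigma>" using assms by (intro nth_equalityI) auto
  then have "set \<sigma> = (fst \<circ> snd) ` set ?L" by (metis set_map)
  then have 3: "(\<forall>x\<in>#mset ?L. fst (snd x) \<in> {-1, 1}) \<longleftrightarrow> set \<sigma> \<subseteq> {-1, 1}" by auto
  have "map (\<lambda>x. (fst x, fst (snd x))) ?L = zip p \<sigma>" using assms by (intro nth_equalityI) auto
  then have z: "mset (zip p \<sigma>) = image_mset (\<lambda>x. (fst x, fst (snd x))) (mset ?L)" by (metis mset_map)
  have 4: "(\<Prod>x\<in>#filter_mset (\<lambda>x. fst x = k) (mset ?L). fst (snd x)) = bar p \<sigma> k" if "k \<in> set q" for k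
  proof -
    have "k \<in> set p" using True that mset_eq_setD by blast
    then have "bar p \<sigma> k = (\<Prod>x\<in>#filter_mset (\<lambda>x. fst x = k) (mset (zip p \<sigma>)). snd x)"
      using bar_eq_prod_mset[of \<sigma> p k] assms by simp
    then show ?thesis unfolding z by (simp add: filter_mset_image_mset image_mset.compositionality o_def)
  qed
  show ?thesis unfolding signed_words_def using True 1 2 3 4 by auto
next
  case False
  have "image_mset fst (mset (zip p (zip \<sigma> f))) = mset p" using assms by (simp flip: mset_map)
  with False show ?thesis by (simp add: signed_words_def)
qed

text \<open>Membership in \<open>OShPf\<close> sees p only through its multiset and \<sigma> only
  through \<open>bar\<close>, and off the values both sign vectors are 0. Fixing the sorted triple
  thus already guarantees every matching condition.\<close>

lemma OShPf_fiber_iff: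
  assumes p0: "p0 \<in> Pf n" "sorted p0" "odd_partition (shape p0)"
    and st: "(\<epsilon>, \<tau>) \<in> arc_structs {-1, 1} (set p0)"
  shows "(p, \<sigma>, \<tau>') \<in> OShPf n \<and> sort_shpf (p, \<sigma>, \<tau>') = (p0, map \<epsilon> [1..<n + 1], \<tau>) \<longleftrightarrow>
    \<tau>' = \<tau> \<and> mset p = mset p0 \<and> length \<sigma> = n \<and> set \<sigma> \<subseteq> {-1, 1} \<and> (\<forall>k\<in>set p0. bar p \<sigma> k = \<epsilon> k)"
proof
  have len0: "length p0 = n" and sub0: "set p0 \<subseteq> {1..n}" using p0 by (auto simp: Pf_iff_luk)
  {
    assume L: "(p, \<sigma>, \<tau>') \<in> OShPf n \<and> sort_shpf (p, \<sigma>, \<tau>') = (p0, map \<epsilon> [1..<n + 1], \<tau>)"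
    then have len: "length p = n" by (simp add: OShPf_iff Pf_def)
    have "sort p = p0" and e: "map (bar p \<sigma>) [1..<n + 1] = map \<epsilon> [1..<n + 1]" and "\<tau>' = \<tau>"
      using L len by (simp_all add: bar_tuple_def del: upt_Suc)
    moreover have "bar p \<sigma> k = \<epsilon> k" if "k \<in> set p0" for k
    proof -
      have "k \<in> set [1..<n + 1]" using that sub0 by auto
      with e show ?thesis by (metis map_eq_conv)
    qed
    moreover have "mset p = mset p0" using \<open>sort p = p0\<close> by auto
    ultimately show "\<tau>' = \<tau> \<and> mset p = mset p0 \<and> length \<sigma> = n \<and> set \<sigma> \<subseteq> {-1, 1} \<and> (\<forall>k\<in>set p0. bar p \<sigma> k = \<epsilon> k)"
      using L by (simp add: OShPf_iff)
  }
  {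
    assume R: "\<tau>' = \<tau> \<and> mset p = mset p0 \<and> length \<sigma> = n \<and> set \<sigma> \<subseteq> {-1, 1} \<and> (\<forall>k\<in>set p0. bar p \<sigma> k = \<epsilon> k)"
    then have ms: "mset p = mset p0" by blast
    have set_eq: "set p = set p0" and len: "length p = n"
      using mset_eq_setD[OF ms] mset_eq_length[OF ms] len0 by auto
    have "sign_map (set p0) \<epsilon>" using st by (simp add: arc_structs_def)
    then have "bar p \<sigma> k = \<epsilon> k" for k
      using R set_eq by (cases "k \<in> set p0") (auto simp: bar_def count_list_0_iff sign_map_def)
    then have bar: "bar p \<sigma> = \<epsilon>" by blast
    have "p \<in> Pf n" "shape p = shape p0" using Pf_mset_cong[OF ms] shape_mset_cong[OF ms] p0 by auto
    then have "(p, \<sigma>, \<tau>') \<in> OShPf n" unfolding OShPf_iff bar using R st p0 set_eq by simp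
    moreover have "sort p = p0" using sort_mset_cong[OF ms] p0(2) by (simp add: sorted_sort_id)
    ultimately show "(p, \<sigma>, \<tau>') \<in> OShPf n \<and> sort_shpf (p, \<sigma>, \<tau>') = (p0, map \<epsilon> [1..<n + 1], \<tau>)"
      using R len by (simp add: bar_tuple_def bar del: upt_Suc)
  }
qed

lemma mem_stabilizer_zip:
  assumes "length p = n" "length \<sigma> = n" "length f = n"
  shows "w \<in> stabilizer (zip p (zip \<sigma> f)) \<longleftrightarrow> w permutes {..<n} \<and>
    tuple_act w p = p \<and> tuple_act w \<sigma> = \<sigma> \<and> (\<forall>i<n. f ! w i = f ! i)"
proof (cases "w permutes {..<n}")
  case True
  then have "w i < n" if "i < n" for i using permutes_in_image[OF True, of i] that by simp
  then show ?thesis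
    using True assms tuple_act_eq_iff[of w p] tuple_act_eq_iff[of w \<sigma>] by (auto simp: stabilizer_def)
qed (use assms in \<open>auto simp: stabilizer_def\<close>)

text \<open>The outcome of \<open>sum_sign_stabilizer\<close> when N singles out the negative
  labels.\<close>

definition signed_stabilizer_count :: "(nat \<times> int \<times> nat) list \<Rightarrow> nat" where
  "signed_stabilizer_count L = (if \<forall>x. fst (snd x) = -1 \<longrightarrow> count (mset L) x \<le> 1 then card (stabilizer L) else 0)"

text \<open>Whether a negative label repeats depends only on the multiset of labels, so the sum over
  the words of one multiset is either 0 or the full n!.\<close>

lemma sum_signed_stabilizer_count:
  "(\<Sum>L | mset L \<in> signed_words p \<epsilon> m. signed_stabilizer_count L)
    = fact (length p) * card {M \<in> signed_words p \<epsilon> m. \<forall>x. fst (snd x) = -1 \<longrightarrow> count M x \<le> 1}"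
proof -
  let ?W = "signed_words p \<epsilon> m"
  let ?A = "{L. mset L \<in> ?W}"
  let ?d = "\<lambda>M :: (nat \<times> int \<times> nat) multiset. \<forall>x. fst (snd x) = -1 \<longrightarrow> count M x \<le> 1"
  note fin = finite_signed_words_lists[of p \<epsilon> m]
  have im: "mset ` ?A = ?W"
  proof (intro equalityI subsetI)
    fix M assume M: "M \<in> ?W"
    obtain L where "mset L = M" using ex_mset by blast
    with M show "M \<in> mset ` ?A" by blast
  qed auto
  have finW: "finite ?W" using finite_imageI[OF fin, of mset] im by simp
  have "(\<Sum>L\<in>?A. signed_stabilizer_count L) = (\<Sum>M\<in>?W. \<Sum>L | L \<in> ?A \<and> mset L = M. signed_stabilizer_count L)"
    using sum.image_gen[OF fin, of signed_stabilizer_count mset] unfolding im .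
  also have "\<dots> = (\<Sum>M\<in>?W. if ?d M then fact (length p) else 0)"
  proof (rule sum.cong)
    fix M assume M: "M \<in> ?W"
    have "image_mset fst M = mset p" using M by (simp add: signed_words_def)
    then have size: "size M = length p" by (metis size_image_mset size_mset)
    have "(\<Sum>L | L \<in> ?A \<and> mset L = M. signed_stabilizer_count L) = (\<Sum>L | mset L = M. if ?d M then card (stabilizer L) else 0)"
      by (rule sum.cong) (use M in \<open>auto simp: signed_stabilizer_count_def\<close>)
    also have "\<dots> = (if ?d M then fact (size M) else 0)"
    proof (cases "?d M")
      case True
      show ?thesis unfolding if_P[OF True] by (rule sum_card_stabilizer)
    next
      case False
      show ?thesis unfolding if_not_P[OF False] by simp
    qed
    finally show "(\<Sum>L | L \<in> ?A \<and> mset L = M. signed_stabilizer_count L) = (if ?d M then fact (length p) else 0)"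
      unfolding size .
  qed simp
  also have "\<dots> = fact (length p) * card {M \<in> ?W. ?d M}"
  proof -
    have "?W \<inter> {M. ?d M} = {M \<in> ?W. ?d M}" by blast
    then show ?thesis using finW by (simp add: sum.If_cases)
  qed
  finally show ?thesis .
qed

text \<open>Zipping p, \<sigma> and the word f of variables turns the fibre into the set of all
  words whose label multiset lies in \<open>signed_words\<close>; each admissible multiset then
  weighs n!.\<close>

lemma sum_OShPf_fiber:
  assumes "s \<in> sorted_OShPf n"
  shows "(\<Sum>t | t \<in> OShPf n \<and> sort_shpf t = s. case t of (p, \<sigma>, \<tau>) \<Rightarrow>
      \<Sum>f | length f = n \<and> mset f = m. of_nat (signed_stabilizer_count (zip p (zip \<sigma> f))))
    = fact n * mcoeff (sym_V (shape (fst s))) m"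
proof -
  obtain p0 \<epsilon> \<tau> where s: "s = (p0, map \<epsilon> [1..<n + 1], \<tau>)"
    and p0: "p0 \<in> Pf n" "sorted p0" "odd_partition (shape p0)"
    and st: "(\<epsilon>, \<tau>) \<in> arc_structs {-1, 1} (set p0)"
    using assms sorted_OShPf_iff by (cases s) (auto simp del: upt_Suc)
  have len0: "length p0 = n" using p0 by (simp add: Pf_def)
  let ?T = "{t. t \<in> OShPf n \<and> sort_shpf t = s}"
  let ?F = "{f :: nat list. length f = n \<and> mset f = m}"
  have finT: "finite ?T" by (rule finite_subset[OF _ finite_OShPf[of n]]) auto
  have finF: "finite ?F"
    by (rule finite_subset[OF _ finite_lists_length_eq[of "set_mset m" n]]) (auto simp flip: set_mset_mset)
  define enc :: "shpf \<times> nat list \<Rightarrow> (nat \<times> int \<times> nat) list"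
    where "enc = (\<lambda>((p, \<sigma>, \<tau>), f). zip p (zip \<sigma> f))"
  have "(\<Sum>t\<in>?T. case t of (p, \<sigma>, \<tau>) \<Rightarrow> \<Sum>f\<in>?F. of_nat (signed_stabilizer_count (zip p (zip \<sigma> f))))
      = (\<Sum>t\<in>?T. \<Sum>f\<in>?F. of_nat (signed_stabilizer_count (enc (t, f))) :: complex)"
    by (rule sum.cong) (auto simp: enc_def)
  also have "\<dots> = (\<Sum>x\<in>?T \<times> ?F. of_nat (signed_stabilizer_count (enc x)))"
    by (simp add: sum.cartesian_product)
  also have "\<dots> = (\<Sum>L | mset L \<in> signed_words p0 \<epsilon> m. of_nat (signed_stabilizer_count L))"
  \<comment> \<open>Zipping forgets the matching, but on this fibre it is always \<tau>, so it can
    be restored.\<close>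
  proof (rule sum.reindex_bij_witness[of _
        "\<lambda>L. ((map fst L, map (fst \<circ> snd) L, \<tau>), map (snd \<circ> snd) L)" enc])
    fix x assume "x \<in> ?T \<times> ?F"
    then obtain p \<sigma> \<tau>' f where x: "x = ((p, \<sigma>, \<tau>'), f)" and t: "(p, \<sigma>, \<tau>') \<in> OShPf n \<and> sort_shpf (p, \<sigma>, \<tau>') = s"
      and f: "length f = n" "mset f = m" by (cases x) auto
    note R = t[unfolded s OShPf_fiber_iff[OF p0 st]]
    then have len: "length p = n" using len0 by (metis mset_eq_length)
    have enc: "enc x = zip p (zip \<sigma> f)" by (simp add: x enc_def)
    show "((map fst (enc x), map (fst \<circ> snd) (enc x), \<tau>), map (snd \<circ> snd) (enc x)) = x"
      unfolding enc using R len f by (auto simp: x intro!: nth_equalityI)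
    show "enc x \<in> {L. mset L \<in> signed_words p0 \<epsilon> m}"
      using mset_zip_in_signed_words_iff[of p p0 \<sigma> f \<epsilon> m] R len len0 f by (simp add: enc)
  next
    fix L assume "L \<in> {L. mset L \<in> signed_words p0 \<epsilon> m}"
    then have L: "mset L \<in> signed_words p0 \<epsilon> m" by simp
    note D = signed_words_lists[OF L]
    let ?p = "map fst L" and ?\<sigma> = "map (fst \<circ> snd) L" and ?f = "map (snd \<circ> snd) L"
    show "enc ((?p, ?\<sigma>, \<tau>), ?f) = L" using D(5) by (simp add: enc_def)
    have "\<forall>k\<in>set p0. bar ?p ?\<sigma> k = \<epsilon> k"
      using mset_zip_in_signed_words_iff[of ?p p0 ?\<sigma> ?f \<epsilon> m] D L by simp
    then have "(?p, ?\<sigma>, \<tau>) \<in> OShPf n \<and> sort_shpf (?p, ?\<sigma>, \<tau>) = (p0, map \<epsilon> [1..<n + 1], \<tau>)"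
      unfolding OShPf_fiber_iff[OF p0 st] using D len0 by simp
    then show "((?p, ?\<sigma>, \<tau>), ?f) \<in> ?T \<times> ?F" using D len0 s by simp
  qed simp
  also have "\<dots> = of_nat (\<Sum>L | mset L \<in> signed_words p0 \<epsilon> m. signed_stabilizer_count L)" by simp
  also have "\<dots> = fact n * of_nat (card {M \<in> signed_words p0 \<epsilon> m. \<forall>x. fst (snd x) = -1 \<longrightarrow> count M x \<le> 1})"
    by (simp only: sum_signed_stabilizer_count len0 of_nat_mult of_nat_fact)
  also have "of_nat (card {M \<in> signed_words p0 \<epsilon> m. \<forall>x. fst (snd x) = -1 \<longrightarrow> count M x \<le> 1})
      = mcoeff (\<Prod>k\<in>set p0. sym_P (count_list p0 k)) m"
  proof (rule card_signed_words[symmetric])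
    fix k assume "k \<in> set p0"
    then show "\<epsilon> k \<in> {-1, 1}" using st by (auto simp: arc_structs_def sign_map_def)
  qed
  also have "(\<Prod>k\<in>set p0. sym_P (count_list p0 k)) = sym_V (shape (fst s))"
    using sym_V_shape[OF p0(1)] by (simp add: s)
  finally show ?thesis .
qed

text \<open>Comparing coefficients, the average over the group is exchanged with the sum over
  triples and words of variables. For each triple and word, the group sum is a signed count of a
  stabilizer, and the n! gained on every fibre cancels the denominator of the average.\<close>

lemma frobenius_character_OShPf:
  "frobenius_character n (OShPf_character n) = (\<Sum>(p, \<sigma>, \<tau>)\<in>sorted_OShPf n. sym_V (shape p))"
proof (rule mseries_eqI)
  fix m
  let ?G = "{w. w permutes {..<n}}"
  let ?F = "{f :: nat list. length f = n \<and> mset f = m}"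
  let ?L = "\<lambda>p \<sigma> f. zip p (zip \<sigma> f) :: (nat \<times> int \<times> nat) list"
  let ?sg = "\<lambda>w \<sigma>. of_int (sign (perm_restrict w (neg_pos \<sigma>))) :: complex"
  have finG: "finite ?G" by (rule finite_permutations) simp
  have finF: "finite ?F"
    by (rule finite_subset[OF _ finite_lists_length_eq[of "set_mset m" n]]) (auto simp flip: set_mset_mset)
  have lens: "length p = n \<and> length \<sigma> = n" if "(p, \<sigma>, \<tau>) \<in> OShPf n" for p \<sigma> \<tau>
    using that by (simp add: OShPf_iff Pf_def)
  \<comment> \<open>A product of fixed-point counts counts jointly fixed pairs, and a triple and a
    word f are both fixed by w exactly when w stabilizes the zipped word.\<close>
  have expand: "OShPf_character n w * mcoeff (sym_p_part (cycle_type n w)) m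
      = (\<Sum>(p, \<sigma>, \<tau>)\<in>OShPf n. \<Sum>f\<in>?F. if w \<in> stabilizer (?L p \<sigma> f) then ?sg w \<sigma> else 0)"
    if w: "w permutes {..<n}" for w
  proof -
    have "mcoeff (sym_p_part (cycle_type n w)) m = (\<Sum>f\<in>?F. if \<forall>i<n. f ! w i = f ! i then 1 else 0)"
    proof -
      have "?F \<inter> {f. \<forall>i<n. f ! w i = f ! i} = {f. length f = n \<and> mset f = m \<and> (\<forall>i<n. f ! w i = f ! i)}"
        by auto
      then show ?thesis using finF by (simp add: mcoeff_sym_p_part_cycle_type[OF w] sum.If_cases)
    qed
    then have "OShPf_character n w * mcoeff (sym_p_part (cycle_type n w)) m
        = (\<Sum>(p, \<sigma>, \<tau>)\<in>OShPf n. \<Sum>f\<in>?F. (if tuple_act w p = p \<and> tuple_act w \<sigma> = \<sigma> then ?sg w \<sigma> else 0)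
            * (if \<forall>i<n. f ! w i = f ! i then 1 else 0))"
      by (simp only: OShPf_character_eq[OF w] sum_product split_def)
    also have "\<dots> = (\<Sum>(p, \<sigma>, \<tau>)\<in>OShPf n. \<Sum>f\<in>?F. if w \<in> stabilizer (?L p \<sigma> f) then ?sg w \<sigma> else 0)"
    proof (rule sum.cong, rule refl, clarify, rule sum.cong, rule refl)
      fix p \<sigma> \<tau> f assume t: "(p, \<sigma>, \<tau>) \<in> OShPf n" and f: "f \<in> ?F"
      show "(if tuple_act w p = p \<and> tuple_act w \<sigma> = \<sigma> then ?sg w \<sigma> else 0)
          * (if \<forall>i<n. f ! w i = f ! i then 1 else 0) = (if w \<in> stabilizer (?L p \<sigma> f) then ?sg w \<sigma> else 0)"
        using mem_stabilizer_zip[of p n \<sigma> f w] lens[OF t] f w by auto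
    qed
    finally show ?thesis .
  qed
  have stab: "(\<Sum>w\<in>?G. if w \<in> stabilizer (?L p \<sigma> f) then ?sg w \<sigma> else 0)
      = of_nat (signed_stabilizer_count (?L p \<sigma> f))" if t: "(p, \<sigma>, \<tau>) \<in> OShPf n" and f: "f \<in> ?F" for p \<sigma> \<tau> f
  proof -
    have len: "length p = n" "length \<sigma> = n" "length f = n" using lens[OF t] f by auto
    then have lenL: "length (?L p \<sigma> f) = n" by simp
    have np: "neg_pos \<sigma> = {i. i < length (?L p \<sigma> f) \<and> fst (snd (?L p \<sigma> f ! i)) = -1}"
      using len by (auto simp: neg_pos_def)
    have "?G \<inter> {w. w \<in> stabilizer (?L p \<sigma> f)} = stabilizer (?L p \<sigma> f)"
      using lenL by (auto simp: stabilizer_def)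
    then have "(\<Sum>w\<in>?G. if w \<in> stabilizer (?L p \<sigma> f) then ?sg w \<sigma> else 0) = (\<Sum>w\<in>stabilizer (?L p \<sigma> f). ?sg w \<sigma>)"
      using finG by (simp add: sum.If_cases)
    also have "\<dots> = of_int (\<Sum>w\<in>stabilizer (?L p \<sigma> f). sign (perm_restrict w {i. i < length (?L p \<sigma> f) \<and> fst (snd (?L p \<sigma> f ! i)) = -1}))"
      by (simp only: np of_int_sum)
    also have "\<dots> = of_nat (signed_stabilizer_count (?L p \<sigma> f))"
      unfolding sum_sign_stabilizer[where N = "\<lambda>x. fst (snd x) = -1"] signed_stabilizer_count_def by simp
    finally show ?thesis .
  qed
  have "(\<Sum>w\<in>?G. OShPf_character n w * mcoeff (sym_p_part (cycle_type n w)) m)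
      = (\<Sum>w\<in>?G. \<Sum>(p, \<sigma>, \<tau>)\<in>OShPf n. \<Sum>f\<in>?F. if w \<in> stabilizer (?L p \<sigma> f) then ?sg w \<sigma> else 0)"
    by (rule sum.cong) (auto simp: expand)
  also have "\<dots> = (\<Sum>t\<in>OShPf n. \<Sum>w\<in>?G. case t of (p, \<sigma>, \<tau>) \<Rightarrow> \<Sum>f\<in>?F. if w \<in> stabilizer (?L p \<sigma> f) then ?sg w \<sigma> else 0)"
    by (rule sum.swap)
  also have "\<dots> = (\<Sum>(p, \<sigma>, \<tau>)\<in>OShPf n. \<Sum>f\<in>?F. of_nat (signed_stabilizer_count (?L p \<sigma> f)))"
  proof (rule sum.cong, rule refl)
    fix t assume "t \<in> OShPf n"
    then obtain p \<sigma> \<tau> where t: "t = (p, \<sigma>, \<tau>)" "(p, \<sigma>, \<tau>) \<in> OShPf n" by (cases t) auto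
    have "(\<Sum>w\<in>?G. \<Sum>f\<in>?F. if w \<in> stabilizer (?L p \<sigma> f) then ?sg w \<sigma> else 0)
        = (\<Sum>f\<in>?F. \<Sum>w\<in>?G. if w \<in> stabilizer (?L p \<sigma> f) then ?sg w \<sigma> else 0)" by (rule sum.swap)
    also have "\<dots> = (\<Sum>f\<in>?F. of_nat (signed_stabilizer_count (?L p \<sigma> f)))"
      by (rule sum.cong) (simp_all only: stab[OF t(2)])
    finally show "(\<Sum>w\<in>?G. case t of (p, \<sigma>, \<tau>) \<Rightarrow> \<Sum>f\<in>?F. if w \<in> stabilizer (?L p \<sigma> f) then ?sg w \<sigma> else 0)
        = (case t of (p, \<sigma>, \<tau>) \<Rightarrow> \<Sum>f\<in>?F. of_nat (signed_stabilizer_count (?L p \<sigma> f)))"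
      unfolding t(1) prod.case .
  qed
  also have "\<dots> = (\<Sum>s\<in>sorted_OShPf n. \<Sum>t | t \<in> OShPf n \<and> sort_shpf t = s.
      case t of (p, \<sigma>, \<tau>) \<Rightarrow> \<Sum>f\<in>?F. of_nat (signed_stabilizer_count (?L p \<sigma> f)))"
    unfolding sorted_OShPf_def by (rule sum.image_gen[OF finite_OShPf])
  also have "\<dots> = (\<Sum>s\<in>sorted_OShPf n. fact n * mcoeff (sym_V (shape (fst s))) m)"
    by (rule sum.cong) (simp_all only: sum_OShPf_fiber)
  finally have "mcoeff (frobenius_character n (OShPf_character n)) m
      = (\<Sum>s\<in>sorted_OShPf n. fact n * mcoeff (sym_V (shape (fst s))) m) / fact n"
    using frobenius_character_average[where n = n and \<chi> = "OShPf_character n" and m = m, OF OShPf_character_conj]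
    by simp
  also have "\<dots> = mcoeff (\<Sum>(p, \<sigma>, \<tau>)\<in>sorted_OShPf n. sym_V (shape p)) m"
    by (simp add: mcoeff_sum split_def sum_distrib_left[symmetric])
  finally show "mcoeff (frobenius_character n (OShPf_character n)) m
      = mcoeff (\<Sum>(p, \<sigma>, \<tau>)\<in>sorted_OShPf n. sym_V (shape p)) m" .
qed

theorem theorem1p2:
  fixes n :: nat
  assumes "n \<ge> 1"
  shows "frobenius_character n (OShPf_character n) = SH n
    \<and> SH n = (\<Sum>(p, \<sigma>, \<tau>)\<in>sorted_OShPf n. sym_V (shape p))"
  by (simp only: frobenius_character_OShPf SH_eq_sum_sorted_OShPf simp_thms)

end
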